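(* There is an algorithm that, given strings $X,Y$ over an alphabet $\Sigma$ of length at most $n$, an integer $k\in \mathbb{Z}_{+}$, and a weight function $w$, computes the value $\mathsf{ed}^w_{\le k}(X,Y)$ in $\mathcal{O}(n+k^5)$ time.
   Context: Let $\bar\Sigma=\Sigma\cup\{\varepsilon\}$, where $\varepsilon$ is the empty string. A weight function is a map $w:\bar\Sigma\times\bar\Sigma\to\mathbb{R}_{\ge 0}$ with $w(a,a)=0$ for all $a$ and $w(a,b)\ge 1$ for all $a\ne b$. An alignment of $X$ onto $Y$ is a sequence $(x_t,y_t)_{t=0}^m$ with $(x_0,y_0)=(0,0)$, $(x_m,y_m)=(|X|,|Y|)$ and $(x_{t+1},y_{t+1})\in\{(x_t+1,y_t+1),(x_t+1,y_t),(x_t,y_t+1)\}$. A step to $(x_t+1,y_t)$ deletes $X[x_t]$ at cost $w(X[x_t],\varepsilon)$; a step to $(x_t,y_t+1)$ inserts $Y[y_t]$ at cost $w(\varepsilon,Y[y_t])$; a step to $(x_t+1,y_t+1)$ aligns $X[x_t]$ with $Y[y_t]$ at cost $w(X[x_t],Y[y_t])$. The cost of an alignment is the sum of its step costs, and $\mathsf{ed}^w(X,Y)$ is the minimum cost of an alignment of $X$ onto $Y$. Set $\mathsf{ed}^w_{\le k}(X,Y)=\mathsf{ed}^w(X,Y)$ if this value is at most $k$, and $\infty$ otherwise. Computation model: real weights are accessed only through comparisons and additions (e.g. word RAM). *)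

theory Defs
  imports Complex_Main "HOL-Library.Extended_Real"
begin

section \<open>Weighted edit distance\<close>

text \<open>The empty string is represented by \<^const>\<open>None\<close>, a letter \<open>a\<close> by \<open>Some a\<close>.\<close>

type_synonym 'a weight = "'a option \<Rightarrow> 'a option \<Rightarrow> real"

definition ext_alphabet :: "'a set \<Rightarrow> 'a option set" where
  "ext_alphabet \<Sigma> = insert None (Some ` \<Sigma>)"

text \<open>Values of \<open>w\<close> outside the extended alphabet are unconstrained.\<close>

definition weight_function :: "'a set \<Rightarrow> 'a weight \<Rightarrow> bool" where
  "weight_function \<Sigma> w \<longleftrightarrow>
     (\<forall>a \<in> ext_alphabet \<Sigma>. \<forall>b \<in> ext_alphabet \<Sigma>. 0 \<le> w a b) \<and>
     (\<forall>a \<in> ext_alphabet \<Sigma>. w a a = 0) \<and>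
     (\<forall>a \<in> ext_alphabet \<Sigma>. \<forall>b \<in> ext_alphabet \<Sigma>. a \<noteq> b \<longrightarrow> 1 \<le> w a b)"

fun align_succs :: "nat \<times> nat \<Rightarrow> (nat \<times> nat) set" where
  "align_succs (x, y) = {(x + 1, y + 1), (x + 1, y), (x, y + 1)}"

text \<open>The list \<open>A\<close> of length \<open>m + 1\<close> is the sequence indexed by \<open>0, \<dots>, m\<close>.\<close>

definition alignment :: "'a list \<Rightarrow> 'a list \<Rightarrow> (nat \<times> nat) list \<Rightarrow> bool" where
  "alignment X Y A \<longleftrightarrow>
     A \<noteq> [] \<and> hd A = (0, 0) \<and> last A = (length X, length Y) \<and>
     (\<forall>t < length A - 1. A ! (t + 1) \<in> align_succs (A ! t))"

fun step_cost :: "'a weight \<Rightarrow> 'a list \<Rightarrow> 'a list \<Rightarrow> nat \<times> nat \<Rightarrow> nat \<times> nat \<Rightarrow> real" where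
  "step_cost w X Y (x, y) (x', y') =
     (if (x', y') = (x + 1, y) then w (Some (X ! x)) None
      else if (x', y') = (x, y + 1) then w None (Some (Y ! y))
      else w (Some (X ! x)) (Some (Y ! y)))"

definition alignment_cost :: "'a weight \<Rightarrow> 'a list \<Rightarrow> 'a list \<Rightarrow> (nat \<times> nat) list \<Rightarrow> real" where
  "alignment_cost w X Y A = (\<Sum>t < length A - 1. step_cost w X Y (A ! t) (A ! (t + 1)))"

definition ed :: "'a weight \<Rightarrow> 'a list \<Rightarrow> 'a list \<Rightarrow> real" where
  "ed w X Y = Min (alignment_cost w X Y ` {A. alignment X Y A})"

definition ed_le :: "'a weight \<Rightarrow> nat \<Rightarrow> 'a list \<Rightarrow> 'a list \<Rightarrow> ereal" where
  "ed_le w k X Y = (if ed w X Y \<le> real k then ereal (ed w X Y) else \<infinity>)"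

text \<open>The minimum in \<^const>\<open>ed\<close> ranges over a finite nonempty set.\<close>

lemma alignment_coord_sum:
  assumes "alignment X Y A" "i \<le> j" "j < length A"
  shows "fst (A ! i) \<le> fst (A ! j) \<and> snd (A ! i) \<le> snd (A ! j) \<and>
         fst (A ! i) + snd (A ! i) + (j - i) \<le> fst (A ! j) + snd (A ! j)"
  using assms(2,3)
proof (induction j rule: dec_induct)
  case base
  then show ?case by simp
next
  case (step j)
  have "A ! (j + 1) \<in> align_succs (A ! j)"
    using assms(1) step.prems by (simp add: alignment_def)
  then show ?case using step by (cases "A ! j") auto
qed

lemma finite_alignments: "finite {A. alignment X Y A}"
proof (rule finite_subset)
  let ?S = "{..length X} \<times> {..length Y}" and ?m = "length X + length Y + 1"
  show "{A. alignment X Y A} \<subseteq> {A. set A \<subseteq> ?S \<and> length A \<le> ?m}"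
  proof (intro subsetI CollectI)
    fix A assume "A \<in> {A. alignment X Y A}"
    then have A: "alignment X Y A" by simp
    then have ne: "A \<noteq> []" and l: "A ! (length A - 1) = (length X, length Y)"
      by (auto simp: alignment_def last_conv_nth)
    have "A ! i \<in> ?S" if "i < length A" for i
      using alignment_coord_sum[OF A, of i "length A - 1"] that l
      by (cases "A ! i") auto
    then have "set A \<subseteq> ?S" by (metis in_set_conv_nth subsetI)
    moreover have "length A \<le> ?m"
      using alignment_coord_sum[OF A, of 0 "length A - 1"] l
      by (simp add: le_diff_conv) linarith
    ultimately show "set A \<subseteq> ?S \<and> length A \<le> ?m" ..
  qed
  show "finite {A. set A \<subseteq> ?S \<and> length A \<le> ?m}"
    by (rule finite_lists_length_le) simp
qed

lemma alignment_exists: "\<exists>A. alignment X Y A"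
proof
  let ?a = "length X" and ?b = "length Y"
  let ?A = "map (\<lambda>t. (min t ?a, t - ?a)) [0..<?a + ?b + 1]"
  have "last ?A = (?a, ?b)" by simp
  moreover have "hd ?A = (0, 0)" by (simp add: hd_map upt_conv_Cons del: upt_Suc)
  moreover have "?A ! (t + 1) \<in> align_succs (?A ! t)" if "t < ?a + ?b" for t
    using that by (auto simp: min_def simp del: upt_Suc)
  ultimately show "alignment X Y ?A" by (simp add: alignment_def del: upt_Suc)
qed


section \<open>A word RAM with opaque real weights\<close>

text \<open>
  Programs work on words, the natural numbers below \<open>2 ^ W\<close>, and on reals. Each sort has
  its own variables and zero-initialised arrays; all of them are named by fixed natural
  numbers, so a program mentions only finitely many, and an array may be indexed by any word.
  Words carry the usual instruction set, whereas reals are only added and compared; they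
  arise from 0, 1 and queries to the weight function, which take letters (words) or
  the empty string as arguments. There is no conversion between words and reals.
\<close>

datatype word_op = Add | Sub | Mul | Div | Mod | Bit_And | Bit_Or | Bit_Xor | Shl | Shr

datatype wexp =
    WConst nat
  | WVar nat
  | WArr nat wexp
  | WOp word_op wexp wexp

datatype rexp =
    RZero
  | ROne
  | RVar nat
  | RArr nat wexp
  | RAdd rexp rexp
  | RWeight "wexp option" "wexp option"

datatype bexp =
    WLess wexp wexp
  | RLess rexp rexp
  | BNot bexp
  | BAnd bexp bexp

datatype com =
    Skip
  | WAssign nat wexp
  | WStore nat wexp wexp
  | RAssign nat rexp
  | RStore nat wexp rexp
  | Seq com com
  | Cond bexp com com
  | While bexp com

record state =
  wvar :: "nat \<Rightarrow> nat"
  warr :: "nat \<Rightarrow> nat \<Rightarrow> nat"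
  rvar :: "nat \<Rightarrow> real"
  rarr :: "nat \<Rightarrow> nat \<Rightarrow> real"

text \<open>Word arithmetic is modulo \<open>2 ^ W\<close>; subtraction wraps around.\<close>

fun word_op_val :: "nat \<Rightarrow> word_op \<Rightarrow> nat \<Rightarrow> nat \<Rightarrow> nat" where
  "word_op_val W Add a b = (a + b) mod 2 ^ W"
| "word_op_val W Sub a b = (a + (2 ^ W - b)) mod 2 ^ W"
| "word_op_val W Mul a b = (a * b) mod 2 ^ W"
| "word_op_val W Div a b = a div b"
| "word_op_val W Mod a b = a mod b"
| "word_op_val W Bit_And a b = Bit_Operations.and a b"
| "word_op_val W Bit_Or a b = Bit_Operations.or a b"
| "word_op_val W Bit_Xor a b = Bit_Operations.xor a b"
| "word_op_val W Shl a b = (a * 2 ^ b) mod 2 ^ W"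
| "word_op_val W Shr a b = a div 2 ^ b"

primrec wval :: "nat \<Rightarrow> state \<Rightarrow> wexp \<Rightarrow> nat" where
  "wval W s (WConst c) = c mod 2 ^ W"
| "wval W s (WVar v) = wvar s v"
| "wval W s (WArr a i) = warr s a (wval W s i)"
| "wval W s (WOp f d e) = word_op_val W f (wval W s d) (wval W s e)"

primrec rval :: "nat \<Rightarrow> nat weight \<Rightarrow> state \<Rightarrow> rexp \<Rightarrow> real" where
  "rval W w s RZero = 0"
| "rval W w s ROne = 1"
| "rval W w s (RVar v) = rvar s v"
| "rval W w s (RArr a i) = rarr s a (wval W s i)"
| "rval W w s (RAdd d e) = rval W w s d + rval W w s e"
| "rval W w s (RWeight d e) = w (map_option (wval W s) d) (map_option (wval W s) e)"

primrec bval :: "nat \<Rightarrow> nat weight \<Rightarrow> state \<Rightarrow> bexp \<Rightarrow> bool" where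
  "bval W w s (WLess d e) \<longleftrightarrow> wval W s d < wval W s e"
| "bval W w s (RLess d e) \<longleftrightarrow> rval W w s d < rval W w s e"
| "bval W w s (BNot b) \<longleftrightarrow> \<not> bval W w s b"
| "bval W w s (BAnd b c) \<longleftrightarrow> bval W w s b \<and> bval W w s c"

text \<open>Evaluating an expression takes one time unit per node of its syntax tree.\<close>

primrec wtime :: "wexp \<Rightarrow> nat" where
  "wtime (WConst c) = 1"
| "wtime (WVar v) = 1"
| "wtime (WArr a i) = 1 + wtime i"
| "wtime (WOp f d e) = 1 + wtime d + wtime e"

primrec rtime :: "rexp \<Rightarrow> nat" where
  "rtime RZero = 1"
| "rtime ROne = 1"
| "rtime (RVar v) = 1"
| "rtime (RArr a i) = 1 + wtime i"
| "rtime (RAdd d e) = 1 + rtime d + rtime e"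
| "rtime (RWeight d e) = 1 + case_option 1 wtime d + case_option 1 wtime e"

primrec btime :: "bexp \<Rightarrow> nat" where
  "btime (WLess d e) = 1 + wtime d + wtime e"
| "btime (RLess d e) = 1 + rtime d + rtime e"
| "btime (BNot b) = 1 + btime b"
| "btime (BAnd b c) = 1 + btime b + btime c"

text \<open>
  \<open>exec W w P s t s'\<close>: with word size \<open>W\<close> and weight oracle \<open>w\<close>, program \<open>P\<close> started
  in \<open>s\<close> halts in \<open>s'\<close> after \<open>t\<close> time units.
\<close>

inductive exec :: "nat \<Rightarrow> nat weight \<Rightarrow> com \<Rightarrow> state \<Rightarrow> nat \<Rightarrow> state \<Rightarrow> bool"
  for W :: nat and w :: "nat weight" where
  Skip: "exec W w Skip s 1 s"
| WAssign: "exec W w (WAssign v e) s (1 + wtime e) (s\<lparr>wvar := (wvar s)(v := wval W s e)\<rparr>)"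
| WStore: "exec W w (WStore a i e) s (1 + wtime i + wtime e)
     (s\<lparr>warr := (warr s)(a := (warr s a)(wval W s i := wval W s e))\<rparr>)"
| RAssign: "exec W w (RAssign v e) s (1 + rtime e) (s\<lparr>rvar := (rvar s)(v := rval W w s e)\<rparr>)"
| RStore: "exec W w (RStore a i e) s (1 + wtime i + rtime e)
     (s\<lparr>rarr := (rarr s)(a := (rarr s a)(wval W s i := rval W w s e))\<rparr>)"
| Seq: "exec W w P s t s' \<Longrightarrow> exec W w Q s' t' s'' \<Longrightarrow> exec W w (Seq P Q) s (t + t') s''"
| CondTrue: "bval W w s b \<Longrightarrow> exec W w P s t s' \<Longrightarrow>
     exec W w (Cond b P Q) s (1 + btime b + t) s'"
| CondFalse: "\<not> bval W w s b \<Longrightarrow> exec W w Q s t s' \<Longrightarrow>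
     exec W w (Cond b P Q) s (1 + btime b + t) s'"
| WhileFalse: "\<not> bval W w s b \<Longrightarrow> exec W w (While b P) s (1 + btime b) s"
| WhileTrue: "bval W w s b \<Longrightarrow> exec W w P s t s' \<Longrightarrow> exec W w (While b P) s' t' s'' \<Longrightarrow>
     exec W w (While b P) s (1 + btime b + t + t') s''"

inductive_cases exec_elims:
  "exec W w Skip s t s'"
  "exec W w (WAssign v e) s t s'"
  "exec W w (WStore a i e) s t s'"
  "exec W w (RAssign v d) s t s'"
  "exec W w (RStore a i d) s t s'"
  "exec W w (Seq P Q) s t s'"
  "exec W w (Cond b P Q) s t s'"
  "exec W w (While b P) s t s'"

lemma exec_deterministic:
  "exec W w P s t s' \<Longrightarrow> exec W w P s u s'' \<Longrightarrow> u = t \<and> s'' = s'"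
proof (induction arbitrary: u s'' rule: exec.induct)
  case (Seq P s t s' Q t' s1)
  show ?case by (rule exec_elims(6)[OF Seq.prems]) (use Seq.IH plus_1_eq_Suc add_Suc in metis)
next
  case (CondTrue s b P t s' Q)
  show ?case by (rule exec_elims(7)[OF CondTrue.prems]) (use CondTrue.hyps CondTrue.IH plus_1_eq_Suc add_Suc in metis)+
next
  case (CondFalse s b Q t s' P)
  show ?case by (rule exec_elims(7)[OF CondFalse.prems]) (use CondFalse.hyps CondFalse.IH plus_1_eq_Suc add_Suc in metis)+
next
  case (WhileFalse s b P)
  show ?case by (rule exec_elims(8)[OF WhileFalse.prems]) (use WhileFalse.hyps plus_1_eq_Suc add_Suc in metis)+
next
  case (WhileTrue s b P t s' t' s1)
  show ?case by (rule exec_elims(8)[OF WhileTrue.prems]) (use WhileTrue.hyps WhileTrue.IH plus_1_eq_Suc add_Suc in metis)+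
qed (erule exec_elims, simp)+


text \<open>
  Input convention: word arrays 0 and 1 hold the two strings, word variables 0, 1, 2 hold
  their lengths and \<open>k\<close>.
\<close>

definition input_state :: "nat list \<Rightarrow> nat list \<Rightarrow> nat \<Rightarrow> state" where
  "input_state X Y k = \<lparr>
     wvar = (\<lambda>_. 0)(0 := length X, 1 := length Y, 2 := k),
     warr = (\<lambda>_ _. 0)(0 := (\<lambda>i. if i < length X then X ! i else 0),
                      1 := (\<lambda>i. if i < length Y then Y ! i else 0)),
     rvar = (\<lambda>_. 0),
     rarr = (\<lambda>_ _. 0)\<rparr>"

text \<open>Output convention: word variable 0 is zero for \<open>\<infinity>\<close>, otherwise real variable 0 is the result.\<close>

definition result :: "state \<Rightarrow> ereal" where
  "result s = (if wvar s 0 = 0 then \<infinity> else ereal (rvar s 0))"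

text \<open>
  \<open>W \<ge> c log\<^sub>2 (n + k + 1)\<close>: the usual assumption that a word has \<open>\<Omega>(log)\<close> many bits, where
  \<open>c\<close> is a constant of the algorithm.
\<close>

definition word_size_ok :: "nat \<Rightarrow> nat \<Rightarrow> nat \<Rightarrow> nat \<Rightarrow> bool" where
  "word_size_ok c W n k \<longleftrightarrow> real c * log 2 (real (n + k + 1)) \<le> real W"

end

theory Submission
  imports Defs
begin

text \<open>
  An alignment of cost at most \<open>k\<close> has at most \<open>k\<close> mismatched columns. Hence \<open>X\<close> splits into
  \<open>O(k)\<close> fragments that are matched exactly along one of \<open>2 k + 1\<close> diagonals, and a greedy search,
  which only compares windows of length \<open>O(k)\<close> on all diagonals before it extends a match, covers
  \<open>X\<close> by \<open>O(k)\<close> matched runs and \<open>O(k)\<close> gaps of length \<open>O(k)\<close>. If it needs more steps, then the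
  distance exceeds \<open>k\<close>.

  Two reductions shrink a matched run \<open>P\<close> simultaneously in both strings without changing the
  distance up to \<open>k\<close>. In a long fragment with a period \<open>p \<le> 2 k\<close>, some chunk of length \<open>p\<close> is
  matched exactly by any given cheap alignment, so one period may be removed or inserted there.
  A fragment without a period up to \<open>2 k\<close> matches along one diagonal only; \<open>k + 1\<close> such factors
  therefore force every cheap alignment onto the diagonal of the run, and everything between two
  such blocks may be dropped. Cutting \<open>P\<close> greedily into aperiodic factors of reduced length
  \<open>O(k\<^sup>2)\<close> and keeping \<open>O(k)\<close> of them leaves \<open>O(k\<^sup>3)\<close> letters per run and \<open>O(k\<^sup>4)\<close> letters in
  total, on which a dynamic program restricted to \<open>2 k + 1\<close> diagonals takes time \<open>O(k\<^sup>5)\<close>.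
\<close>


section \<open>Alignments as lists of columns\<close>

text \<open>The obstacle is that both strings have to be shrunk in one pass, although the optimal
  alignment is unknown. \<open>interch P P'\<close> therefore quantifies over all contexts whose
  left parts differ in length by at most \<open>k\<close>, as the prefixes before a matched run do,
  and over every threshold up to \<open>k\<close>; replacements then compose freely and preserve the
  exact value, not only the decision. Windows reach \<open>4 k\<close> back and \<open>2 k\<close>
  ahead because two diagonals differ by at most \<open>2 k\<close>: comparing them yields periods up
  to \<open>2 k\<close>, and the argument shifts a position backwards by two of them or forwards by
  one. A run is closed \<open>2 k\<close> letters before it breaks, so that the cursor in
  \<open>Y\<close> cannot overtake the next run on another diagonal. The reduced factor length
  \<open>8 * (k * k)\<close> leaves room for \<open>k + 1\<close> chunks of a period up to
  \<open>2 k\<close> and for two margins of \<open>2 k\<close>. The search tests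
  \<open>2 k + 1\<close> windows of \<open>O(k)\<close> letters in each of \<open>O(k)\<close>
  rounds, hence \<open>O(k^3)\<close>; everything else before the dynamic program is charged to
  letters of the input.\<close>

abbreviation upper :: "('a option \<times> 'a option) list \<Rightarrow> 'a list" where
  "upper \<equiv> List.map_filter fst"

abbreviation lower :: "('a option \<times> 'a option) list \<Rightarrow> 'a list" where
  "lower \<equiv> List.map_filter snd"

text \<open>A column is one step of an alignment, with \<open>None\<close> for a gap. Lists of
  columns replace coordinate sequences because cutting and joining alignments becomes
  \<open>append\<close>. The column \<open>(None, None)\<close> would consume nothing, so it is
  excluded; without it, longer prefixes consume more letters.\<close>

definition columns :: "'a list \<Rightarrow> 'a list \<Rightarrow> ('a option \<times> 'a option) list \<Rightarrow> bool" where
  "columns X Y cs \<longleftrightarrow> upper cs = X \<and> lower cs = Y \<and> (None, None) \<notin> set cs"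

definition mismatches :: "('a option \<times> 'a option) list \<Rightarrow> nat" where
  "mismatches cs = length (filter (\<lambda>c. fst c \<noteq> snd c) cs)"

definition column_cost :: "'a weight \<Rightarrow> ('a option \<times> 'a option) list \<Rightarrow> real" where
  "column_cost w cs = (\<Sum>c\<leftarrow>cs. w (fst c) (snd c))"

abbreviation diagonal :: "'a list \<Rightarrow> ('a option \<times> 'a option) list" where
  "diagonal P \<equiv> map (\<lambda>a. (Some a, Some a)) P"

lemma map_filter_append: "List.map_filter f (xs @ ys) = List.map_filter f xs @ List.map_filter f ys"
  by (simp add: List.map_filter_def)

lemma map_filter_Cons:
  "List.map_filter f (x # xs) = (case f x of None \<Rightarrow> [] | Some y \<Rightarrow> [y]) @ List.map_filter f xs"
  by (simp add: List.map_filter_def split: option.split)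

lemma map_filter_Nil: "List.map_filter f [] = []"
  by (simp add: List.map_filter_def)

lemmas map_filter_rec = map_filter_append map_filter_Cons map_filter_Nil

lemma mismatches_rec [simp]:
  "mismatches [] = 0"
  "mismatches (c # cs) = (if fst c \<noteq> snd c then 1 else 0) + mismatches cs"
  "mismatches (cs @ cs') = mismatches cs + mismatches cs'"
  by (simp_all add: mismatches_def)

lemma column_cost_rec [simp]:
  "column_cost w [] = 0"
  "column_cost w (c # cs) = w (fst c) (snd c) + column_cost w cs"
  "column_cost w (cs @ cs') = column_cost w cs + column_cost w cs'"
  by (simp_all add: column_cost_def)

lemma upper_diagonal [simp]: "upper (diagonal P) = P" "lower (diagonal P) = P"
  by (induction P) (simp_all add: map_filter_rec)

lemma None_None_diagonal [simp]: "(None, None) \<notin> set (diagonal P)"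
  by auto

text \<open>Only a column with exactly one gap changes the length difference of the rows, and it is
  a mismatch. With at most \<open>k\<close> mismatches, every cut through an alignment thus lies on
  a diagonal between \<open>- k\<close> and \<open>k\<close>.\<close>

lemma length_rows_mismatches:
  "length (upper cs) \<le> length (lower cs) + mismatches cs"
  "length (lower cs) \<le> length (upper cs) + mismatches cs"
  by (induction cs) (auto simp: map_filter_rec split: option.split)

lemma split_upper:
  assumes "upper cs = A @ B"
  obtains c1 c2 where "cs = c1 @ c2" "upper c1 = A" "upper c2 = B"
proof -
  have "\<exists>c1 c2. cs = c1 @ c2 \<and> upper c1 = A \<and> upper c2 = B"
    using assms
  proof (induction cs arbitrary: A)
    case Nil
    then show ?case by (simp add: map_filter_rec)
  next
    case (Cons c cs)
    show ?case
    proof (cases "fst c")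
      case None
      then have "upper cs = A @ B" using Cons.prems by (simp add: map_filter_rec)
      from Cons.IH[OF this] obtain c1 c2 where "cs = c1 @ c2" "upper c1 = A" "upper c2 = B"
        by blast
      then have "c # cs = (c # c1) @ c2 \<and> upper (c # c1) = A \<and> upper c2 = B"
        using None by (simp add: map_filter_rec)
      then show ?thesis by blast
    next
      case (Some a)
      show ?thesis
      proof (cases A)
        case Nil
        then have "c # cs = [] @ (c # cs) \<and> upper [] = A \<and> upper (c # cs) = B"
          using Cons.prems by (simp add: map_filter_rec)
        then show ?thesis by blast
      next
        case (Cons a' A')
        then have "upper cs = A' @ B" "a' = a"
          using Cons.prems Some by (simp_all add: map_filter_rec)
        from Cons.IH[OF this(1)] obtain c1 c2 where "cs = c1 @ c2" "upper c1 = A'" "upper c2 = B"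
          by blast
        then have "c # cs = (c # c1) @ c2 \<and> upper (c # c1) = A \<and> upper c2 = B"
          using Cons Some \<open>a' = a\<close> by (simp add: map_filter_rec)
        then show ?thesis by blast
      qed
    qed
  qed
  then show ?thesis using that by blast
qed

lemma no_mismatch_rows:
  assumes "mismatches cs = 0"
  shows "lower cs = upper cs"
  using assms by (induction cs) (auto simp: map_filter_rec split: option.split if_splits)

text \<open>Pigeonhole: the factors of \<open>concat Fs\<close> occupy disjoint blocks of columns,
  and fewer mismatches than factors leave one block exact.\<close>

lemma exact_factor:
  assumes "upper cs = A @ concat Fs @ B" "mismatches cs < length Fs"
  obtains F1 F F2 c1 c2 c3 where "Fs = F1 @ F # F2" "cs = c1 @ c2 @ c3"
    "upper c1 = A @ concat F1" "upper c2 = F" "lower c2 = F" "mismatches c2 = 0"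
    "upper c3 = concat F2 @ B"
proof -
  have "\<exists>F1 F F2 c1 c2 c3. Fs = F1 @ F # F2 \<and> cr = c1 @ c2 @ c3 \<and> upper c1 = concat F1 \<and>
    upper c2 = F \<and> mismatches c2 = 0 \<and> upper c3 = concat F2 @ B"
    if "upper cr = concat Fs @ B" "mismatches cr < length Fs" for cr
    using that
  proof (induction Fs arbitrary: cr)
    case Nil
    then show ?case by simp
  next
    case (Cons F Fs)
    then have "upper cr = F @ (concat Fs @ B)" by simp
    then obtain c1 c2 where c: "cr = c1 @ c2" "upper c1 = F" "upper c2 = concat Fs @ B"
      by (rule split_upper)
    show ?case
    proof (cases "mismatches c1 = 0")
      case True
      then have "F # Fs = [] @ F # Fs \<and> cr = [] @ c1 @ c2 \<and> upper [] = concat [] \<and>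
        upper c1 = F \<and> mismatches c1 = 0 \<and> upper c2 = concat Fs @ B"
        using c by (simp add: map_filter_rec)
      then show ?thesis by blast
    next
      case False
      then have "mismatches c2 < length Fs" using Cons.prems c by simp
      from Cons.IH[OF c(3) this] obtain F1 F' F2 d1 d2 d3 where
        "Fs = F1 @ F' # F2" "c2 = d1 @ d2 @ d3" "upper d1 = concat F1"
        "upper d2 = F'" "mismatches d2 = 0" "upper d3 = concat F2 @ B" by blast
      then have "F # Fs = (F # F1) @ F' # F2 \<and> cr = (c1 @ d1) @ d2 @ d3 \<and>
        upper (c1 @ d1) = concat (F # F1) \<and> upper d2 = F' \<and> mismatches d2 = 0 \<and>
        upper d3 = concat F2 @ B"
        using c by (simp add: map_filter_rec)
      then show ?thesis by blast
    qed
  qed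
  note ex = this
  obtain c0 cr where c: "cs = c0 @ cr" "upper c0 = A" "upper cr = concat Fs @ B"
    using assms(1) by (rule split_upper)
  have "mismatches cr < length Fs" using assms(2) c by simp
  from ex[OF c(3) this] obtain F1 F F2 c1 c2 c3 where
    "Fs = F1 @ F # F2" "cr = c1 @ c2 @ c3" "upper c1 = concat F1"
    "upper c2 = F" "mismatches c2 = 0" "upper c3 = concat F2 @ B" by blast
  with c show ?thesis
    by (intro that[of F1 F F2 "c0 @ c1" c2 c3]) (simp_all add: map_filter_rec no_mismatch_rows)
qed


section \<open>Periods\<close>

definition period :: "nat \<Rightarrow> 'a list \<Rightarrow> bool" where
  "period p xs \<longleftrightarrow> (\<forall>i. i + p < length xs \<longrightarrow> xs ! i = xs ! (i + p))"

text \<open>For 0 < \<open>m\<close>, a list of length at most \<open>m\<close> has period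
  \<open>m\<close> vacuously, so an aperiodic list is longer than \<open>m\<close>.\<close>

definition aperiodic :: "nat \<Rightarrow> 'a list \<Rightarrow> bool" where
  "aperiodic m xs \<longleftrightarrow> (\<forall>q. 0 < q \<and> q \<le> m \<longrightarrow> \<not> period q xs)"

lemma period_drop: "period p xs \<Longrightarrow> period p (drop n xs)"
  by (auto simp: period_def add.assoc)

lemma period_factor: "period p (U @ xs @ V) \<Longrightarrow> period p xs"
proof -
  assume a: "period p (U @ xs @ V)"
  show "period p xs"
    unfolding period_def
  proof (intro allI impI)
    fix i assume "i + p < length xs"
    then show "xs ! i = xs ! (i + p)"
      using a[unfolded period_def, rule_format, of "length U + i"]
      by (simp add: nth_append)
  qed
qed

lemma aperiodic_factor: "aperiodic m xs \<Longrightarrow> aperiodic m (U @ xs @ V)"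
  using period_factor unfolding aperiodic_def by blast

text \<open>Cutting \<open>p\<close> consecutive letters out of a list of period \<open>p\<close>
  shifts the rest by one period, so the result does not depend on the place. The two rows of an
  alignment may therefore lose a chunk at different places and still agree.\<close>

lemma period_cut:
  assumes "period p (U @ F @ V)" "length F = p"
  shows "U @ V = drop p (U @ F @ V)"
proof (rule nth_equalityI)
  fix i assume i: "i < length (U @ V)"
  have d: "drop p (U @ F @ V) ! i = (U @ F @ V) ! (i + p)"
    using i assms(2) by (simp add: add.commute del: drop_append)
  show "(U @ V) ! i = drop p (U @ F @ V) ! i"
  proof (cases "i < length U")
    case True
    have "(U @ F @ V) ! i = (U @ F @ V) ! (i + p)"
      using assms i unfolding period_def by simp
    then show ?thesis using True unfolding d by (simp add: nth_append)
  next
    case False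
    then have "\<not> i + p < length U" "\<not> i + p - length U < p" "i + p - length U - p = i - length U"
      by auto
    then show ?thesis unfolding d using False assms(2) by (simp add: nth_append)
  qed
qed (use assms in simp)

text \<open>The inverse of \<open>period_cut\<close>: doubling a block of length \<open>p\<close>
  anywhere restores the period that was dropped at the front.\<close>

lemma period_duplicate:
  assumes "period p P" "drop p P = U @ F @ V" "length F = p"
  shows "U @ F @ F @ V = P"
proof (cases "p = 0")
  case True
  then show ?thesis using assms by simp
next
  case False
  have len: "length P = p + (length U + p + length V)"
    using arg_cong[OF assms(2), of length] assms(3) False by (cases "p \<le> length P") auto
  have eq: "P ! (p + i) = (U @ F @ V) ! i" if "i < length P - p" for i
    using that len by (simp flip: assms(2))
  show ?thesis
  proof (rule nth_equalityI)
    fix i assume i: "i < length (U @ F @ F @ V)"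
    show "(U @ F @ F @ V) ! i = P ! i"
    proof (cases "i < length U + p")
      case True
      then have "P ! i = P ! (i + p)"
        using assms(1) len unfolding period_def by simp
      also have "\<dots> = (U @ F @ V) ! i"
        using eq[of i] True len by (simp add: add.commute)
      finally show ?thesis using True assms(3) by (auto simp: nth_append)
    next
      case False
      then have "P ! i = (U @ F @ V) ! (i - p)"
        using eq[of "i - p"] i len assms(3) by simp
      moreover have "\<not> i < length U" "\<not> i - length U < p" "\<not> i - p < length U"
        "i - length U - p = i - p - length U" using False by auto
      ultimately show ?thesis using assms(3) by (simp add: nth_append)
    qed
  qed (use len assms in simp)
qed

text \<open>If \<open>c\<close> breaks the period \<open>p\<close> of \<open>H\<close>, no
  \<open>q\<close> \<le> \<open>m\<close> can be a period of \<open>H @ [c]\<close>: stepping back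
  from \<open>c\<close> by \<open>q\<close>, then by \<open>p\<close>, then forward by
  \<open>q\<close> would give \<open>c = H ! (length H - p)\<close>. The length \<open>2 * m\<close>
  keeps these positions in range.\<close>

lemma aperiodic_break:
  assumes "period p H" "0 < p" "p \<le> m" "2 * m \<le> length H" "c \<noteq> H ! (length H - p)"
  shows "aperiodic m (H @ [c])"
  unfolding aperiodic_def
proof (intro allI impI notI)
  fix q assume q: "0 < q \<and> q \<le> m" and "period q (H @ [c])"
  then have per: "\<And>i. i + q \<le> length H \<Longrightarrow> (H @ [c]) ! i = (H @ [c]) ! (i + q)"
    by (auto simp: period_def)
  let ?l = "length H"
  have "H \<noteq> []" using assms q by auto
  then have "c = H ! (?l - q)" using per[of "?l - q"] q assms(3,4) by (simp add: nth_append)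
  also have "\<dots> = H ! (?l - q - p)"
    using assms(1)[unfolded period_def, rule_format, of "?l - q - p"] q assms
    by (simp add: \<open>H \<noteq> []\<close>)
  also have "\<dots> = H ! (?l - p)"
    using per[of "?l - q - p"] q assms \<open>H \<noteq> []\<close> by (simp add: nth_append)
  finally show False using assms by simp
qed

lemma concat_chunks:
  "concat (map (\<lambda>i. take p (drop (i * p) xs)) [0..<m]) = take (m * p) xs"
  by (induction m) (simp_all add: take_add add.commute[of p])


section \<open>Interchangeable fragments\<close>

locale weights =
  fixes w :: "'a weight" and k :: nat
  assumes w_refl [simp]: "w a a = 0"
    and w_ge_1: "a \<noteq> b \<Longrightarrow> 1 \<le> w a b"
begin

lemma w_nonneg: "0 \<le> w a b"
  using w_refl[of a] w_ge_1[of a b] by (cases "a = b") auto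

lemma mismatches_le_cost: "real (mismatches cs) \<le> column_cost w cs"
proof (induction cs)
  case (Cons c cs)
  then show ?case using w_ge_1[of "fst c" "snd c"] w_nonneg[of "fst c" "snd c"] by auto
qed simp

lemma cost_nonneg: "0 \<le> column_cost w cs"
  using mismatches_le_cost[of cs] by linarith

lemma cost_no_mismatch: "mismatches cs = 0 \<Longrightarrow> column_cost w cs = 0"
  by (induction cs) (auto split: if_splits)

lemma cost_diagonal [simp]: "column_cost w (diagonal P) = 0"
  by (rule cost_no_mismatch) (simp add: mismatches_def)

text \<open>Costs enter as thresholds, so that a reduction only has to transform a witness and never
  argues about minimality.\<close>

definition alignable :: "real \<Rightarrow> 'a list \<Rightarrow> 'a list \<Rightarrow> bool" where
  "alignable c X Y \<longleftrightarrow> (\<exists>cs. columns X Y cs \<and> column_cost w cs \<le> c)"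

definition close :: "'a list \<Rightarrow> 'a list \<Rightarrow> bool" where
  "close A A' \<longleftrightarrow> length A \<le> length A' + k \<and> length A' \<le> length A + k"

text \<open>The same fragment is replaced in both rows. \<open>close\<close> holds for the prefixes
  before a fragment that is matched along one of the \<open>2 k + 1\<close> diagonals. Having all
  real thresholds up to \<open>k\<close> allows to recover the distance itself.\<close>

definition interch :: "'a list \<Rightarrow> 'a list \<Rightarrow> bool" where
  "interch P P' \<longleftrightarrow> (\<forall>A A' B B' c. close A A' \<longrightarrow> c \<le> real k \<longrightarrow>
     alignable c (A @ P @ B) (A' @ P @ B') = alignable c (A @ P' @ B) (A' @ P' @ B'))"

lemma interch_refl: "interch P P"
  by (simp add: interch_def)

lemma interch_trans: "interch P Q \<Longrightarrow> interch Q R \<Longrightarrow> interch P R"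
  by (simp add: interch_def)

text \<open>Appending \<open>U\<close> to both left contexts keeps their length difference, so
  interchangeability is a congruence and factors can be reduced one by one.\<close>

lemma interch_context:
  assumes "interch P P'"
  shows "interch (U @ P @ V) (U @ P' @ V)"
  unfolding interch_def
proof (intro allI impI)
  fix A A' B B' c assume "close A A'" "c \<le> real k"
  then have "close (A @ U) (A' @ U)" by (simp add: close_def)
  from assms[unfolded interch_def, rule_format, OF this \<open>c \<le> real k\<close>, of "V @ B" "V @ B'"]
  show "alignable c (A @ (U @ P @ V) @ B) (A' @ (U @ P @ V) @ B') =
        alignable c (A @ (U @ P' @ V) @ B) (A' @ (U @ P' @ V) @ B')"
    by simp
qed

lemma interch_append:
  assumes "interch P P'" "interch Q Q'"
  shows "interch (P @ Q) (P' @ Q')"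
  by (rule interch_trans[of _ "P' @ Q"])
    (use interch_context[OF assms(1), of "[]" Q] interch_context[OF assms(2), of P' "[]"] in simp_all)

lemma mismatches_le_k: "column_cost w cs \<le> c \<Longrightarrow> c \<le> real k \<Longrightarrow> mismatches cs \<le> k"
  using mismatches_le_cost[of cs] by linarith

text \<open>The margins of length \<open>2 k\<close> keep the partner of the chunk inside the copy of \<open>P\<close> in
  the lower row.\<close>

lemma exact_chunk:
  assumes cs: "columns (A @ P @ B) (A' @ P @ B') cs" "mismatches cs \<le> k" and "close A A'"
    and P: "(k + 1) * p + 4 * k \<le> length P"
  obtains c1 c2 c3 U F V U' V' where "cs = c1 @ c2 @ c3" "length F = p"
    "P = U @ F @ V" "P = U' @ F @ V'" "upper c1 = A @ U" "lower c1 = A' @ U'"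
    "upper c2 = F" "lower c2 = F" "upper c3 = V @ B" "lower c3 = V' @ B'"
proof -
  \<comment> \<open>\<open>k + 1\<close> chunks against at most \<open>k\<close> mismatches; they
    start only after a margin of \<open>2 * k\<close> letters, and \<open>V0\<close> contains the
    margin at the other end.\<close>
  define Fs where "Fs = map (\<lambda>i. take p (drop (i * p) (drop (2 * k) P))) [0..<k + 1]"
  have cFs: "concat Fs = take ((k + 1) * p) (drop (2 * k) P)"
    unfolding Fs_def by (rule concat_chunks)
  have lF: "length F = p" if "F \<in> set Fs" for F
  proof -
    have "F \<in> (\<lambda>i. take p (drop (i * p) (drop (2 * k) P))) ` {..<k + 1}"
      using that unfolding Fs_def by (simp add: atLeast0LessThan del: drop_drop upt_Suc)
    then obtain i where i: "i < k + 1" "F = take p (drop (i * p) (drop (2 * k) P))"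
      by blast
    have "i * p \<le> k * p" using i(1) by (intro mult_right_mono) auto
    then have "i * p + 2 * k + p \<le> length P" using P by (simp only: add_mult_distrib)
    then show ?thesis unfolding i(2) drop_drop length_take length_drop by linarith
  qed
  define V0 where "V0 = drop ((k + 1) * p) (drop (2 * k) P)"
  have Peq: "P = take (2 * k) P @ concat Fs @ V0"
    unfolding cFs V0_def by (metis append_take_drop_id)
  have lV0: "2 * k \<le> length V0" unfolding V0_def using P by simp
  have "upper cs = (A @ take (2 * k) P) @ concat Fs @ (V0 @ B)"
    using cs(1) Peq unfolding columns_def by (metis append.assoc)
  then obtain F1 F F2 c1 c2 c3 where c: "Fs = F1 @ F # F2" "cs = c1 @ c2 @ c3"
    "upper c1 = (A @ take (2 * k) P) @ concat F1" "upper c2 = F" "lower c2 = F"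
    "mismatches c2 = 0" "upper c3 = concat F2 @ V0 @ B"
    by (rule exact_factor) (use cs(2) in \<open>simp add: Fs_def\<close>)
  have lFp: "length F = p" using lF c(1) by simp
  define U where "U = take (2 * k) P @ concat F1"
  define V where "V = concat F2 @ V0"
  have PU: "P = U @ F @ V" using Peq c(1) unfolding U_def V_def by (metis append.assoc concat.simps(2) concat_append)
  \<comment> \<open>\<open>v\<close> is the offset of the partner of \<open>F\<close> in the lower
    copy of \<open>P\<close>. It may differ from \<open>length U\<close> by up to
    \<open>2 * k\<close>: \<open>k\<close> from the mismatches in \<open>c1\<close> and
    \<open>k\<close> from \<open>close\<close>.\<close>
  define v where "v = length (lower c1) - length A'"
  have lP: "length P = length U + p + length V" using PU lFp by (metis add.assoc length_append)
  have lU: "2 * k \<le> length U" and lV: "2 * k \<le> length V"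
    unfolding U_def V_def using P lV0 by auto
  have lc1: "length (upper c1) = length A + length U" using c(3) by (simp add: U_def)
  have "mismatches c1 \<le> k" using cs(2) c(2) by simp
  then have cl: "length (lower c1) \<le> length A + length U + k"
    "length A + length U \<le> length (lower c1) + k"
    using length_rows_mismatches[of c1] lc1 by linarith+
  have low: "lower c1 @ F @ lower c3 = A' @ P @ B'"
    using cs(1) c unfolding columns_def by (simp add: map_filter_rec)
  have ge: "length A' \<le> length (lower c1)" and le: "v + p \<le> length P"
    using cl lU lV lP \<open>close A A'\<close> unfolding close_def v_def by linarith+
  have lc: "lower c1 = A' @ take v P"
  proof -
    have "lower c1 = take (length (lower c1)) (A' @ P @ B')"
      by (simp flip: low)
    then show ?thesis using ge le unfolding v_def by simp
  qed
  have FP: "F @ lower c3 = drop v P @ B'"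
    using low le unfolding lc by (simp add: append_eq_append_conv_if)
  have F: "F = take p (drop v P)"
    using arg_cong[OF FP, of "take p"] lFp le by simp
  have l3: "lower c3 = drop (v + p) P @ B'"
    using arg_cong[OF FP, of "drop p"] lFp le by (simp add: add.commute)
  show ?thesis
  proof (rule that[of c1 c2 c3 F U V "take v P" "drop (v + p) P"])
    show "P = take v P @ F @ drop (v + p) P"
      unfolding F by (metis append_take_drop_id drop_drop add.commute)
    show "P = U @ F @ V" by (rule PU)
    show "upper c1 = A @ U" "upper c3 = V @ B" by (simp_all add: c(3,7) U_def V_def)
  qed (rule c lFp lc l3)+
qed

section \<open>Removing and inserting whole periods\<close>

text \<open>An exact chunk of length \<open>p\<close> can be deleted together with its partner, or
  doubled by free diagonal columns, so the cost does not increase in either direction. One period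
  more than in \<open>exact_chunk\<close> is assumed because the converse looks for the chunk in the
  shortened \<open>drop p P\<close>.\<close>

lemma interch_period_once:
  assumes "period p P" "(k + 2) * p + 4 * k \<le> length P"
  shows "interch P (drop p P)"
  unfolding interch_def
proof (intro allI impI iffI)
  fix A A' B B' c
  assume clo: "close A A'" and c: "c \<le> real k"
  {
    assume "alignable c (A @ P @ B) (A' @ P @ B')"
    then obtain cs where cs: "columns (A @ P @ B) (A' @ P @ B') cs" "column_cost w cs \<le> c"
      unfolding alignable_def by blast
    have P: "(k + 1) * p + 4 * k \<le> length P" using assms(2) by simp
    obtain c1 c2 c3 U F V U' V' where d: "cs = c1 @ c2 @ c3" "length F = p"
      "P = U @ F @ V" "P = U' @ F @ V'" "upper c1 = A @ U" "lower c1 = A' @ U'"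
      "upper c2 = F" "lower c2 = F" "upper c3 = V @ B" "lower c3 = V' @ B'"
      by (rule exact_chunk[OF cs(1) mismatches_le_k[OF cs(2) c] clo P])
    have "U @ V = drop p P" "U' @ V' = drop p P"
      using period_cut[of p U F V] period_cut[of p U' F V'] assms(1) d by metis+
    then have "columns (A @ drop p P @ B) (A' @ drop p P @ B') (c1 @ c3)"
      using cs(1) d unfolding columns_def by (simp add: map_filter_rec)
    moreover have "column_cost w (c1 @ c3) \<le> c"
      using cs(2) d(1) cost_nonneg[of c2] by simp
    ultimately show "alignable c (A @ drop p P @ B) (A' @ drop p P @ B')"
      unfolding alignable_def by blast
  next
    assume "alignable c (A @ drop p P @ B) (A' @ drop p P @ B')"
    then obtain cs where cs: "columns (A @ drop p P @ B) (A' @ drop p P @ B') cs"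
      "column_cost w cs \<le> c"
      unfolding alignable_def by blast
    have P: "(k + 1) * p + 4 * k \<le> length (drop p P)" using assms(2) by simp
    note m = mismatches_le_k[OF cs(2) c]
    obtain c1 c2 c3 U F V U' V' where d: "cs = c1 @ c2 @ c3" "length F = p"
      "drop p P = U @ F @ V" "drop p P = U' @ F @ V'" "upper c1 = A @ U" "lower c1 = A' @ U'"
      "upper c2 = F" "lower c2 = F" "upper c3 = V @ B" "lower c3 = V' @ B'"
      by (rule exact_chunk[OF cs(1) m clo P])
    have "U @ F @ F @ V = P" "U' @ F @ F @ V' = P"
      using period_duplicate[OF assms(1)] d by metis+
    then have "columns (A @ P @ B) (A' @ P @ B') (c1 @ diagonal F @ c2 @ c3)"
      using cs(1) d unfolding columns_def by (auto simp add: map_filter_rec)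
    moreover have "column_cost w (c1 @ diagonal F @ c2 @ c3) \<le> c"
      using cs(2) d(1) by simp
    ultimately show "alignable c (A @ P @ B) (A' @ P @ B')"
      unfolding alignable_def by blast
  }
qed

text \<open>Periods may be dropped as long as \<open>k + 1\<close> chunks and both margins remain
  afterwards.\<close>

lemma interch_period:
  assumes "period p P" "(k + 1) * p + 4 * k + j * p \<le> length P"
  shows "interch P (drop (j * p) P)"
  using assms(2)
proof (induction j)
  case 0
  then show ?case by (simp add: interch_refl)
next
  case (Suc j)
  have "interch (drop (j * p) P) (drop p (drop (j * p) P))"
    by (rule interch_period_once) (use Suc.prems assms(1) in \<open>simp_all add: period_drop\<close>)
  then show ?case using Suc by (auto intro: interch_trans)
qed

section \<open>Synchronisation by aperiodic factors\<close>

text \<open>Some \<open>G\<close> is matched exactly, and its partner in the lower row lies within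
  distance \<open>2 k\<close> of the copy of \<open>G\<close> at the corresponding place. A nonzero
  displacement \<open>q\<close> would give \<open>G\<close> the period \<open>q\<close>. So the
  alignment passes through corresponding positions, namely behind \<open>U\<close> in both
  rows.\<close>

lemma synchronised:
  assumes cs: "columns (A @ concat Gs @ R) (A' @ concat Gs @ R') cs" "mismatches cs \<le> k"
    and "close A A'" and Gs: "k < length Gs" "\<And>G. G \<in> set Gs \<Longrightarrow> aperiodic (2 * k) G"
  obtains c1 c2 U V where "cs = c1 @ c2" "concat Gs = U @ V" "upper c1 = A @ U" "lower c1 = A' @ U"
proof -
  have "upper cs = A @ concat Gs @ R" using cs(1) unfolding columns_def by blast
  then obtain G1 G G2 c1 c2 c3 where c: "Gs = G1 @ G # G2" "cs = c1 @ c2 @ c3"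
    "upper c1 = A @ concat G1" "upper c2 = G" "lower c2 = G"
    "mismatches c2 = 0" "upper c3 = concat G2 @ R"
    by (rule exact_factor) (use cs(2) Gs(1) in linarith)
  have apG: "aperiodic (2 * k) G" using Gs(2) c(1) by simp
  define x where "x = length (concat G1)"
  define y where "y = length (lower c1)"
  have "mismatches c1 \<le> k" using cs(2) c(2) by simp
  then have cl: "y \<le> length A + x + k" "length A + x \<le> y + k"
    using length_rows_mismatches[of c1] c(3) unfolding x_def y_def by simp_all
  have low: "lower c1 @ G @ lower c3 = (A' @ concat G1) @ G @ (concat G2 @ R')"
    using cs(1) c unfolding columns_def by (simp add: map_filter_rec)
  \<comment> \<open>The lower row is read in two ways, as the partner of \<open>G\<close> behind
    \<open>c1\<close> and as the original \<open>concat Gs\<close>; an index covered by both copies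
    of \<open>G\<close> equates two of its letters.\<close>
  have nthG: "G ! i = G ! i'" if "y + i = length A' + x + i'" "i < length G" "i' < length G" for i i'
  proof -
    have "G ! i = (lower c1 @ G @ lower c3) ! (y + i)"
      using that(2) unfolding y_def nth_append_length_plus by (simp add: nth_append)
    also have "\<dots> = ((A' @ concat G1) @ G @ (concat G2 @ R')) ! (length A' + x + i')"
      unfolding low that(1) ..
    also have "\<dots> = ((A' @ concat G1) @ G @ concat G2 @ R') ! (length (A' @ concat G1) + i')"
      by (simp add: x_def)
    also have "\<dots> = G ! i'"
      using that(3) unfolding nth_append_length_plus by (simp add: nth_append)
    finally show ?thesis .
  qed
  have "y = length A' + x"
  proof (rule ccontr)
    assume "y \<noteq> length A' + x"
    then consider "y < length A' + x" | "length A' + x < y" by linarith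
    then show False
    proof cases
      case 1
      define q where "q = length A' + x - y"
      have "0 < q" "q \<le> 2 * k" using 1 cl \<open>close A A'\<close> unfolding q_def close_def by linarith+
      moreover have "period q G" unfolding period_def
      proof (intro allI impI)
        fix i assume "i + q < length G"
        then show "G ! i = G ! (i + q)" using nthG[of "i + q" i] 1 by (simp add: q_def)
      qed
      ultimately show False using apG unfolding aperiodic_def by blast
    next
      case 2
      define q where "q = y - (length A' + x)"
      have "0 < q" "q \<le> 2 * k" using 2 cl \<open>close A A'\<close> unfolding q_def close_def by linarith+
      moreover have "period q G" unfolding period_def
      proof (intro allI impI)
        fix i assume "i + q < length G"
        then show "G ! i = G ! (i + q)" using nthG[of "i" "i + q"] 2 by (simp add: q_def)
      qed
      ultimately show False using apG unfolding aperiodic_def by blast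
    qed
  qed
  then have "length (lower c1) = length (A' @ concat G1)" by (simp add: x_def y_def)
  with low have "lower c1 = A' @ concat G1" by (metis append_eq_append_conv)
  with c show ?thesis by (intro that[of c1 "c2 @ c3" "concat G1" "concat (G # G2)"]) auto
qed

text \<open>No column is empty, so a longer prefix consumes strictly more letters; this orders two
  cuts of the same alignment.\<close>

lemma length_rows_mono:
  assumes "a < b" "b \<le> length cs" "(None, None) \<notin> set cs"
  shows "length (upper (take a cs)) + length (lower (take a cs))
       < length (upper (take b cs)) + length (lower (take b cs))"
proof -
  have "take b cs = take a cs @ take (b - a) (drop a cs)"
    using assms(1) by (metis le_add_diff_inverse less_imp_le take_add)
  moreover obtain d ds where d: "take (b - a) (drop a cs) = d # ds"
    using assms by (cases "take (b - a) (drop a cs)") auto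
  moreover have "d \<noteq> (None, None)"
    using assms(3) in_set_takeD[of d "b - a" "drop a cs"] in_set_dropD[of d a cs] d by auto
  ultimately show ?thesis by (cases d) (auto simp: map_filter_rec split: option.split)
qed

text \<open>An alignment that meets the diagonal of \<open>P1\<close> and of \<open>P2\<close> may as well stay on it in
  between, whatever \<open>M\<close> is.\<close>

lemma interch_synchronised_aux:
  assumes sync: "k < length Gs" "\<And>G. G \<in> set Gs \<Longrightarrow> aperiodic (2 * k) G"
      "k < length Hs" "\<And>G. G \<in> set Hs \<Longrightarrow> aperiodic (2 * k) G"
    and clo: "close A A'" and c: "c \<le> real k"
    and "alignable c (A @ (concat Gs @ M @ concat Hs) @ B) (A' @ (concat Gs @ M @ concat Hs) @ B')"
  shows "alignable c (A @ (concat Gs @ M' @ concat Hs) @ B) (A' @ (concat Gs @ M' @ concat Hs) @ B')"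
proof -
  from assms(7) obtain cs where
    cs: "columns (A @ (concat Gs @ M @ concat Hs) @ B) (A' @ (concat Gs @ M @ concat Hs) @ B') cs"
      "column_cost w cs \<le> c" unfolding alignable_def by blast
  note m = mismatches_le_k[OF cs(2) c]
  have "columns (A @ concat Gs @ (M @ concat Hs @ B)) (A' @ concat Gs @ (M @ concat Hs @ B')) cs"
    using cs(1) by simp
  then obtain c1 c2 U V where c1: "cs = c1 @ c2" "concat Gs = U @ V"
    "upper c1 = A @ U" "lower c1 = A' @ U"
    by (rule synchronised[OF _ m clo sync(1,2)])
  have "columns ((A @ concat Gs @ M) @ concat Hs @ B) ((A' @ concat Gs @ M) @ concat Hs @ B') cs"
    using cs(1) by simp
  moreover have "close (A @ concat Gs @ M) (A' @ concat Gs @ M)" using clo by (simp add: close_def)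
  ultimately obtain d1 d2 U' V' where d1: "cs = d1 @ d2" "concat Hs = U' @ V'"
    "upper d1 = (A @ concat Gs @ M) @ U'" "lower d1 = (A' @ concat Gs @ M) @ U'"
    by (rule synchronised[OF _ m _ sync(3,4)])
  have d2: "upper d2 = V' @ B" "lower d2 = V' @ B'"
    using cs(1) d1 unfolding columns_def by (simp_all add: map_filter_rec)
  have N: "(None, None) \<notin> set c1" "(None, None) \<notin> set d2"
    using cs(1) c1(1) d1(1) unfolding columns_def by (metis Un_iff set_append)+
  \<comment> \<open>The first cut lies inside \<open>concat Gs\<close> and the second one not before
    \<open>concat Hs\<close>, so they cannot be in reverse order.\<close>
  have "length c1 \<le> length d1"
  proof (rule ccontr)
    assume "\<not> length c1 \<le> length d1"
    then have "length (upper d1) + length (lower d1) < length (upper c1) + length (lower c1)"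
      using length_rows_mono[of "length d1" "length c1" cs] cs(1) c1(1) d1(1)
      unfolding columns_def by (metis append_eq_conv_conj length_append le_add1 not_le)
    then show False using c1 d1 by simp
  qed
  then obtain e where e: "d1 = c1 @ e"
    using c1(1) d1(1) by (metis append_eq_append_conv_if append_take_drop_id)
  \<comment> \<open>\<open>c1\<close> ends on the diagonal before \<open>V\<close> and
    \<open>d2\<close> starts on it after \<open>U'\<close>; the columns \<open>e\<close> between
    them are replaced by free ones.\<close>
  have "columns (A @ (concat Gs @ M' @ concat Hs) @ B) (A' @ (concat Gs @ M' @ concat Hs) @ B')
     (c1 @ diagonal (V @ M' @ U') @ d2)"
    using N c1(2-4) d1(2) d2 unfolding columns_def
    by (auto simp: map_filter_append simp del: map_append)
  moreover have "column_cost w (c1 @ diagonal (V @ M' @ U') @ d2) \<le> c"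
    using cs(2) d1(1) e cost_nonneg[of e] by (simp del: map_append)
  ultimately show ?thesis unfolding alignable_def by blast
qed

lemma interch_synchronised:
  assumes "k < length Gs" "\<And>G. G \<in> set Gs \<Longrightarrow> aperiodic (2 * k) G"
      "k < length Hs" "\<And>G. G \<in> set Hs \<Longrightarrow> aperiodic (2 * k) G"
  shows "interch (concat Gs @ M @ concat Hs) (concat Gs @ concat Hs)"
  unfolding interch_def
  using interch_synchronised_aux[OF assms, of _ _ _ M _ _ "[]"]
    interch_synchronised_aux[OF assms, of _ _ _ "[]" _ _ M] by auto

end


section \<open>The dynamic program\<close>

text \<open>The recursion links the two notions of alignment: it gives both the minimum over
  coordinate sequences in \<open>ed\<close> and the least cost of a list of columns. Indices refer
  to prefixes of fixed strings, as in the program.\<close>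

fun dp :: "'a weight \<Rightarrow> 'a list \<Rightarrow> 'a list \<Rightarrow> nat \<Rightarrow> nat \<Rightarrow> real" where
  "dp w X Y 0 0 = 0"
| "dp w X Y (Suc i) 0 = dp w X Y i 0 + w (Some (X ! i)) None"
| "dp w X Y 0 (Suc j) = dp w X Y 0 j + w None (Some (Y ! j))"
| "dp w X Y (Suc i) (Suc j) =
     min (dp w X Y i j + w (Some (X ! i)) (Some (Y ! j)))
       (min (dp w X Y i (Suc j) + w (Some (X ! i)) None) (dp w X Y (Suc i) j + w None (Some (Y ! j))))"

lemma dp_step:
  assumes "q \<in> align_succs p"
  shows "dp w X Y (fst q) (snd q) \<le> dp w X Y (fst p) (snd p) + step_cost w X Y p q"
proof -
  obtain x y where p: "p = (x, y)" by (cases p)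
  have "dp w X Y (Suc x) y \<le> dp w X Y x y + w (Some (X ! x)) None" by (cases y) auto
  moreover have "dp w X Y x (Suc y) \<le> dp w X Y x y + w None (Some (Y ! y))" by (cases x) auto
  moreover have "dp w X Y (Suc x) (Suc y) \<le> dp w X Y x y + w (Some (X ! x)) (Some (Y ! y))" by auto
  ultimately show ?thesis using assms p by auto
qed

lemma dp_le_alignment_cost:
  assumes "alignment X Y A"
  shows "dp w X Y (length X) (length Y) \<le> alignment_cost w X Y A"
proof -
  have "dp w X Y (fst (A ! t)) (snd (A ! t)) \<le> (\<Sum>i<t. step_cost w X Y (A ! i) (A ! (i + 1)))"
    if "t < length A" for t
    using that
  proof (induction t)
    case 0
    then show ?case using assms by (simp add: alignment_def hd_conv_nth)
  next
    case (Suc t)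
    then have "A ! (t + 1) \<in> align_succs (A ! t)" using assms by (simp add: alignment_def)
    from dp_step[OF this, of w X Y] show ?case using Suc by simp
  qed
  moreover have "A \<noteq> []" "A ! (length A - 1) = (length X, length Y)"
    using assms by (auto simp: alignment_def last_conv_nth)
  ultimately show ?thesis
    unfolding alignment_cost_def by (metis diff_less fst_conv length_greater_0_conv snd_conv zero_less_one)
qed

text \<open>\<open>alignment\<close> with a free end point, so that optimal sequences can be
  extended cell by cell.\<close>

definition path :: "(nat \<times> nat) list \<Rightarrow> nat \<Rightarrow> nat \<Rightarrow> bool" where
  "path A i j \<longleftrightarrow> A \<noteq> [] \<and> hd A = (0, 0) \<and> last A = (i, j) \<and>
     (\<forall>t < length A - 1. A ! (t + 1) \<in> align_succs (A ! t))"

lemma path_snoc: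
  assumes "path A i j" "q \<in> align_succs (i, j)"
  shows "path (A @ [q]) (fst q) (snd q)"
    "alignment_cost w X Y (A @ [q]) = alignment_cost w X Y A + step_cost w X Y (i, j) q"
proof -
  have A: "A \<noteq> []" "A ! (length A - 1) = (i, j)"
    using assms(1) by (auto simp: path_def last_conv_nth)
  then obtain m where m: "length A = Suc m" by (cases A) auto
  show "path (A @ [q]) (fst q) (snd q)"
    using assms A m by (auto simp: path_def nth_append less_Suc_eq)
  have "(\<Sum>t<m. step_cost w X Y ((A @ [q]) ! t) ((A @ [q]) ! (t + 1)))
      = (\<Sum>t<m. step_cost w X Y (A ! t) (A ! (t + 1)))"
    by (rule sum.cong) (use m in \<open>auto simp: nth_append\<close>)
  then show "alignment_cost w X Y (A @ [q]) = alignment_cost w X Y A + step_cost w X Y (i, j) q"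
    using A m by (simp add: alignment_cost_def nth_append)
qed

lemma path_dp: "\<exists>A. path A i j \<and> alignment_cost w X Y A = dp w X Y i j"
proof (induction w X Y i j rule: dp.induct)
  case (1 w X Y)
  show ?case by (intro exI[of _ "[(0, 0)]"]) (simp add: path_def alignment_cost_def)
next
  case (2 w X Y i)
  then obtain A where "path A i 0" "alignment_cost w X Y A = dp w X Y i 0" by blast
  with path_snoc(1)[of A i 0 "(Suc i, 0)"] path_snoc(2)[of A i 0 "(Suc i, 0)" w X Y] show ?case by (intro exI[of _ "A @ [(Suc i, 0)]"]) simp
next
  case (3 w X Y j)
  then obtain A where "path A 0 j" "alignment_cost w X Y A = dp w X Y 0 j" by blast
  with path_snoc(1)[of A 0 j "(0, Suc j)"] path_snoc(2)[of A 0 j "(0, Suc j)" w X Y] show ?case by (intro exI[of _ "A @ [(0, Suc j)]"]) simp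
next
  case (4 w X Y i j)
  from 4(1) obtain A where A: "path A i j" "alignment_cost w X Y A = dp w X Y i j" by blast
  from 4(2) obtain B where B: "path B i (Suc j)" "alignment_cost w X Y B = dp w X Y i (Suc j)" by blast
  from 4(3) obtain C where C: "path C (Suc i) j" "alignment_cost w X Y C = dp w X Y (Suc i) j" by blast
  have "\<exists>A'. path A' (Suc i) (Suc j) \<and>
      alignment_cost w X Y A' = dp w X Y i j + w (Some (X ! i)) (Some (Y ! j))"
    using A path_snoc(1)[of A i j "(Suc i, Suc j)"] path_snoc(2)[of A i j "(Suc i, Suc j)" w X Y] by (intro exI[of _ "A @ [(Suc i, Suc j)]"]) simp
  moreover have "\<exists>A'. path A' (Suc i) (Suc j) \<and>
      alignment_cost w X Y A' = dp w X Y i (Suc j) + w (Some (X ! i)) None"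
    using B path_snoc(1)[of B i "Suc j" "(Suc i, Suc j)"] path_snoc(2)[of B i "Suc j" "(Suc i, Suc j)" w X Y] by (intro exI[of _ "B @ [(Suc i, Suc j)]"]) simp
  moreover have "\<exists>A'. path A' (Suc i) (Suc j) \<and>
      alignment_cost w X Y A' = dp w X Y (Suc i) j + w None (Some (Y ! j))"
    using C path_snoc(1)[of C "Suc i" j "(Suc i, Suc j)"] path_snoc(2)[of C "Suc i" j "(Suc i, Suc j)" w X Y] by (intro exI[of _ "C @ [(Suc i, Suc j)]"]) simp
  ultimately show ?case unfolding dp.simps min_def by presburger
qed

lemma ed_eq_dp: "ed w X Y = dp w X Y (length X) (length Y)"
  unfolding ed_def
proof (rule Min_eqI)
  show "finite (alignment_cost w X Y ` {A. alignment X Y A})"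
    by (intro finite_imageI finite_alignments)
  show "dp w X Y (length X) (length Y) \<le> y"
    if "y \<in> alignment_cost w X Y ` {A. alignment X Y A}" for y
    using that dp_le_alignment_cost by blast
  obtain A where "path A (length X) (length Y)" "alignment_cost w X Y A = dp w X Y (length X) (length Y)"
    using path_dp by blast
  then show "dp w X Y (length X) (length Y) \<in> alignment_cost w X Y ` {A. alignment X Y A}"
    by (auto simp: path_def alignment_def intro!: image_eqI[of _ _ A])
qed

text \<open>Only letters of the two strings are ever weighed, so a weight function that is
  constrained on the alphabet alone can be replaced by one that satisfies the axioms
  everywhere.\<close>

lemma dp_cong:
  assumes "\<And>a b. a \<in> ext_alphabet (set X \<union> set Y) \<Longrightarrow> b \<in> ext_alphabet (set X \<union> set Y) \<Longrightarrow> w a b = w' a b"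
    and "i \<le> length X" "j \<le> length Y"
  shows "dp w X Y i j = dp w' X Y i j"
  using assms by (induction w X Y i j rule: dp.induct) (simp_all add: ext_alphabet_def Suc_le_eq)

text \<open>The last column is one of the three kinds of steps, and the columns before it align the
  prefixes that belong to the cell from which this step comes.\<close>

lemma dp_le_column_cost:
  assumes "columns (take i X) (take j Y) cs" "i \<le> length X" "j \<le> length Y"
  shows "dp w X Y i j \<le> column_cost w cs"
  using assms
proof (induction cs arbitrary: i j rule: rev_induct)
  case Nil
  then have "i = 0" "j = 0" by (auto simp: columns_def map_filter_rec)
  then show ?case by simp
next
  case (snoc c cs)
  have up: "upper cs @ upper [c] = take i X" and lo: "lower cs @ lower [c] = take j Y"
    and N: "(None, None) \<notin> set cs" "c \<noteq> (None, None)"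
    using snoc.prems(1) by (auto simp: columns_def map_filter_rec)
  \<comment> \<open>A last letter in a row moves the end of the corresponding prefix back by exactly
    one.\<close>
  have snocE: "\<exists>n'. n = Suc n' \<and> xs = take n' Z \<and> a = Z ! n'"
    if "xs @ [a] = take n Z" "n \<le> length Z" for xs a n and Z :: "'a list"
  proof -
    have "length xs + 1 = n" using arg_cong[OF that(1), of length] that(2) by simp
    then obtain n' where n: "n = Suc n'" by (cases n) auto
    then have "xs @ [a] = take n' Z @ [Z ! n']" using that by (simp add: take_Suc_conv_app_nth)
    then show ?thesis using n by simp
  qed
  consider a b where "c = (Some a, Some b)" | a where "c = (Some a, None)" | b where "c = (None, Some b)"
    using N(2) by (metis option.exhaust surj_pair)
  then show ?case
  proof cases
    case 1
    obtain i' where i': "i = Suc i'" "upper cs = take i' X" "a = X ! i'"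
      using snocE[of "upper cs" a i X] up 1 snoc.prems by (auto simp: map_filter_rec)
    obtain j' where j': "j = Suc j'" "lower cs = take j' Y" "b = Y ! j'"
      using snocE[of "lower cs" b j Y] lo 1 snoc.prems by (auto simp: map_filter_rec)
    have "dp w X Y i' j' \<le> column_cost w cs"
      using snoc.IH[of i' j'] i' j' N snoc.prems by (simp add: columns_def)
    moreover have "dp w X Y i j \<le> dp w X Y i' j' + w (Some a) (Some b)" using i' j' by simp
    ultimately show ?thesis using 1 by simp
  next
    case 2
    obtain i' where i': "i = Suc i'" "upper cs = take i' X" "a = X ! i'"
      using snocE[of "upper cs" a i X] up 2 snoc.prems by (auto simp: map_filter_rec)
    have "lower cs = take j Y" using lo 2 by (simp add: map_filter_rec)
    then have "dp w X Y i' j \<le> column_cost w cs"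
      using snoc.IH[of i' j] i' N snoc.prems by (simp add: columns_def)
    moreover have "dp w X Y i j \<le> dp w X Y i' j + w (Some a) None" using i' by (cases j) simp_all
    ultimately show ?thesis using 2 by simp
  next
    case 3
    obtain j' where j': "j = Suc j'" "lower cs = take j' Y" "b = Y ! j'"
      using snocE[of "lower cs" b j Y] lo 3 snoc.prems by (auto simp: map_filter_rec)
    have "upper cs = take i X" using up 3 by (simp add: map_filter_rec)
    then have "dp w X Y i j' \<le> column_cost w cs"
      using snoc.IH[of i j'] j' N snoc.prems by (simp add: columns_def)
    moreover have "dp w X Y i j \<le> dp w X Y i j' + w None (Some b)" using j' by (cases i) simp_all
    ultimately show ?thesis using 3 by simp
  qed
qed

lemma columns_dp:
  assumes "i \<le> length X" "j \<le> length Y"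
  shows "\<exists>cs. columns (take i X) (take j Y) cs \<and> column_cost w cs = dp w X Y i j"
  using assms
proof (induction w X Y i j rule: dp.induct)
  case (1 w X Y)
  show ?case by (intro exI[of _ "[]"]) (simp add: columns_def map_filter_rec)
next
  case (2 w X Y i)
  then obtain cs where "columns (take i X) (take 0 Y) cs" "column_cost w cs = dp w X Y i 0" by auto
  then show ?case using 2
    by (intro exI[of _ "cs @ [(Some (X ! i), None)]"])
      (auto simp: columns_def map_filter_rec take_Suc_conv_app_nth)
next
  case (3 w X Y j)
  then obtain cs where "columns (take 0 X) (take j Y) cs" "column_cost w cs = dp w X Y 0 j" by auto
  then show ?case using 3
    by (intro exI[of _ "cs @ [(None, Some (Y ! j))]"])
      (auto simp: columns_def map_filter_rec take_Suc_conv_app_nth)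
next
  case (4 w X Y i j)
  from 4 obtain a where a: "columns (take i X) (take j Y) a" "column_cost w a = dp w X Y i j" by auto
  from 4 obtain b where b: "columns (take i X) (take (Suc j) Y) b" "column_cost w b = dp w X Y i (Suc j)"
    by auto
  from 4 obtain c where c: "columns (take (Suc i) X) (take j Y) c" "column_cost w c = dp w X Y (Suc i) j"
    by auto
  note t = take_Suc_conv_app_nth[of i X] take_Suc_conv_app_nth[of j Y]
  have "\<exists>cs. columns (take (Suc i) X) (take (Suc j) Y) cs \<and>
      column_cost w cs = dp w X Y i j + w (Some (X ! i)) (Some (Y ! j))"
    using a 4(4,5) t
    by (intro exI[of _ "a @ [(Some (X ! i), Some (Y ! j))]"]) (auto simp: columns_def map_filter_rec)
  moreover have "\<exists>cs. columns (take (Suc i) X) (take (Suc j) Y) cs \<and>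
      column_cost w cs = dp w X Y i (Suc j) + w (Some (X ! i)) None"
    using b 4(4,5) t
    by (intro exI[of _ "b @ [(Some (X ! i), None)]"]) (auto simp: columns_def map_filter_rec)
  moreover have "\<exists>cs. columns (take (Suc i) X) (take (Suc j) Y) cs \<and>
      column_cost w cs = dp w X Y (Suc i) j + w None (Some (Y ! j))"
    using c 4(4,5) t
    by (intro exI[of _ "c @ [(None, Some (Y ! j))]"]) (auto simp: columns_def map_filter_rec)
  ultimately show ?case unfolding dp.simps min_def by presburger
qed

context weights
begin

lemma alignable_iff_dp: "alignable c X Y \<longleftrightarrow> dp w X Y (length X) (length Y) \<le> c"
  using columns_dp[of "length X" X "length Y" Y w] dp_le_column_cost[of "length X" X "length Y" Y _ w]
  unfolding alignable_def by force

text \<open>Each unit of length difference needs a mismatched column of cost at least 1. Hence cells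
  outside the band of \<open>2 k + 1\<close> diagonals have values above \<open>k\<close>.\<close>

lemma length_diff_le_dp:
  assumes "i \<le> length X" "j \<le> length Y"
  shows "real i \<le> real j + dp w X Y i j" "real j \<le> real i + dp w X Y i j"
proof -
  obtain cs where cs: "columns (take i X) (take j Y) cs" "column_cost w cs = dp w X Y i j"
    using columns_dp[OF assms] by blast
  then have "real i \<le> real j + mismatches cs" "real j \<le> real i + mismatches cs"
    using length_rows_mismatches[of cs] assms by (auto simp: columns_def)
  with mismatches_le_cost[of cs] cs(2)
  show "real i \<le> real j + dp w X Y i j" "real j \<le> real i + dp w X Y i j" by linarith+
qed

end


section \<open>Covering the upper string by runs\<close>

text \<open>The diagonal that pairs position \<open>i\<close> of \<open>X\<close> with position \<open>i + d\<close> of \<open>Y\<close>, where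
  \<open>- k \<le> d \<le> k\<close>, is represented by the natural number \<open>j = d + k\<close>.\<close>

definition agree :: "'a list \<Rightarrow> 'a list \<Rightarrow> nat \<Rightarrow> nat \<Rightarrow> nat \<Rightarrow> bool" where
  "agree X Y k j i \<longleftrightarrow> i < length X \<and> i + j - k < length Y \<and> X ! i = Y ! (i + j - k)"

text \<open>The window is asymmetric: the uniqueness argument steps back from \<open>x\<close> by
  two shifts of at most \<open>2 * k\<close> each, but forward by only one.\<close>

definition hit :: "'a list \<Rightarrow> 'a list \<Rightarrow> nat \<Rightarrow> nat \<Rightarrow> nat \<Rightarrow> bool" where
  "hit X Y k j x \<longleftrightarrow> (\<forall>i. x - 4 * k \<le> i \<and> i \<le> x + 2 * k \<longrightarrow> agree X Y k j i)"

text \<open>A relation, because any diagonal that matches the whole window may be followed to its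
  first disagreement \<open>x'\<close>. If no diagonal does, the search jumps just past the
  window.\<close>

definition run_step :: "'a list \<Rightarrow> 'a list \<Rightarrow> nat \<Rightarrow> nat \<Rightarrow> nat \<Rightarrow> bool" where
  "run_step X Y k x x' \<longleftrightarrow> x + 2 * k < length X \<and>
     ((\<exists>j \<le> 2 * k. x + 2 * k < x' \<and> (\<forall>i. x - 4 * k \<le> i \<and> i < x' \<longrightarrow> agree X Y k j i) \<and>
          \<not> agree X Y k j x') \<or>
      (\<forall>j \<le> 2 * k. \<not> hit X Y k j x) \<and> x' = x + 2 * k + 1)"

text \<open>After a maximal run has stopped inside a matched fragment, the surroundings of the
  stopping position have no period up to \<open>2 k\<close>, so only the diagonal of the fragment hits.\<close>

lemma hit_unique:
  assumes "0 < k" "5 * k \<le> x" "j0 \<le> 2 * k" "js \<le> 2 * k" "j1 \<le> 2 * k"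
    and run: "\<And>i. x - 4 * k \<le> i \<Longrightarrow> i < x \<Longrightarrow> agree X Y k j0 i" and stop: "\<not> agree X Y k j0 x"
    and frag: "\<And>i. x - 4 * k \<le> i \<Longrightarrow> i \<le> x + 2 * k \<Longrightarrow> agree X Y k js i"
    and hit: "hit X Y k j1 x"
  shows "j1 = js"
proof (rule ccontr)
  assume ne: "j1 \<noteq> js"
  have h: "X ! i = Y ! (i + j1 - k)" if "x - 4 * k \<le> i" "i \<le> x + 2 * k" for i
    using hit that by (simp add: hit_def agree_def)
  have f: "i < length X" "i + js - k < length Y" "X ! i = Y ! (i + js - k)"
    if "x - 4 * k \<le> i" "i \<le> x + 2 * k" for i
    using frag that by (simp_all add: agree_def)
  have r: "X ! i = Y ! (i + j0 - k)" if "x - 4 * k \<le> i" "i < x" for i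
    using run that by (simp add: agree_def)
  have "x + 2 * k + js - k < length Y" by (rule f(2)) linarith+
  then have "x + j0 - k < length Y" using assms(3) by linarith
  then have s: "X ! x \<noteq> Y ! (x + j0 - k)"
    using stop f(1)[of x] by (simp add: agree_def)
  have ne0: "j0 \<noteq> js" using f(3)[of x] s by auto
  \<comment> \<open>Both \<open>j1\<close> and \<open>js\<close> match the whole window, so
    comparing them gives \<open>X\<close> the period \<open>q'\<close> there.\<close>
  define q' where "q' = (if j1 < js then js - j1 else j1 - js)"
  have q': "0 < q'" "q' \<le> 2 * k" using ne assms unfolding q'_def by auto
  have per': "X ! i = X ! (i + q')" if "x - 4 * k \<le> i" "i + q' \<le> x + 2 * k" for i
  proof (cases "j1 < js")
    case True
    then have "i + q' + j1 - k = i + js - k" unfolding q'_def by simp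
    then show ?thesis using h[of "i + q'"] f(3)[of i] that by simp
  next
    case False
    then have "i + q' + js - k = i + j1 - k" unfolding q'_def by simp
    then show ?thesis using h[of "i"] f(3)[of "i + q'"] that by simp
  qed
  show False
  proof (cases "j0 < js")
    case True
    define q where "q = js - j0"
    have q: "0 < q" "q \<le> 2 * k" "x - q + js - k = x + j0 - k" using True assms unfolding q_def by auto
    have per: "X ! i = X ! (i + q)" if "x - 4 * k \<le> i" "i + q < x" for i
      using r[of "i + q"] f(3)[of i] that True assms by (simp add: q_def)
    \<comment> \<open>On the diagonal \<open>js\<close>, the letter of \<open>Y\<close> that stops
      \<open>j0\<close> is paired with \<open>X ! (x - q)\<close>. The periods \<open>q'\<close> and
      \<open>q\<close> lead from there through \<open>x - q - q'\<close> and \<open>x - q'\<close>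
      to \<open>x\<close>, which contradicts the stop.\<close>
    have "X ! (x - q) = Y ! (x + j0 - k)" using f(3)[of "x - q"] q by simp
    moreover have "X ! (x - q) = X ! (x - q - q')" using per'[of "x - q - q'"] q q' assms by simp
    moreover have "X ! (x - q - q') = X ! (x - q')"
      using per[of "x - q - q'"] q q' assms by (simp add: diff_commute)
    moreover have "X ! (x - q') = X ! x" using per'[of "x - q'"] q q' assms by simp
    ultimately show False using s by simp
  next
    case False
    define q where "q = j0 - js"
    have q: "0 < q" "q \<le> 2 * k" "x + q + js - k = x + j0 - k" using False ne0 assms unfolding q_def by auto
    have per: "X ! i = X ! (i + q)" if "x - 4 * k \<le> i" "i < x" for i
      using r[of i] f(3)[of "i + q"] that False assms q by (simp add: q_def)
    \<comment> \<open>The mirrored case: the stopping letter is paired with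
      \<open>X ! (x + q)\<close>, which is reached from \<open>x\<close> through
      \<open>x - q'\<close> and \<open>x - q' + q\<close>.\<close>
    have "X ! (x + q) = Y ! (x + j0 - k)" using f(3)[of "x + q"] q by simp
    moreover have "X ! (x - q') = X ! x" using per'[of "x - q'"] q q' assms by simp
    moreover have "X ! (x - q') = X ! (x - q' + q)" using per[of "x - q'"] q q' assms by simp
    moreover have "X ! (x - q' + q) = X ! (x + q)" using per'[of "x - q' + q"] q q' assms by simp
    ultimately show False using s by simp
  qed
qed

lemma run_step_gt: "run_step X Y k x x' \<Longrightarrow> x + 2 * k < x'"
  by (auto simp: run_step_def)

lemma run_step_le: "run_step X Y k x x' \<Longrightarrow> x' \<le> length X"
proof -
  assume s: "run_step X Y k x x'"
  show ?thesis
  proof (cases "x' = x + 2 * k + 1")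
    case True
    then show ?thesis using s by (simp add: run_step_def)
  next
    case False
    then obtain j where "x + 2 * k < x'" "\<forall>i. x - 4 * k \<le> i \<and> i < x' \<longrightarrow> agree X Y k j i"
      using s by (auto simp: run_step_def)
    then have "agree X Y k j (x' - 1)" by auto
    then show ?thesis using \<open>x + 2 * k < x'\<close> by (auto simp: agree_def)
  qed
qed

text \<open>Within a matched fragment the first two steps move the window inside, a third one may
  follow a wrong diagonal, and the fourth one reaches the end.\<close>

lemma four_run_steps:
  assumes "0 < k" "5 * k \<le> x0" "js \<le> 2 * k" and frag: "\<And>i. x0 \<le> i \<Longrightarrow> i < f \<Longrightarrow> agree X Y k js i"
    and s: "run_step X Y k x0 x1" "run_step X Y k x1 x2" "run_step X Y k x2 x3" "run_step X Y k x3 x4"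
  shows "f \<le> x4"
proof (rule ccontr)
  assume "\<not> f \<le> x4"
  note gt = s[THEN run_step_gt]
  have f: "x3 + 2 * k < f" "x2 + 2 * k < f" using gt \<open>\<not> f \<le> x4\<close> by linarith+
  have x2: "x0 + 4 * k \<le> x2" using gt by linarith
  \<comment> \<open>After two steps the \<open>4 * k\<close> positions behind \<open>x2\<close> lie
    in the fragment. So some diagonal matches the window, and the third step is a run and not a
    jump; the same applies at \<open>x3\<close>.\<close>
  have "hit X Y k js x2" using frag f x2 unfolding hit_def by auto
  then have "\<not> (\<forall>j \<le> 2 * k. \<not> hit X Y k j x2)" using assms by blast
  then obtain j0 where j0: "j0 \<le> 2 * k" "\<And>i. x2 - 4 * k \<le> i \<Longrightarrow> i < x3 \<Longrightarrow> agree X Y k j0 i"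
    "\<not> agree X Y k j0 x3"
    using s(3) unfolding run_step_def by blast
  have fr3: "agree X Y k js i" if "x3 - 4 * k \<le> i" "i \<le> x3 + 2 * k" for i
    using that f x2 gt by (intro frag) linarith+
  then have "hit X Y k js x3" unfolding hit_def by blast
  then have "\<not> (\<forall>j \<le> 2 * k. \<not> hit X Y k j x3)" using assms by blast
  then obtain j1 where j1: "j1 \<le> 2 * k" "\<And>i. x3 - 4 * k \<le> i \<Longrightarrow> i < x4 \<Longrightarrow> agree X Y k j1 i"
    "\<not> agree X Y k j1 x4"
    using s(4) unfolding run_step_def by blast
  have "hit X Y k j1 x3" using j1(2) gt unfolding hit_def by auto
  have r3: "agree X Y k j0 i" if "x3 - 4 * k \<le> i" "i < x3" for i
    using that gt by (intro j0(2)) linarith+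
  have "5 * k \<le> x3" using gt assms by linarith
  from hit_unique[OF assms(1) this j0(1) assms(3) j1(1) r3 j0(3) fr3 \<open>hit X Y k j1 x3\<close>]
  have "j1 = js" by blast
  moreover have "agree X Y k js x4" using \<open>\<not> f \<le> x4\<close> gt by (intro frag) linarith+
  ultimately show False using j1(3) by simp
qed

text \<open>The mismatch budget to the right of a search position; every fragment that the search
  leaves behind lowers it by one.\<close>

definition remaining :: "('a option \<times> 'a option) list \<Rightarrow> nat \<Rightarrow> nat \<Rightarrow> bool" where
  "remaining cs x r \<longleftrightarrow> (\<exists>c1 c2. cs = c1 @ c2 \<and> length (upper c1) = x \<and> mismatches c2 \<le> r)"

lemma remaining_mono:
  assumes "remaining cs x r" "x \<le> x'" "x' \<le> length (upper cs)"
  shows "remaining cs x' r"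
proof -
  obtain c1 c2 where c: "cs = c1 @ c2" "length (upper c1) = x" "mismatches c2 \<le> r"
    using assms(1) unfolding remaining_def by blast
  have "upper c2 = take (x' - x) (upper c2) @ drop (x' - x) (upper c2)" by simp
  then obtain d1 d2 where d: "c2 = d1 @ d2" "upper d1 = take (x' - x) (upper c2)"
    by (rule split_upper)
  have "length (upper (c1 @ d1)) = x'" using c d(2) assms(2,3) by (simp add: map_filter_append)
  moreover have "mismatches d2 \<le> r" using c d by simp
  ultimately show ?thesis using c(1) d(1) unfolding remaining_def by (metis append.assoc)
qed

text \<open>The columns up to the next mismatch form a fragment on the diagonal of the cut. The
  mismatched column that ends it takes one unit of the budget and at most one letter of
  \<open>X\<close>, whence \<open>f + 1\<close>.\<close>

lemma remaining_fragment:
  assumes cs: "columns X Y cs" "mismatches cs \<le> k" and "remaining cs x r" "k \<le> x"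
  obtains f j where "x \<le> f" "f \<le> length X" "j \<le> 2 * k"
    "\<And>i. x \<le> i \<Longrightarrow> i < f \<Longrightarrow> agree X Y k j i"
    "f = length X \<or> (\<exists>r' f'. r = Suc r' \<and> f' \<le> f + 1 \<and> remaining cs f' r')"
proof -
  obtain c1 c2 where c: "cs = c1 @ c2" "length (upper c1) = x" "mismatches c2 \<le> r"
    using assms(3) unfolding remaining_def by blast
  define m where "m = takeWhile (\<lambda>c. fst c = snd c) c2"
  define rest where "rest = dropWhile (\<lambda>c. fst c = snd c) c2"
  have c2: "c2 = m @ rest" unfolding m_def rest_def by simp
  have "mismatches m = 0" unfolding m_def mismatches_def
    by (auto dest: set_takeWhileD simp: filter_empty_conv)
  then have lm: "lower m = upper m" by (rule no_mismatch_rows)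
  define y where "y = length (lower c1)"
  have "mismatches c1 \<le> k" using cs(2) c(1) by simp
  then have xy: "x \<le> y + k" "y \<le> x + k"
    using length_rows_mismatches[of c1] c(2) unfolding y_def by linarith+
  define f where "f = x + length (upper m)"
  have X: "X = upper c1 @ upper m @ upper rest" and Y: "Y = lower c1 @ upper m @ lower rest"
    using cs(1) c(1) c2 lm unfolding columns_def by (auto simp: map_filter_append)
  show ?thesis
  proof (rule that[of f "y + k - x"])
    show "x \<le> f" "f \<le> length X" "y + k - x \<le> 2 * k" using X c(2) xy by (auto simp: f_def)
    fix i assume i: "x \<le> i" "i < f"
    define o' where "o' = i - x"
    have o': "o' < length (upper m)" "i = x + o'" using i by (auto simp: f_def o'_def)
    have e: "i + (y + k - x) - k = y + o'" using o' xy by simp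
    have "X ! i = upper m ! o'"
      unfolding X o'(2) c(2)[symmetric] nth_append_length_plus using o'(1) by (simp add: nth_append)
    moreover have "Y ! (y + o') = upper m ! o'"
      unfolding Y y_def nth_append_length_plus using o'(1) by (simp add: nth_append)
    moreover have "i < length X" "y + o' < length Y" using o' X Y c(2) y_def by auto
    ultimately show "agree X Y k (y + k - x) i" unfolding agree_def e by simp
  next
    show "f = length X \<or> (\<exists>r' f'. r = Suc r' \<and> f' \<le> f + 1 \<and> remaining cs f' r')"
    proof (cases rest)
      case Nil
      then show ?thesis using X c(2) by (simp add: f_def map_filter_rec)
    next
      case (Cons b c3)
      then have "fst b \<noteq> snd b" unfolding rest_def by (simp add: dropWhile_eq_Cons_conv)
      then have r: "Suc (mismatches c3) \<le> r" using c(3) c2 Cons by simp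
      then obtain r' where r': "r = Suc r'" by (cases r) auto
      have "cs = (c1 @ m @ [b]) @ c3" using c(1) c2 Cons by simp
      then have "remaining cs (length (upper (c1 @ m @ [b]))) r'"
        unfolding remaining_def using r r' by (metis Suc_le_mono)
      moreover have "length (upper (c1 @ m @ [b])) \<le> f + 1"
        using c(2) by (simp add: f_def map_filter_rec split: option.split)
      ultimately show ?thesis using r' by blast
    qed
  qed
qed

text \<open>Four steps reach the end of the current fragment, the fifth passes the mismatched column
  behind it. If the fragment extended to the end of \<open>X\<close>, there would be no fifth
  step.\<close>

lemma five_run_steps:
  assumes cs: "columns X Y cs" "mismatches cs \<le> k" and "0 < k" "remaining cs x0 r" "5 * k \<le> x0"
    and s: "run_step X Y k x0 x1" "run_step X Y k x1 x2" "run_step X Y k x2 x3"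
      "run_step X Y k x3 x4" "run_step X Y k x4 x5"
  obtains r' where "r = Suc r'" "remaining cs x5 r'"
proof -
  have "k \<le> x0" using assms by simp
  obtain f j where f: "x0 \<le> f" "f \<le> length X" "j \<le> 2 * k"
    "\<And>i. x0 \<le> i \<Longrightarrow> i < f \<Longrightarrow> agree X Y k j i"
    "f = length X \<or> (\<exists>r' f'. r = Suc r' \<and> f' \<le> f + 1 \<and> remaining cs f' r')"
    by (rule remaining_fragment[OF cs assms(4) \<open>k \<le> x0\<close>]) blast
  have "f \<le> x4" by (rule four_run_steps[OF assms(3,5) f(3,4) s(1-4)])
  have x5: "x4 < x5" "x5 \<le> length X" using s(5) run_step_gt run_step_le by fastforce+
  then have "f \<noteq> length X" using \<open>f \<le> x4\<close> by linarith
  then obtain r' f' where r': "r = Suc r'" "f' \<le> f + 1" "remaining cs f' r'" using f(5) by blast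
  have "x5 \<le> length (upper cs)" using x5 cs(1) by (simp add: columns_def)
  with r' x5 \<open>f \<le> x4\<close> have "remaining cs x5 r'" by (intro remaining_mono[OF r'(3)]) simp_all
  with r' that show ?thesis by blast
qed

lemma run_steps_ge: "(run_step X Y k ^^ t) x x' \<Longrightarrow> x \<le> x'"
proof (induction t arbitrary: x')
  case (Suc t)
  then obtain y where "(run_step X Y k ^^ t) x y" "run_step X Y k y x'" by auto
  then show ?case using Suc.IH run_step_gt by fastforce
qed simp

text \<open>Each group of five steps uses up one mismatch, and \<open>k + 1\<close> groups would
  need \<open>k + 1\<close> of them. This is the origin of the step limit \<open>5 * k + 5\<close>
  in the program.\<close>

lemma number_of_run_steps:
  assumes cs: "columns X Y cs" "mismatches cs \<le> k" and "0 < k"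
    and steps: "(run_step X Y k ^^ t) (5 * k) x"
  shows "t < 5 * (k + 1)"
proof (rule ccontr)
  assume "\<not> t < 5 * (k + 1)"
  then have "t = 5 * (k + 1) + (t - 5 * (k + 1))" by simp
  then obtain z where z: "(run_step X Y k ^^ (5 * (k + 1))) (5 * k) z"
    using steps by (metis relcomppE relpowp_add)
  have five: "\<exists>x0 x1 x2 x3 x4. (run_step X Y k ^^ n) (5 * k) x0 \<and> run_step X Y k x0 x1 \<and>
      run_step X Y k x1 x2 \<and> run_step X Y k x2 x3 \<and> run_step X Y k x3 x4 \<and> run_step X Y k x4 x"
    if "(run_step X Y k ^^ (n + 5)) (5 * k) x" for n x
    using that by (simp add: numeral_eq_Suc relcompp.simps) blast
  have le: "5 * k \<le> length (upper cs)"
  proof -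
    have "(run_step X Y k ^^ (5 * k + 5)) (5 * k) z" using z by (simp add: add.commute)
    from five[OF this] obtain x0 x1 where "(run_step X Y k ^^ (5 * k)) (5 * k) x0"
      "run_step X Y k x0 x1" by blast
    then have "5 * k \<le> x0" "x0 < length X" by (auto dest: run_steps_ge simp: run_step_def)
    then show ?thesis using cs(1) by (simp add: columns_def)
  qed
  have "remaining cs 0 k" unfolding remaining_def
    by (intro exI[of _ "[]"] exI[of _ cs]) (simp add: cs map_filter_rec)
  then have start: "remaining cs (5 * k) k" using le by (auto intro: remaining_mono)
  have rem: "\<exists>r. remaining cs x r \<and> r + m = k" if "(run_step X Y k ^^ (5 * m)) (5 * k) x" for m x
    using that
  proof (induction m arbitrary: x)
    case 0
    then show ?case using start by auto
  next
    case (Suc m)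
    then have "(run_step X Y k ^^ (5 * m + 5)) (5 * k) x" by (simp add: add.commute)
    from five[OF this] obtain x0 x1 x2 x3 x4 where x: "(run_step X Y k ^^ (5 * m)) (5 * k) x0"
      "run_step X Y k x0 x1" "run_step X Y k x1 x2" "run_step X Y k x2 x3" "run_step X Y k x3 x4"
      "run_step X Y k x4 x" by blast
    from Suc.IH[OF x(1)] obtain r where r: "remaining cs x0 r" "r + m = k" by blast
    obtain r' where "r = Suc r'" "remaining cs x r'"
      by (rule five_run_steps[OF cs assms(3) r(1) run_steps_ge[OF x(1)] x(2-6)])
    then show ?case using r by auto
  qed
  from rem[of "k + 1" z] z show False by simp
qed


section \<open>Program logic\<close>

declare One_nat_def [simp del]

text \<open>Total correctness with the running time as an argument of the postcondition. Since
  execution is deterministic, the existential form still yields equivalences for the atomic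
  commands.\<close>

definition wp :: "nat \<Rightarrow> nat weight \<Rightarrow> com \<Rightarrow> (nat \<Rightarrow> state \<Rightarrow> bool) \<Rightarrow> state \<Rightarrow> bool" where
  "wp W w P Q s \<longleftrightarrow> (\<exists>t s'. exec W w P s t s' \<and> Q t s')"

lemma wp_conseq: "wp W w P Q s \<Longrightarrow> (\<And>t s'. Q t s' \<Longrightarrow> Q' t s') \<Longrightarrow> wp W w P Q' s"
  unfolding wp_def by blast

lemma wp_Skip: "wp W w Skip Q s \<longleftrightarrow> Q 1 s"
  unfolding wp_def by (metis exec.Skip exec_deterministic)

lemma wp_WAssign: "wp W w (WAssign v e) Q s \<longleftrightarrow>
    Q (1 + wtime e) (s\<lparr>wvar := (wvar s)(v := wval W s e)\<rparr>)"
  unfolding wp_def by (metis exec.WAssign exec_deterministic)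

lemma wp_WStore: "wp W w (WStore a i e) Q s \<longleftrightarrow>
    Q (1 + wtime i + wtime e) (s\<lparr>warr := (warr s)(a := (warr s a)(wval W s i := wval W s e))\<rparr>)"
  unfolding wp_def by (metis exec.WStore exec_deterministic)

lemma wp_RAssign: "wp W w (RAssign v e) Q s \<longleftrightarrow>
    Q (1 + rtime e) (s\<lparr>rvar := (rvar s)(v := rval W w s e)\<rparr>)"
  unfolding wp_def by (metis exec.RAssign exec_deterministic)

lemma wp_RStore: "wp W w (RStore a i e) Q s \<longleftrightarrow>
    Q (1 + wtime i + rtime e) (s\<lparr>rarr := (rarr s)(a := (rarr s a)(wval W s i := rval W w s e))\<rparr>)"
  unfolding wp_def by (metis exec.RStore exec_deterministic)

lemma wp_Seq: "wp W w (Seq A B) Q s \<longleftrightarrow> wp W w A (\<lambda>t s'. wp W w B (\<lambda>t'. Q (t + t')) s') s"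
  unfolding wp_def by (blast elim: exec_elims(6) intro: exec.Seq)

lemma wp_Cond: "wp W w (Cond b A B) Q s \<longleftrightarrow>
    (if bval W w s b then wp W w A (\<lambda>t. Q (1 + btime b + t)) s
     else wp W w B (\<lambda>t. Q (1 + btime b + t)) s)"
proof
  assume "wp W w (Cond b A B) Q s"
  then obtain t s' where "exec W w (Cond b A B) s t s'" "Q t s'" unfolding wp_def by blast
  then show "if bval W w s b then wp W w A (\<lambda>t. Q (1 + btime b + t)) s
     else wp W w B (\<lambda>t. Q (1 + btime b + t)) s"
    by (elim exec_elims(7)) (auto simp: wp_def One_nat_def)
next
  assume "if bval W w s b then wp W w A (\<lambda>t. Q (1 + btime b + t)) s
     else wp W w B (\<lambda>t. Q (1 + btime b + t)) s"
  then show "wp W w (Cond b A B) Q s"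
    unfolding wp_def using exec.CondTrue exec.CondFalse by (metis (no_types, lifting))
qed

lemmas wp_simps = wp_Skip wp_WAssign wp_WStore wp_RAssign wp_RStore wp_Seq wp_Cond

text \<open>\<open>\<mu>\<close> is a potential measured in time units: it pays for each test and
  body, and as this is at least one unit it also proves termination. The final failing test is the
  extra \<open>1 + btime b\<close>.\<close>

lemma wp_While:
  assumes step: "\<And>s. I s \<Longrightarrow> bval W w s b \<Longrightarrow>
      wp W w P (\<lambda>t s'. I s' \<and> t + 1 + btime b + \<mu> s' \<le> \<mu> s) s"
    and "I s"
  shows "wp W w (While b P) (\<lambda>t s'. I s' \<and> \<not> bval W w s' b \<and> t + \<mu> s' \<le> \<mu> s + 1 + btime b) s"
  using \<open>I s\<close>
proof (induction "\<mu> s" arbitrary: s rule: less_induct)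
  case less
  show ?case
  proof (cases "bval W w s b")
    case True
    from step[OF less.prems True] obtain t s' where P: "exec W w P s t s'" "I s'"
      "t + 1 + btime b + \<mu> s' \<le> \<mu> s" unfolding wp_def by blast
    from less.hyps[OF _ P(2)] P(3) obtain t' s'' where "exec W w (While b P) s' t' s''"
      "I s''" "\<not> bval W w s'' b" "t' + \<mu> s'' \<le> \<mu> s' + 1 + btime b" unfolding wp_def by auto
    with P exec.WhileTrue[OF True P(1)] show ?thesis unfolding wp_def
      by (intro exI[of _ "1 + btime b + t + t'"] exI[of _ s'']) auto
  next
    case False
    then show ?thesis unfolding wp_def
      using exec.WhileFalse[OF False] less.prems by fastforce
  qed
qed

definition incr :: "nat \<Rightarrow> com" where
  "incr v = WAssign v (WOp Add (WVar v) (WConst 1))"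

lemma wp_incr:
  assumes "wvar s v + 1 < 2 ^ W"
  shows "wp W w (incr v) Q s \<longleftrightarrow> Q 4 (s\<lparr>wvar := (wvar s)(v := wvar s v + 1)\<rparr>)"
proof -
  have "W \<noteq> 0" using assms by (cases W) auto
  then show ?thesis using assms by (simp add: incr_def wp_WAssign)
qed

lemma wp_incrI:
  "wvar s v + 1 < 2 ^ W \<Longrightarrow> s' = s\<lparr>wvar := (wvar s)(v := wvar s v + 1)\<rparr> \<Longrightarrow> Q 4 s' \<Longrightarrow>
    wp W w (incr v) Q s"
  by (simp add: wp_incr)

abbreviation mkst :: "(nat \<Rightarrow> nat) \<Rightarrow> (nat \<Rightarrow> nat \<Rightarrow> nat) \<Rightarrow> (nat \<Rightarrow> real) \<Rightarrow> (nat \<Rightarrow> nat \<Rightarrow> real) \<Rightarrow> state" where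
  "mkst f g h q \<equiv> \<lparr>wvar = f, warr = g, rvar = h, rarr = q\<rparr>"

text \<open>\<open>M\<close> is a position where the test is known to fail; it bounds the scan and,
  by \<open>M < 2 ^ W\<close>, keeps the counter from wrapping around.\<close>

lemma wp_scan:
  assumes "i0 \<le> M" "M < 2 ^ W" "\<not> bval W w (mkst (f(v := M)) g h q) b"
  shows "wp W w (While b (incr v)) (\<lambda>t s'. \<exists>i. i0 \<le> i \<and> i \<le> M \<and> s' = mkst (f(v := i)) g h q \<and>
      \<not> bval W w (mkst (f(v := i)) g h q) b \<and>
      (\<forall>l. i0 \<le> l \<and> l < i \<longrightarrow> bval W w (mkst (f(v := l)) g h q) b) \<and>
      t \<le> (i - i0) * (btime b + 5) + btime b + 1) (mkst (f(v := i0)) g h q)"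
proof -
  let ?st = "\<lambda>i. mkst (f(v := i)) g h q"
  define I where "I s \<longleftrightarrow> (\<exists>i. i0 \<le> i \<and> i \<le> M \<and> s = ?st i \<and>
      (\<forall>l. i0 \<le> l \<and> l < i \<longrightarrow> bval W w (?st l) b))" for s
  have "wp W w (While b (incr v)) (\<lambda>t s'. I s' \<and> \<not> bval W w s' b \<and>
      t + (M - wvar s' v) * (btime b + 5) \<le> (M - wvar (?st i0) v) * (btime b + 5) + 1 + btime b) (?st i0)"
  proof (rule wp_While)
    fix s assume "I s" and b: "bval W w s b"
    then obtain i where i: "i0 \<le> i" "i \<le> M" "s = ?st i" "\<forall>l. i0 \<le> l \<and> l < i \<longrightarrow> bval W w (?st l) b"
      unfolding I_def by blast
    have "i \<noteq> M" using assms(3) b i(3) by blast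
    then have lt: "i < M" using i(2) by simp
    have "\<forall>l. i0 \<le> l \<and> l < i + 1 \<longrightarrow> bval W w (?st l) b"
      using i b by (metis Suc_eq_plus1 less_Suc_eq)
    then have "I (?st (i + 1))" unfolding I_def
      using i(1) lt by (intro exI[of _ "i + 1"] conjI) (linarith | blast | rule refl)+
    moreover have "4 + 1 + btime b + (M - (i + 1)) * (btime b + 5) \<le> (M - i) * (btime b + 5)"
    proof -
      obtain e where "M = i + 1 + e" using lt by (auto simp: less_iff_Suc_add)
      then show ?thesis by (simp add: add_mult_distrib)
    qed
    moreover have "i + 1 < 2 ^ W" using lt assms(2) by linarith
    ultimately have "I (?st (i + 1)) \<and> 4 + 1 + btime b + (M - wvar (?st (i + 1)) v) * (btime b + 5)
        \<le> (M - wvar (?st i) v) * (btime b + 5)" "wvar (?st i) v + 1 < 2 ^ W"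
      by simp_all
    then show "wp W w (incr v) (\<lambda>t s'. I s' \<and>
        t + 1 + btime b + (M - wvar s' v) * (btime b + 5) \<le> (M - wvar s v) * (btime b + 5)) s"
      unfolding i(3) by (intro wp_incrI[where s' = "?st (i + 1)"]) (simp_all add: fun_eq_iff)
  next
    show "I (?st i0)" unfolding I_def using assms(1) by (intro exI[of _ i0]) auto
  qed
  then show ?thesis
  proof (rule wp_conseq)
    fix t s'
    assume "I s' \<and> \<not> bval W w s' b \<and>
      t + (M - wvar s' v) * (btime b + 5) \<le> (M - wvar (?st i0) v) * (btime b + 5) + 1 + btime b"
    then obtain i where i: "i0 \<le> i" "i \<le> M" "s' = ?st i" "\<not> bval W w (?st i) b"
      "\<forall>l. i0 \<le> l \<and> l < i \<longrightarrow> bval W w (?st l) b"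
      "t + (M - i) * (btime b + 5) \<le> (M - i0) * (btime b + 5) + 1 + btime b"
      unfolding I_def by auto
    have "M - i0 = (i - i0) + (M - i)" using i by simp
    then have "t \<le> (i - i0) * (btime b + 5) + btime b + 1" using i(6) by (simp add: add_mult_distrib)
    with i show "\<exists>i. i0 \<le> i \<and> i \<le> M \<and> s' = ?st i \<and> \<not> bval W w (?st i) b \<and>
      (\<forall>l. i0 \<le> l \<and> l < i \<longrightarrow> bval W w (?st l) b) \<and> t \<le> (i - i0) * (btime b + 5) + btime b + 1"
      by blast
  qed
qed

definition copy :: "nat \<Rightarrow> nat \<Rightarrow> nat \<Rightarrow> nat \<Rightarrow> nat \<Rightarrow> com" where
  "copy a b i e d = While (WLess (WVar i) (WVar e))
     (Seq (WStore b (WVar d) (WArr a (WVar i))) (Seq (incr i) (incr d)))"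

definition paste :: "(nat \<Rightarrow> 'b) \<Rightarrow> nat \<Rightarrow> nat \<Rightarrow> (nat \<Rightarrow> 'b) \<Rightarrow> nat \<Rightarrow> nat \<Rightarrow> 'b" where
  "paste src i len dst d = (\<lambda>r. if d \<le> r \<and> r < d + len then src (i + (r - d)) else dst r)"

text \<open>The arrays may coincide as long as the block is moved downwards.\<close>

lemma wp_copy:
  assumes "i \<noteq> e" "i \<noteq> d" "e \<noteq> d" "f i \<le> f e" "f e < 2 ^ W" "f d + (f e - f i) < 2 ^ W"
    "a = b \<Longrightarrow> f d \<le> f i"
  shows "wp W w (copy a b i e d) (\<lambda>t s'. t \<le> 16 * (f e - f i) + 4 \<and>
      s' = mkst (f(i := f e, d := f d + (f e - f i))) (g(b := paste (g a) (f i) (f e - f i) (g b) (f d))) h q)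
    (mkst f g h q)"
proof -
  define st where "st c = mkst (f(i := f i + c, d := f d + c)) (g(b := paste (g a) (f i) c (g b) (f d))) h q" for c
  define I where "I s \<longleftrightarrow> (\<exists>c \<le> f e - f i. s = st c)" for s
  have "wp W w (copy a b i e d) (\<lambda>t s'. I s' \<and> \<not> bval W w s' (WLess (WVar i) (WVar e)) \<and>
      t + 16 * (wvar s' e - wvar s' i) \<le> 16 * (wvar (mkst f g h q) e - wvar (mkst f g h q) i)
        + 1 + btime (WLess (WVar i) (WVar e))) (mkst f g h q)"
    unfolding copy_def
  proof (rule wp_While)
    have "paste (g a) (f i) 0 (g b) (f d) = g b" by (auto simp: paste_def)
    then have "mkst f g h q = st 0" by (simp add: st_def)
    then show "I (mkst f g h q)" unfolding I_def by auto
  next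
    fix s assume "I s" and b: "bval W w s (WLess (WVar i) (WVar e))"
    then obtain c where c: "c \<le> f e - f i" "s = st c" unfolding I_def by blast
    then have lt: "f i + c < f e" using b assms by (simp add: st_def)
    \<comment> \<open>For \<open>a = b\<close>, the cells written so far lie below
      \<open>f i + c\<close>, since the target does not start above the source; the next cell to be
      read is unchanged.\<close>
    have val: "(g(b := paste (g a) (f i) c (g b) (f d))) a (f i + c) = g a (f i + c)"
      using assms(7) by (auto simp: paste_def)
    have p: "(paste (g a) (f i) c (g b) (f d))(f d + c := g a (f i + c)) = paste (g a) (f i) (c + 1) (g b) (f d)"
      by (auto simp: paste_def)
    have "st (c + 1) = mkst (f(i := f i + c + 1, d := f d + c + 1))
         (g(b := (paste (g a) (f i) c (g b) (f d))(f d + c := g a (f i + c)))) h q"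
      unfolding st_def p by (simp add: add.assoc)
    moreover have "I (st (c + 1))" unfolding I_def using lt by (intro exI[of _ "c + 1"]) simp
    ultimately have I': "I (mkst (f(i := f i + c + 1, d := f d + c + 1))
         (g(b := (paste (g a) (f i) c (g b) (f d))(f d + c := g a (f i + c)))) h q)" by simp
    have tw: "f(i := x, d := y, i := x', d := y') = f(i := x', d := y')" for x y x' y'
      using assms(2) by (auto simp: fun_eq_iff)
    have ov: "f i + c + 1 < 2 ^ W" "f d + c + 1 < 2 ^ W" using lt assms by linarith+
    show "wp W w (Seq (WStore b (WVar d) (WArr a (WVar i))) (Seq (incr i) (incr d)))
      (\<lambda>t s'. I s' \<and> t + 1 + btime (WLess (WVar i) (WVar e)) + 16 * (wvar s' e - wvar s' i)
         \<le> 16 * (wvar s e - wvar s i)) s"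
      unfolding c(2) st_def using ov I' val lt assms
      by (simp add: wp_Seq wp_WStore wp_incr tw del: fun_upd_apply) (simp add: wp_incr tw)
  qed
  then show ?thesis
  proof (rule wp_conseq)
    fix t s'
    assume "I s' \<and> \<not> bval W w s' (WLess (WVar i) (WVar e)) \<and>
      t + 16 * (wvar s' e - wvar s' i) \<le> 16 * (wvar (mkst f g h q) e - wvar (mkst f g h q) i)
        + 1 + btime (WLess (WVar i) (WVar e))"
    then obtain c where c: "c \<le> f e - f i" "s' = st c" "\<not> f i + c < f e"
      "t \<le> 16 * (f e - f i) + 4"
      using assms unfolding I_def by (auto simp: st_def)
    then have "c = f e - f i" by simp
    with c assms show "t \<le> 16 * (f e - f i) + 4 \<and>
      s' = mkst (f(i := f e, d := f d + (f e - f i))) (g(b := paste (g a) (f i) (f e - f i) (g b) (f d))) h q"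
      by (simp add: st_def)
  qed
qed

section \<open>Array segments as lists\<close>

definition slice :: "(nat \<Rightarrow> 'b) \<Rightarrow> nat \<Rightarrow> nat \<Rightarrow> 'b list" where
  "slice f a b = map f [a..<b]"

lemma length_slice [simp]: "length (slice f a b) = b - a"
  by (simp add: slice_def)

lemma nth_slice [simp]: "i < b - a \<Longrightarrow> slice f a b ! i = f (a + i)"
  by (simp add: slice_def)

lemma slice_append: "a \<le> b \<Longrightarrow> b \<le> c \<Longrightarrow> slice f a b @ slice f b c = slice f a c"
  unfolding slice_def by (metis le_add_diff_inverse map_append upt_add_eq_append)

lemma drop_slice: "drop i (slice f a b) = slice f (a + i) b"
  by (simp add: slice_def drop_map)

lemma slice_cong: "(\<And>i. a \<le> i \<Longrightarrow> i < b \<Longrightarrow> f i = g i) \<Longrightarrow> slice f a b = slice g a b"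
  by (simp add: slice_def)

lemma slice_empty [simp]: "b \<le> a \<Longrightarrow> slice f a b = []"
  by (simp add: slice_def)

lemma slice_Suc: "a \<le> b \<Longrightarrow> slice f a (Suc b) = slice f a b @ [f b]"
  by (simp add: slice_def)

lemma set_slice_mono: "a' \<le> a \<Longrightarrow> b \<le> b' \<Longrightarrow> set (slice f a b) \<subseteq> set (slice f a' b')"
  by (auto simp: slice_def)

lemma slice_paste:
  "slice (paste src i len dst d) d (d + len) = slice src i (i + len)"
  by (rule nth_equalityI) (simp_all add: paste_def)

lemma slice_paste_append:
  assumes "o0 \<le> d"
  shows "slice (paste src i len dst d) o0 (d + len) = slice dst o0 d @ slice src i (i + len)"
proof -
  have "slice (paste src i len dst d) o0 d = slice dst o0 d"
    by (rule slice_cong) (simp add: paste_def)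
  then show ?thesis
    using slice_append[of o0 d "d + len" "paste src i len dst d"] assms by (simp add: slice_paste)
qed


section \<open>Compressing a matched run\<close>

lemma sub_mod_word: "b \<le> a \<Longrightarrow> a < (M::nat) \<Longrightarrow> (a + (M - b)) mod M = a - b"
  by (metis Nat.add_diff_assoc add.commute le_trans less_imp_le mod_add_self2 mod_less
      less_imp_diff_less)

lemma sub_mod_word': "b \<le> a \<Longrightarrow> a < (M::nat) \<Longrightarrow> (a + M - b) mod M = a - b"
  using sub_mod_word[of b a M] by simp

definition letters_eq :: "wexp \<Rightarrow> wexp \<Rightarrow> bexp" where
  "letters_eq d e = BAnd (BNot (WLess d e)) (BNot (WLess e d))"

lemma bval_letters_eq [simp]: "bval W w s (letters_eq d e) \<longleftrightarrow> wval W s d = wval W s e"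
  by (auto simp: letters_eq_def)

lemma btime_letters_eq [simp]: "btime (letters_eq d e) = 5 + 2 * wtime d + 2 * wtime e"
  by (simp add: letters_eq_def)

text \<open>Word variables: 0, 1 lengths of the input strings; 2 \<open>k\<close>; 3 position of the greedy search;
  4, 5 input cursors and 6, 7 output cursors; 8 number of search steps; 9 \<open>5 k + 5\<close>; 10 \<open>2 k\<close>;
  11 \<open>4 k\<close>; 13 \<open>8 k\<^sup>2\<close>; 14 diagonal; 16 scan position; 17 end of the match; 18 end of the run;
  19, 25 start and end of the current factor; 20 start of the output of the run; 21 number of
  factors; 22 period; 24 start of the retained part of the factor; 26 end of the search window;
  28, 29 ends of blocks to be copied; 30, 31, 32 row, column and end of the band in the dynamic
  program. Word arrays: 0, 1 input strings; 2, 3 output strings; 4 start positions of the retained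
  factors in the output. Real variables: 0 result; 1 \<open>k + 1\<close>; 2 \<open>k\<close>; 3, 4 the left and the diagonal
  neighbour of a cell; 5 its new value. Real array 0: current row, capped at \<open>k + 1\<close>.\<close>

definition periodic_cond :: bexp where
  "periodic_cond = BAnd (WLess (WVar 16) (WVar 18))
     (letters_eq (WArr 0 (WVar 16)) (WArr 0 (WOp Sub (WVar 16) (WVar 22))))"

text \<open>Candidates from 1 to \<open>2 k\<close> are tried until the first \<open>4 k\<close>
  letters of the factor respect one of them, or the last candidate is reached. A rejected candidate
  costs \<open>O(k)\<close>; the accepted one is followed to its first violation, in time linear in
  the letters passed.\<close>

definition find_period :: com where
  "find_period = Seq (WAssign 22 (WConst 1)) (Seq (WAssign 16 (WOp Add (WVar 19) (WConst 1)))
     (Seq (While periodic_cond (incr 16))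
       (While (BAnd (WLess (WVar 16) (WOp Add (WVar 19) (WVar 11))) (WLess (WVar 22) (WVar 10)))
         (Seq (incr 22) (Seq (WAssign 16 (WOp Add (WVar 19) (WVar 22)))
           (While periodic_cond (incr 16)))))))"

text \<open>\<open>w\<close> satisfies the axioms everywhere, while the program queries the oracle
  \<open>v\<close>, which is related to \<open>w\<close> only on the letters of the input (see
  \<open>agrees\<close>). The bound on \<open>2 ^ W\<close> leaves room for sums of positions and
  for \<open>8 * (k * k)\<close>, so that arithmetic does not wrap around.\<close>

locale kernel = weights w k for w :: "nat weight" and k +
  fixes W n :: nat and v :: "nat weight"
  assumes k_pos: "0 < k" and word: "20 * (n + k + k * k + 1) < 2 ^ W"
begin

lemma k_le_square: "k \<le> k * k" using k_pos by simp

lemma word_bounds: "20 * n + 20 * k + 20 * (k * k) + 20 < 2 ^ W"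
  using word by (simp add: distrib_left)

lemma W_pos [simp]: "0 < W"
  using word_bounds by (cases W) auto

text \<open>\<open>i\<close> is where the scan for the period \<open>p\<close> from \<open>z\<close>
  stops: at the first violation, or at the end \<open>en\<close> of the run.\<close>

definition breaks :: "(nat \<Rightarrow> nat) \<Rightarrow> nat \<Rightarrow> nat \<Rightarrow> nat \<Rightarrow> nat \<Rightarrow> bool" where
  "breaks A z en p i \<longleftrightarrow> z + p \<le> i \<and> i \<le> en \<and> (\<forall>l. z + p \<le> l \<and> l < i \<longrightarrow> A l = A (l - p)) \<and>
     (i < en \<longrightarrow> A i \<noteq> A (i - p))"

lemma wp_periodic_scan:
  assumes "f 18 \<le> n" "z + f 22 \<le> f 18"
  shows "wp W v (While periodic_cond (incr 16)) (\<lambda>t s'. \<exists>i. breaks (g 0) z (f 18) (f 22) i \<and>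
      s' = mkst (f(16 := i)) g h q \<and> t \<le> 26 * (i - z) + 22) (mkst (f(16 := z + f 22)) g h q)"
proof -
  have W: "f 18 < 2 ^ W" using assms word_bounds by linarith
  have c: "bval W v (mkst (f(16 := l)) g h q) periodic_cond \<longleftrightarrow> l < f 18 \<and> g 0 l = g 0 (l - f 22)"
    if "z + f 22 \<le> l" "l \<le> f 18" for l
    using that W by (auto simp: periodic_cond_def sub_mod_word sub_mod_word')
  have bt: "btime periodic_cond = 21" by (simp add: periodic_cond_def)
  show ?thesis
  proof (rule wp_conseq[OF wp_scan[where M = "f 18"]])
    show "z + f 22 \<le> f 18" "f 18 < 2 ^ W" by fact+
    show "\<not> bval W v (mkst (f(16 := f 18)) g h q) periodic_cond" using c[of "f 18"] assms by simp
    fix t s' assume "\<exists>i\<ge>z + f 22. i \<le> f 18 \<and> s' = mkst (f(16 := i)) g h q \<and>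
      \<not> bval W v (mkst (f(16 := i)) g h q) periodic_cond \<and>
      (\<forall>l. z + f 22 \<le> l \<and> l < i \<longrightarrow> bval W v (mkst (f(16 := l)) g h q) periodic_cond) \<and>
      t \<le> (i - (z + f 22)) * (btime periodic_cond + 5) + btime periodic_cond + 1"
    then obtain i where i: "z + f 22 \<le> i" "i \<le> f 18" "s' = mkst (f(16 := i)) g h q"
      "\<not> bval W v (mkst (f(16 := i)) g h q) periodic_cond"
      "\<And>l. z + f 22 \<le> l \<Longrightarrow> l < i \<Longrightarrow> bval W v (mkst (f(16 := l)) g h q) periodic_cond"
      "t \<le> (i - (z + f 22)) * 26 + 22"
      unfolding bt by auto
    have "breaks (g 0) z (f 18) (f 22) i" unfolding breaks_def
      using i(1,2,4,5) c[of i] c by fastforce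
    moreover have "t \<le> 26 * (i - z) + 22" using i(6) by simp
    ultimately show "\<exists>i. breaks (g 0) z (f 18) (f 22) i \<and> s' = mkst (f(16 := i)) g h q \<and>
      t \<le> 26 * (i - z) + 22" using i(3) by blast
  qed
qed

lemma wp_find_period:
  assumes "f 18 \<le> n" "f 10 = 2 * k" "f 11 = 4 * k" "f 19 + 4 * k \<le> f 18"
  shows "wp W v find_period (\<lambda>t s'. \<exists>p i. s' = mkst (f(22 := p, 16 := i)) g h q \<and>
      0 < p \<and> p \<le> 2 * k \<and> breaks (g 0) (f 19) (f 18) p i \<and>
      (i < f 19 + 4 * k \<longrightarrow> (\<forall>p'. 0 < p' \<and> p' \<le> 2 * k \<longrightarrow>
         (\<exists>i' < f 19 + 4 * k. breaks (g 0) (f 19) (f 18) p' i'))) \<and>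
      t \<le> 500 * (k * k) + 26 * (i - f 19) + 50) (mkst f g h q)"
proof -
  let ?z = "f 19" and ?en = "f 18" and ?br = "breaks (g 0) (f 19) (f 18)"
  have W: "?en < 2 ^ W" "?z + 1 < 2 ^ W" "?z + 4 * k < 2 ^ W" using assms word_bounds by linarith+
  define I where "I s \<longleftrightarrow> (\<exists>p i. s = mkst (f(22 := p, 16 := i)) g h q \<and> 0 < p \<and> p \<le> 2 * k \<and> ?br p i \<and>
     (\<forall>p'. 0 < p' \<and> p' < p \<longrightarrow> (\<exists>i' < ?z + 4 * k. ?br p' i')))" for s
  \<comment> \<open>A candidate that fails within \<open>4 * k\<close> letters costs at most
    \<open>26 * (4 * k)\<close> plus a constant, below \<open>150 * k\<close>. The second summand
    pays for the one long scan and is kept in full until that scan occurs.\<close>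
  define \<mu> where "\<mu> s = (2 * k - wvar s 22) * (150 * k)
     + 26 * (if wvar s 16 < ?z + 4 * k then ?en - ?z else ?en - wvar s 16)" for s :: state
  let ?b = "BAnd (WLess (WVar 16) (WOp Add (WVar 19) (WVar 11))) (WLess (WVar 22) (WVar 10))"
  let ?body = "Seq (incr 22) (Seq (WAssign 16 (WOp Add (WVar 19) (WVar 22))) (While periodic_cond (incr 16)))"
  have loop: "wp W v (While ?b ?body)
     (\<lambda>t s'. I s' \<and> \<not> bval W v s' ?b \<and> t + \<mu> s' \<le> \<mu> s + 1 + btime ?b) s" if "I s" for s
  proof (rule wp_While)
    fix s assume "I s" and b: "bval W v s ?b"
    then obtain p i where I: "s = mkst (f(22 := p, 16 := i)) g h q" "0 < p" "p \<le> 2 * k" "?br p i"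
     "\<forall>p'. 0 < p' \<and> p' < p \<longrightarrow> (\<exists>i' < ?z + 4 * k. ?br p' i')" unfolding I_def by blast
    have lt: "i < ?z + 4 * k" "p < 2 * k" using b assms W unfolding I(1) by auto
    have ov: "p + 1 < 2 ^ W" "?z + (p + 1) < 2 ^ W" "?z + (p + 1) \<le> ?en" using lt assms W by linarith+
    define f' where "f' = f(22 := p + 1)"
    have f': "f' 18 \<le> n" "?z + f' 22 \<le> f' 18" using assms(1) ov by (simp_all add: f'_def)
    have st: "f(22 := p, 16 := i, 22 := p + 1, 16 := ?z + (p + 1)) = f'(16 := ?z + f' 22)"
      by (auto simp: f'_def fun_eq_iff)
    show "wp W v ?body (\<lambda>t s'. I s' \<and> t + 1 + btime ?b + \<mu> s' \<le> \<mu> s) s"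
      unfolding I(1) wp_Seq
    proof (rule wp_incrI[OF _ refl])
      show "wvar (mkst (f(22 := p, 16 := i)) g h q) 22 + 1 < 2 ^ W" using ov by simp
      have *: "wp W v (While periodic_cond (incr 16)) (\<lambda>t s'. I s' \<and> 4 + (4 + t) + 1 + btime ?b + \<mu> s' \<le> \<mu> s)
          (mkst (f'(16 := ?z + f' 22)) g h q)"
      proof (rule wp_conseq[OF wp_periodic_scan[OF f']])
        fix t s' assume "\<exists>i. breaks (g 0) ?z (f' 18) (f' 22) i \<and> s' = mkst (f'(16 := i)) g h q \<and>
            t \<le> 26 * (i - ?z) + 22"
        then obtain i' where i': "?br (p + 1) i'" "s' = mkst (f'(16 := i')) g h q"
          "t \<le> 26 * (i' - ?z) + 22" by (auto simp: f'_def)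
        have "\<exists>i' < ?z + 4 * k. ?br p' i'" if "0 < p'" "p' < p + 1" for p'
          using I(4,5) lt(1) that by (cases "p' = p") auto
        then have "I s'" unfolding I_def
          using lt i' by - (rule exI[of _ "p + 1"], rule exI[of _ i'], simp add: f'_def)
        moreover have "4 + (4 + t) + 1 + btime ?b + \<mu> s' \<le> \<mu> s"
        proof -
          have ie: "?z \<le> i'" "i' \<le> ?en" using i'(1) by (auto simp: breaks_def)
          obtain e where e: "2 * k = p + 1 + e" using lt(2) by (auto simp: less_iff_Suc_add)
          have "(2 * k - p) * (150 * k) = (2 * k - (p + 1)) * (150 * k) + 150 * k"
            unfolding e by (simp add: add_mult_distrib)
          moreover have "\<mu> s = (2 * k - p) * (150 * k) + 26 * (?en - ?z)"
            using lt(1) unfolding \<mu>_def I(1) by simp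
          moreover have "\<mu> s' = (2 * k - (p + 1)) * (150 * k)
              + 26 * (if i' < ?z + 4 * k then ?en - ?z else ?en - i')"
            unfolding \<mu>_def i'(2) by (simp add: f'_def)
          moreover have "btime ?b = 9" by simp
          moreover have "18 + t \<le> 150 * k" if "i' < ?z + 4 * k"
            using that i'(3) ie k_pos by linarith
          moreover have "18 + t + 26 * (?en - i') \<le> 150 * k + 26 * (?en - ?z)"
            using i'(3) ie k_pos by linarith
          ultimately show ?thesis by (auto split: if_splits)
        qed
        ultimately show "I s' \<and> 4 + (4 + t) + 1 + btime ?b + \<mu> s' \<le> \<mu> s" ..
      qed
      show "wp W v (WAssign 16 (WOp Add (WVar 19) (WVar 22)))
        (\<lambda>t'. wp W v (While periodic_cond (incr 16))
           (\<lambda>t'a s'. I s' \<and> 4 + (t' + t'a) + 1 + btime ?b + \<mu> s' \<le> \<mu> (mkst (f(22 := p, 16 := i)) g h q)))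
        ((mkst (f(22 := p, 16 := i)) g h q)
          \<lparr>wvar := (wvar (mkst (f(22 := p, 16 := i)) g h q))
            (22 := wvar (mkst (f(22 := p, 16 := i)) g h q) 22 + 1)\<rparr>)"
        using * ov unfolding I(1) st[symmetric] by (simp add: wp_WAssign)
    qed
  qed (rule that)
  define f1 where "f1 = f(22 := 1)"
  have f1: "f1 18 \<le> n" "?z + f1 22 \<le> f1 18" using assms k_pos by (simp_all add: f1_def)
  have st1: "f(22 := 1, 16 := ?z + 1) = f1(16 := ?z + f1 22)" by (auto simp: f1_def fun_eq_iff)
  have first: "wp W v (While periodic_cond (incr 16)) (\<lambda>t s'. wp W v (While ?b ?body) (\<lambda>t' s'.
      \<exists>p i. s' = mkst (f(22 := p, 16 := i)) g h q \<and>
      0 < p \<and> p \<le> 2 * k \<and> breaks (g 0) (f 19) (f 18) p i \<and>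
      (i < f 19 + 4 * k \<longrightarrow> (\<forall>p'. 0 < p' \<and> p' \<le> 2 * k \<longrightarrow>
         (\<exists>i' < f 19 + 4 * k. breaks (g 0) (f 19) (f 18) p' i'))) \<and>
      6 + (t + t') \<le> 500 * (k * k) + 26 * (i - f 19) + 50) s') (mkst (f1(16 := ?z + f1 22)) g h q)"
  proof (rule wp_conseq[OF wp_periodic_scan[OF f1]])
    fix t s' assume "\<exists>i. breaks (g 0) ?z (f1 18) (f1 22) i \<and> s' = mkst (f1(16 := i)) g h q \<and>
       t \<le> 26 * (i - ?z) + 22"
    then obtain i where i: "?br 1 i" "s' = mkst (f1(16 := i)) g h q" "t \<le> 26 * (i - ?z) + 22"
      by (auto simp: f1_def)
    have ie: "?z \<le> i" "i \<le> ?en" using i(1) by (auto simp: breaks_def)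
    have "I s'" unfolding I_def
      using i k_pos by - (rule exI[of _ 1], rule exI[of _ i], simp add: f1_def)
    have mu: "t + \<mu> s' \<le> 22 + 104 * k + 300 * (k * k) + 26 * (?en - ?z)"
    proof -
      have "(2 * k - 1) * (150 * k) \<le> 2 * k * (150 * k)" by (rule mult_le_mono1) simp
      then have "(2 * k - 1) * (150 * k) \<le> 300 * (k * k)" by (simp add: mult.assoc mult.left_commute)
      moreover have "\<mu> s' = (2 * k - 1) * (150 * k) + 26 * (if i < ?z + 4 * k then ?en - ?z else ?en - i)"
        unfolding \<mu>_def i(2) by (simp add: f1_def)
      moreover have "t \<le> 22 + 104 * k" if "i < ?z + 4 * k" using that i(3) ie by linarith
      moreover have "t + 26 * (?en - i) \<le> 22 + 26 * (?en - ?z)" using i(3) ie by linarith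
      ultimately show ?thesis
        by (cases "i < ?z + 4 * k"; simp only: if_True if_False simp_thms; linarith)
    qed
    show "wp W v (While ?b ?body) (\<lambda>t' s'. \<exists>p i. s' = mkst (f(22 := p, 16 := i)) g h q \<and>
      0 < p \<and> p \<le> 2 * k \<and> breaks (g 0) (f 19) (f 18) p i \<and>
      (i < f 19 + 4 * k \<longrightarrow> (\<forall>p'. 0 < p' \<and> p' \<le> 2 * k \<longrightarrow>
         (\<exists>i' < f 19 + 4 * k. breaks (g 0) (f 19) (f 18) p' i'))) \<and>
      6 + (t + t') \<le> 500 * (k * k) + 26 * (i - f 19) + 50) s'"
    proof (rule wp_conseq[OF loop[OF \<open>I s'\<close>]])
      fix t' s'' assume a: "I s'' \<and> \<not> bval W v s'' ?b \<and> t' + \<mu> s'' \<le> \<mu> s' + 1 + btime ?b"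
      then obtain p i where I: "s'' = mkst (f(22 := p, 16 := i)) g h q" "0 < p" "p \<le> 2 * k" "?br p i"
        "\<forall>p'. 0 < p' \<and> p' < p \<longrightarrow> (\<exists>i' < ?z + 4 * k. ?br p' i')" unfolding I_def by blast
      have nb: "i < ?z + 4 * k \<Longrightarrow> p = 2 * k" using a assms W I(3) unfolding I(1) by auto
      have all: "\<exists>i' < ?z + 4 * k. ?br p' i'" if "i < ?z + 4 * k" "0 < p'" "p' \<le> 2 * k" for p'
        using nb[OF that(1)] I(4,5) that by (cases "p' = p") auto
      have ie: "?z \<le> i" "i \<le> ?en" using I(4) by (auto simp: breaks_def)
      have "t' + \<mu> s'' \<le> \<mu> s' + 10" using a by simp
      moreover have "26 * (?en - i) \<le> 26 * (?en - ?z)" using ie by simp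
      then have "26 * (?en - i) \<le> \<mu> s''" unfolding \<mu>_def I(1)
        by (simp add: trans_le_add2 del: mult_le_cancel1 mult_le_cancel2)
      ultimately have "6 + (t + t') + 26 * (?en - i) \<le> 38 + 104 * k + 300 * (k * k) + 26 * (?en - ?z)"
        using mu by linarith
      then have "6 + (t + t') \<le> 500 * (k * k) + 26 * (i - f 19) + 50"
        using ie k_le_square by linarith
      then show "\<exists>p i. s'' = mkst (f(22 := p, 16 := i)) g h q \<and>
        0 < p \<and> p \<le> 2 * k \<and> breaks (g 0) (f 19) (f 18) p i \<and>
        (i < f 19 + 4 * k \<longrightarrow> (\<forall>p'. 0 < p' \<and> p' \<le> 2 * k \<longrightarrow>
          (\<exists>i' < f 19 + 4 * k. breaks (g 0) (f 19) (f 18) p' i'))) \<and>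
        6 + (t + t') \<le> 500 * (k * k) + 26 * (i - f 19) + 50" using I all by blast
    qed
  qed
  show ?thesis unfolding find_period_def
    using first W unfolding st1[symmetric] by (simp add: wp_Seq wp_WAssign add.assoc)
qed

end


section \<open>Cutting one factor off a run\<close>

text \<open>If the period breaks within \<open>8 * (k * k)\<close> letters, that many letters form
  an aperiodic factor and nothing is removed. Otherwise whole periods are skipped in front until
  fewer than \<open>8 * (k * k) + p\<close> letters remain before the break. The letter at the
  break, if the run continues, is included because it makes the factor aperiodic.\<close>

definition locate_cut :: com where
  "locate_cut = Seq find_period (Cond (WLess (WVar 16) (WOp Add (WVar 19) (WVar 13)))
     (WAssign 25 (WOp Add (WVar 19) (WVar 13)))
     (Seq (WAssign 24 (WOp Add (WVar 19) (WOp Mul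
         (WOp Div (WOp Sub (WVar 16) (WOp Add (WVar 19) (WVar 13))) (WVar 22)) (WVar 22))))
       (Cond (WLess (WVar 16) (WVar 18)) (WAssign 25 (WOp Add (WVar 16) (WConst 1))) Skip)))"

definition select_cut :: com where
  "select_cut = Seq (WAssign 24 (WVar 19)) (Seq (WAssign 25 (WVar 18))
     (Cond (WLess (WOp Add (WVar 19) (WVar 13)) (WVar 18)) locate_cut Skip))"

definition emit_factor :: com where
  "emit_factor = Seq (WStore 4 (WVar 21) (WVar 6)) (Seq (incr 21) (Seq select_cut
     (Seq (copy 0 2 24 25 6) (WAssign 19 (WVar 25)))))"

context kernel
begin

text \<open>The factor from \<open>z\<close> to \<open>e\<close> is replaced by its suffix from
  \<open>r\<close>. Only a factor that ends together with the run may fail to be aperiodic.\<close>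

definition cut :: "(nat \<Rightarrow> nat) \<Rightarrow> nat \<Rightarrow> nat \<Rightarrow> nat \<Rightarrow> nat \<Rightarrow> bool" where
  "cut A en z r e \<longleftrightarrow> z \<le> r \<and> r < e \<and> e \<le> en \<and> e - r \<le> 8 * (k * k) + 2 * k \<and>
     interch (slice A z e) (slice A r e) \<and>
     (e < en \<longrightarrow> aperiodic (2 * k) (slice A r e))"

lemma aperiodic_window:
  assumes "\<forall>q. 0 < q \<and> q \<le> 2 * k \<longrightarrow> (\<exists>i < hi. breaks A z en q i)" "hi \<le> e" "hi \<le> en"
  shows "aperiodic (2 * k) (slice A z e)"
  unfolding aperiodic_def
proof (intro allI impI notI)
  fix q assume q: "0 < q \<and> q \<le> 2 * k" and per: "period q (slice A z e)"
  then obtain i where i: "i < hi" "breaks A z en q i" using assms(1) by blast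
  then have "z + q \<le> i" "A i \<noteq> A (i - q)" using assms(3) by (auto simp: breaks_def)
  moreover have "slice A z e ! (i - q - z) = slice A z e ! (i - q - z + q)"
    by (rule per[unfolded period_def, rule_format]) (use i(1) assms(2) \<open>z + q \<le> i\<close> in simp)
  moreover have "slice A z e ! (i - q - z) = A (i - q)" "slice A z e ! (i - q - z + q) = A i"
    using i(1) assms(2) \<open>z + q \<le> i\<close> by simp_all
  ultimately show False by simp
qed

lemma period_breaks:
  assumes "breaks A z en p i" "z \<le> z'"
  shows "period p (slice A z' i)"
  unfolding period_def
proof (intro allI impI)
  fix j assume j: "j + p < length (slice A z' i)"
  then have "z + p \<le> z' + j + p" "z' + j + p < i" using assms(2) by simp_all
  then have "A (z' + j + p) = A (z' + j + p - p)" using assms(1) unfolding breaks_def by blast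
  then show "slice A z' i ! j = slice A z' i ! (j + p)" using j by (simp add: add.assoc)
qed

lemma aperiodic_breaks:
  assumes "breaks A z en p i" "0 < p" "p \<le> 2 * k" "i < en" "z \<le> z'" "z' + 4 * k \<le> i"
  shows "aperiodic (2 * k) (slice A z' (Suc i))"
proof -
  have "aperiodic (2 * k) (slice A z' i @ [A i])"
  proof (rule aperiodic_break[OF period_breaks[OF assms(1,5)] assms(2,3)])
    show "2 * (2 * k) \<le> length (slice A z' i)" using assms(6) by simp
    have "slice A z' i ! (length (slice A z' i) - p) = A (i - p)"
      using assms(2,3,6) k_pos by simp
    then show "A i \<noteq> slice A z' i ! (length (slice A z' i) - p)"
      using assms(1,4) by (simp add: breaks_def)
  qed
  then show ?thesis using assms(6) by (simp add: slice_Suc)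
qed

lemma cut_short: "z < en \<Longrightarrow> en \<le> z + 8 * (k * k) \<Longrightarrow> cut A en z z en"
  by (simp add: cut_def interch_refl)

text \<open>There are two reasons for being aperiodic: every candidate is violated within the first
  \<open>4 * k\<close> letters, or the accepted period holds for \<open>4 * k\<close> letters and
  then breaks, which excludes all other short periods as well.\<close>

lemma cut_aperiodic:
  assumes br: "breaks A z en p i" "0 < p" "p \<le> 2 * k" and "z + 8 * (k * k) < en" "i < z + 8 * (k * k)"
    and no: "i < z + 4 * k \<longrightarrow> (\<forall>q. 0 < q \<and> q \<le> 2 * k \<longrightarrow> (\<exists>i < z + 4 * k. breaks A z en q i))"
  shows "cut A en z z (z + 8 * (k * k))"
proof -
  have k4: "4 * k \<le> 8 * (k * k)" using k_le_square by linarith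
  have "aperiodic (2 * k) (slice A z (z + 8 * (k * k)))"
  proof (cases "i < z + 4 * k")
    case True
    then show ?thesis
      using aperiodic_window[of "z + 4 * k" A z en "z + 8 * (k * k)"] no k4 assms(4) by simp
  next
    case False
    then have "aperiodic (2 * k) (slice A z (Suc i))"
      using aperiodic_breaks[OF br, of z] assms(4,5) by simp
    moreover have "slice A z (z + 8 * (k * k)) = [] @ slice A z (Suc i) @ slice A (Suc i) (z + 8 * (k * k))"
      using assms(5) False by (simp add: slice_append)
    ultimately show ?thesis by (metis aperiodic_factor)
  qed
  then show ?thesis using assms(4) k_pos by (simp add: cut_def interch_refl)
qed

lemma cut_periodic:
  assumes br: "breaks A z en p i" "0 < p" "p \<le> 2 * k" and "z + 8 * (k * k) \<le> i" "i \<le> en"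
    and r: "r = z + (i - (z + 8 * (k * k))) div p * p" and e: "e = (if i < en then i + 1 else en)"
  shows "cut A en z r e"
proof -
  let ?j = "(i - (z + 8 * (k * k))) div p"
  have j: "?j * p \<le> i - (z + 8 * (k * k))" "i - (z + 8 * (k * k)) < ?j * p + p"
    using assms(2) by (simp_all add: div_times_less_eq_dividend)
      (metis add.commute dividend_less_div_times)
  \<comment> \<open>\<open>interch_period\<close> wants \<open>(k + 1) * p + 4 * k\<close> letters
    to remain. For \<open>p\<close> \<le> \<open>2 * k\<close> this is at most
    \<open>2 * (k * k) + 6 * k\<close>, hence at most \<open>8 * (k * k)\<close>: the origin of that
    constant.\<close>
  have "(k + 1) * p \<le> (k + 1) * (2 * k)" using assms(3) by (rule mult_le_mono2)
  also have "\<dots> = 2 * (k * k) + 2 * k" by (simp add: algebra_simps)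
  finally have "(k + 1) * p + 4 * k + ?j * p \<le> length (slice A z i)"
    unfolding length_slice using j(1) k_le_square assms(4) by linarith
  from interch_period[OF period_breaks[OF br(1) order_refl] this]
  have ic: "interch (slice A z i) (slice A r i)" unfolding drop_slice r by simp
  have r': "z \<le> r" "r + 8 * (k * k) \<le> i" "i - r < 8 * (k * k) + p" using j assms(4) r by linarith+
  have ri: "r < i" using r'(2) k_pos by (metis add_gr_0 le_add1 le_neq_implies_less le_trans less_add_same_cancel1 mult_pos_pos not_le zero_less_numeral)
  show ?thesis
  proof (cases "i < en")
    case True
    then have e': "e = Suc i" using e by simp
    have "4 * k \<le> 8 * (k * k)" using k_le_square by linarith
    then have "aperiodic (2 * k) (slice A r e)"
      unfolding e' using r'(2) by (intro aperiodic_breaks[OF br True r'(1)]) linarith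
    moreover have "interch (slice A z e) (slice A r e)"
      using interch_append[OF ic interch_refl[of "[A i]"]] r' ri unfolding e' by (simp add: slice_Suc)
    ultimately show ?thesis using r' ri True assms(3) unfolding e' cut_def by simp
  next
    case False
    then have "e = i" "i = en" using e assms(5) by auto
    then show ?thesis using ic r' ri assms(3) unfolding cut_def by simp
  qed
qed

text \<open>The quadratic cost of \<open>find_period\<close> arises only if more than
  \<open>8 * (k * k)\<close> letters are left, and then at least that many are consumed; so the time
  is linear in the letters consumed.\<close>

lemma wp_select_cut:
  assumes f: "f 18 \<le> n" "f 10 = 2 * k" "f 11 = 4 * k" "f 13 = 8 * (k * k)" "f 19 < f 18"
  shows "wp W v select_cut (\<lambda>t s'. \<exists>f'. s' = mkst f' g h q \<and>
      cut (g 0) (f 18) (f 19) (f' 24) (f' 25) \<and> (\<forall>x. x \<notin> {16, 22, 24, 25} \<longrightarrow> f' x = f x) \<and>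
      t \<le> 300 * (f' 25 - f 19)) (mkst f g h q)"
proof -
  let ?z = "f 19" and ?en = "f 18" and ?S = "8 * (k * k)"
  define f1 where "f1 = f(24 := ?z, 25 := ?en)"
  have W: "?z + ?S < 2 ^ W" "?en + 1 < 2 ^ W" using f word_bounds by linarith+
  show ?thesis
  proof (cases "?z + ?S < ?en")
    case False
    then have "cut (g 0) ?en ?z ?z ?en" using f by (intro cut_short) auto
    then show ?thesis unfolding select_cut_def using False f W
      by (intro iffD2[OF wp_Seq] iffD2[OF wp_WAssign]) (auto simp: wp_simps intro!: exI[of _ f1] simp: f1_def)
  next
    case True
    have "?z + 4 * k \<le> ?en" using True k_le_square by linarith
    then have f1: "f1 18 \<le> n" "f1 10 = 2 * k" "f1 11 = 4 * k" "f1 19 + 4 * k \<le> f1 18"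
      using f unfolding f1_def by simp_all
    have main: "wp W v locate_cut (\<lambda>t s'. \<exists>f'. s' = mkst f' g h q \<and>
      cut (g 0) (f 18) (f 19) (f' 24) (f' 25) \<and> (\<forall>x. x \<notin> {16, 22, 24, 25} \<longrightarrow> f' x = f x) \<and>
      t + 20 \<le> 300 * (f' 25 - f 19)) (mkst f1 g h q)"
      unfolding locate_cut_def wp_Seq[of _ _ find_period]
    proof (rule wp_conseq[OF wp_find_period[OF f1]])
      fix t s'
      assume "\<exists>p i. s' = mkst (f1(22 := p, 16 := i)) g h q \<and>
        0 < p \<and> p \<le> 2 * k \<and> breaks (g 0) (f1 19) (f1 18) p i \<and>
        (i < f1 19 + 4 * k \<longrightarrow> (\<forall>p'. 0 < p' \<and> p' \<le> 2 * k \<longrightarrow>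
          (\<exists>i' < f1 19 + 4 * k. breaks (g 0) (f1 19) (f1 18) p' i'))) \<and>
        t \<le> 500 * (k * k) + 26 * (i - f1 19) + 50"
      then obtain p i where s': "s' = mkst (f1(22 := p, 16 := i)) g h q" and p: "0 < p" "p \<le> 2 * k"
        and br: "breaks (g 0) ?z ?en p i" and no: "i < ?z + 4 * k \<longrightarrow> (\<forall>p'. 0 < p' \<and> p' \<le> 2 * k \<longrightarrow>
          (\<exists>i' < ?z + 4 * k. breaks (g 0) ?z ?en p' i'))"
        and t: "t \<le> 500 * (k * k) + 26 * (i - ?z) + 50" by (auto simp: f1_def)
      have ie: "?z \<le> i" "i \<le> ?en" using br by (auto simp: breaks_def)
      have kk: "1 \<le> k * k" using k_pos k_le_square by linarith
      show "wp W v (Cond (WLess (WVar 16) (WOp Add (WVar 19) (WVar 13)))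
         (WAssign 25 (WOp Add (WVar 19) (WVar 13)))
         (Seq (WAssign 24 (WOp Add (WVar 19) (WOp Mul
             (WOp Div (WOp Sub (WVar 16) (WOp Add (WVar 19) (WVar 13))) (WVar 22)) (WVar 22))))
           (Cond (WLess (WVar 16) (WVar 18)) (WAssign 25 (WOp Add (WVar 16) (WConst 1))) Skip))) (\<lambda>t' s'. \<exists>f'. s' = mkst f' g h q \<and>
         cut (g 0) (f 18) (f 19) (f' 24) (f' 25) \<and> (\<forall>x. x \<notin> {16, 22, 24, 25} \<longrightarrow> f' x = f x) \<and>
         t + t' + 20 \<le> 300 * (f' 25 - f 19)) s'"
      proof (cases "i < ?z + ?S")
        case less: True
        have c: "cut (g 0) ?en ?z ?z (?z + ?S)" by (rule cut_aperiodic[OF br p True less no])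
        have "t + 40 \<le> 300 * ?S" using t less kk by linarith
        then show ?thesis unfolding s' using c less W f
          by (auto simp: wp_simps f1_def intro!: exI[of _ "f(24 := ?z, 25 := ?z + ?S, 22 := p, 16 := i)"])
      next
        case ge: False
        define j where "j = (i - (?z + ?S)) div p * p"
        define e where "e = (if i < ?en then i + 1 else ?en)"
        have c: "cut (g 0) ?en ?z (?z + j) e"
          by (rule cut_periodic[OF br p _ ie(2) _ e_def]) (use ge in \<open>simp_all add: j_def\<close>)
        have j: "j \<le> i - (?z + ?S)" unfolding j_def by (simp add: div_times_less_eq_dividend)
        have W': "i < 2 ^ W" "j < 2 ^ W" "?z + j < 2 ^ W" "i + 1 < 2 ^ W" using j ie W ge by linarith+
        have "?S \<le> i - ?z" using ge by linarith
        then have "t + 100 \<le> 300 * (i - ?z)" using t kk by linarith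
        moreover have "i - ?z \<le> e - ?z" unfolding e_def using ie by auto
        ultimately have "t + 100 \<le> 300 * (e - ?z)" by linarith
        then show ?thesis unfolding s' using c ge W W' f
          by (auto simp: wp_simps f1_def sub_mod_word sub_mod_word' j_def[symmetric] e_def
              intro!: exI[of _ "f(24 := ?z + j, 25 := e, 22 := p, 16 := i)"])
      qed
    qed
    show ?thesis unfolding select_cut_def using True f(1-4) W
      by (simp add: wp_Seq wp_WAssign wp_Cond flip: f1_def) (rule wp_conseq[OF main], auto)
  qed
qed

end


section \<open>Compressing and emitting a whole run\<close>

text \<open>The last factor need not be aperiodic, so \<open>k + 2\<close> factors are kept at the
  end and \<open>k + 1\<close> at the front. The end block is moved down over the middle with the
  help of the recorded start positions.\<close>

definition drop_middle :: com where
  "drop_middle = Cond (WLess (WOp Add (WVar 10) (WConst 3)) (WVar 21))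
     (Seq (WAssign 16 (WArr 4 (WOp Sub (WVar 21) (WOp Add (WVar 2) (WConst 2)))))
     (Seq (WAssign 28 (WVar 6)) (Seq (WAssign 6 (WArr 4 (WOp Add (WVar 2) (WConst 1))))
       (copy 2 2 16 28 6)))) Skip"

text \<open>The run is the same in both strings, so it is compressed once, in array 2, and the
  result is copied to array 3.\<close>

definition emit_run :: com where
  "emit_run = Seq (WAssign 19 (WVar 3)) (Seq (WAssign 20 (WVar 6)) (Seq (WAssign 21 (WConst 0))
     (Seq (While (WLess (WVar 19) (WVar 18)) emit_factor)
     (Seq drop_middle (copy 2 3 20 6 7)))))"

lemma take_slice: "a + i \<le> b \<Longrightarrow> take i (slice f a b) = slice f a (a + i)"
  by (simp add: slice_def take_map)

lemma length_concat_take_mono: "i \<le> j \<Longrightarrow> length (concat (take i gs)) \<le> length (concat (take j gs))"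
proof -
  assume "i \<le> j"
  then have "take j gs = take i gs @ take (j - i) (drop i gs)"
    by (metis le_add_diff_inverse take_add)
  then show ?thesis by simp
qed

lemma length_concat_le: "(\<And>g. g \<in> set gs \<Longrightarrow> length g \<le> L) \<Longrightarrow> length (concat gs) \<le> length gs * L"
  by (induction gs) (simp_all add: add_mono)

context kernel
begin

lemma wp_emit_factor:
  assumes f: "f 18 \<le> n" "f 10 = 2 * k" "f 11 = 4 * k" "f 13 = 8 * (k * k)" "f 19 < f 18"
    "f 6 + (f 18 - f 19) \<le> n" "f 21 \<le> n"
  shows "wp W v emit_factor (\<lambda>t s'. \<exists>f' r e.
      s' = mkst f' (g(4 := (g 4)(f 21 := f 6), 2 := paste (g 0) r (e - r) (g 2) (f 6))) h q \<and>
      cut (g 0) (f 18) (f 19) r e \<and> f' 19 = e \<and> f' 21 = f 21 + 1 \<and> f' 6 = f 6 + (e - r) \<and>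
      (\<forall>x. x \<notin> {6, 16, 19, 21, 22, 24, 25} \<longrightarrow> f' x = f x) \<and> t \<le> 400 * (e - f 19)) (mkst f g h q)"
proof -
  define f1 where "f1 = f(21 := f 21 + 1)"
  define g1 where "g1 = g(4 := (g 4)(f 21 := f 6))"
  have f1: "f1 18 \<le> n" "f1 10 = 2 * k" "f1 11 = 4 * k" "f1 13 = 8 * (k * k)" "f1 19 < f1 18"
    using f by (simp_all add: f1_def)
  have W: "f 21 + 1 < 2 ^ W" using f word_bounds by linarith
  define Q where "Q t s' \<longleftrightarrow> (\<exists>f' r e.
      s' = mkst f' (g(4 := (g 4)(f 21 := f 6), 2 := paste (g 0) r (e - r) (g 2) (f 6))) h q \<and>
      cut (g 0) (f 18) (f 19) r e \<and> f' 19 = e \<and> f' 21 = f 21 + 1 \<and> f' 6 = f 6 + (e - r) \<and>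
      (\<forall>x. x \<notin> {6, 16, 19, 21, 22, 24, 25} \<longrightarrow> f' x = f x) \<and> t \<le> 400 * (e - f 19))" for t s'
  have fin: "wp W v (copy 0 2 24 25 6)
      (\<lambda>t' s'. Q (9 + (t + t')) (s'\<lparr>wvar := (wvar s')(19 := wvar s' 25)\<rparr>)) s'"
    if a: "\<exists>f'. s' = mkst f' g1 h q \<and> cut (g1 0) (f1 18) (f1 19) (f' 24) (f' 25) \<and>
        (\<forall>x. x \<notin> {16, 22, 24, 25} \<longrightarrow> f' x = f1 x) \<and> t \<le> 300 * (f' 25 - f1 19)" for t s'
  proof -
    obtain f2 where f2: "s' = mkst f2 g1 h q" "cut (g 0) (f 18) (f 19) (f2 24) (f2 25)"
      "\<And>x. x \<notin> {16, 22, 24, 25} \<Longrightarrow> f2 x = f1 x" "t \<le> 300 * (f2 25 - f 19)"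
      using a by (auto simp: g1_def f1_def)
    have re: "f 19 \<le> f2 24" "f2 24 < f2 25" "f2 25 \<le> f 18" using f2(2) by (auto simp: cut_def)
    have f26: "f2 6 = f 6" "f2 21 = f 21 + 1" using f2(3)[of 6] f2(3)[of 21] by (simp_all add: f1_def)
    have ov: "f2 25 < 2 ^ W" "f2 6 + (f2 25 - f2 24) < 2 ^ W"
      unfolding f26 using re f word_bounds by linarith+
    have "wp W v (copy 0 2 24 25 6) (\<lambda>t' s'. t' \<le> 16 * (f2 25 - f2 24) + 4 \<and>
        s' = mkst (f2(24 := f2 25, 6 := f2 6 + (f2 25 - f2 24)))
          (g1(2 := paste (g1 0) (f2 24) (f2 25 - f2 24) (g1 2) (f2 6))) h q) (mkst f2 g1 h q)"
      by (rule wp_copy) (use re ov in simp_all)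
    then show ?thesis unfolding f2(1)
    proof (rule wp_conseq)
      fix t' s''
      assume a: "t' \<le> 16 * (f2 25 - f2 24) + 4 \<and>
        s'' = mkst (f2(24 := f2 25, 6 := f2 6 + (f2 25 - f2 24)))
          (g1(2 := paste (g1 0) (f2 24) (f2 25 - f2 24) (g1 2) (f2 6))) h q"
      define f3 where "f3 = f2(24 := f2 25, 6 := f2 6 + (f2 25 - f2 24), 19 := f2 25)"
      have "9 + (t + t') \<le> 400 * (f2 25 - f 19)" using a f2(4) re by linarith
      moreover have "f3 19 = f2 25" "f3 21 = f 21 + 1" "f3 6 = f 6 + (f2 25 - f2 24)"
        using f26 by (simp_all add: f3_def)
      moreover have "\<forall>x. x \<notin> {6, 16, 19, 21, 22, 24, 25} \<longrightarrow> f3 x = f x"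
        using f2(3) by (simp add: f3_def f1_def)
      moreover have "s''\<lparr>wvar := (wvar s'')(19 := wvar s'' 25)\<rparr> = mkst f3
          (g(4 := (g 4)(f 21 := f 6), 2 := paste (g 0) (f2 24) (f2 25 - f2 24) (g 2) (f 6))) h q"
        using a f26 by (simp add: f3_def g1_def)
      ultimately show "Q (9 + (t + t')) (s''\<lparr>wvar := (wvar s'')(19 := wvar s'' 25)\<rparr>)"
        unfolding Q_def using f2(2) by blast
    qed
  qed
  have "wp W v emit_factor Q (mkst f g h q)"
    unfolding emit_factor_def using W
    by (simp add: wp_Seq wp_WStore wp_WAssign wp_incr flip: f1_def g1_def)
      (rule wp_conseq[OF wp_select_cut[OF f1]], drule fin, simp add: ac_simps)
  then show ?thesis unfolding Q_def .
qed

text \<open>\<open>O'\<close> records where each retained factor starts, for use in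
  \<open>drop_middle\<close>. The inclusion of letters ensures that the oracle is queried within the
  alphabet only, and the bounds by \<open>z - x\<close> keep the cursors in range.\<close>

definition factored :: "(nat \<Rightarrow> nat) \<Rightarrow> nat \<Rightarrow> nat \<Rightarrow> (nat \<Rightarrow> nat) \<Rightarrow> (nat \<Rightarrow> nat) \<Rightarrow> nat \<Rightarrow> nat list list \<Rightarrow> bool" where
  "factored A x z G O' o0 gs \<longleftrightarrow> length gs \<le> z - x \<and> length (concat gs) \<le> z - x \<and>
     slice G o0 (o0 + length (concat gs)) = concat gs \<and>
     (\<forall>i < length gs. O' i = o0 + length (concat (take i gs))) \<and>
     interch (slice A x z) (concat gs) \<and> (\<forall>p \<in> set gs. length p \<le> 8 * (k * k) + 2 * k) \<and>
     (\<forall>p \<in> set (butlast gs). aperiodic (2 * k) p) \<and> set (concat gs) \<subseteq> set (slice A x z)"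

text \<open>All earlier factors have to be aperiodic because the new one takes over the role of the
  exceptional last factor.\<close>

lemma factored_snoc:
  assumes "factored A x z G O' o0 gs" "\<forall>p \<in> set gs. aperiodic (2 * k) p" "cut A en z r e" "x \<le> z"
  shows "factored A x e (paste A r (e - r) G (o0 + length (concat gs)))
     (O'(length gs := o0 + length (concat gs))) o0 (gs @ [slice A r e])"
proof -
  have re: "z \<le> r" "r < e" "e \<le> en" "e - r \<le> 8 * (k * k) + 2 * k"
    "interch (slice A z e) (slice A r e)" using assms(3) by (auto simp: cut_def)
  have "interch (slice A x z @ slice A z e) (concat gs @ slice A r e)"
    using interch_append re(5) assms(1) by (simp add: factored_def)
  moreover have "slice A x z @ slice A z e = slice A x e" using assms(4) re by (simp add: slice_append)
  moreover have "slice (paste A r (e - r) G (o0 + length (concat gs))) o0 (o0 + length (concat gs) + (e - r))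
      = concat gs @ slice A r e"
    using slice_paste_append[of o0 "o0 + length (concat gs)" A r "e - r" G] assms(1) re
    by (simp add: factored_def)
  moreover have "set (slice A r e) \<subseteq> set (slice A x e)" "set (slice A x z) \<subseteq> set (slice A x e)"
    using assms(4) re by (simp_all add: set_slice_mono)
  then have "set (concat (gs @ [slice A r e])) \<subseteq> set (slice A x e)"
    using assms(1) by (auto simp: factored_def)
  ultimately show ?thesis using assms re
    by (auto simp: factored_def less_Suc_eq nth_append add.assoc)
qed

lemma wp_factors:
  assumes f: "f 18 \<le> n" "f 10 = 2 * k" "f 11 = 4 * k" "f 13 = 8 * (k * k)" "f 19 \<le> f 18"
    "f 6 + (f 18 - f 19) \<le> n" "f 21 = 0"
  shows "wp W v (While (WLess (WVar 19) (WVar 18)) emit_factor) (\<lambda>t s'. \<exists>f' G O' gs.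
      s' = mkst f' (g(2 := G, 4 := O')) h q \<and> factored (g 0) (f 19) (f 18) G O' (f 6) gs \<and>
      f' 21 = length gs \<and> f' 6 = f 6 + length (concat gs) \<and> (\<forall>r < f 6. G r = g 2 r) \<and>
      (\<forall>x. x \<notin> {6, 16, 19, 21, 22, 24, 25} \<longrightarrow> f' x = f x) \<and> t \<le> 500 * (f 18 - f 19) + 4) (mkst f g h q)"
proof -
  \<comment> \<open>While letters of the run are left, all factors so far are aperiodic, since
    \<open>cut\<close> permits an exception only at the end of the run.\<close>
  define I where "I s \<longleftrightarrow> (\<exists>f' G O' gs. s = mkst f' (g(2 := G, 4 := O')) h q \<and>
     f 19 \<le> f' 19 \<and> f' 19 \<le> f 18 \<and> factored (g 0) (f 19) (f' 19) G O' (f 6) gs \<and>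
     (f' 19 < f 18 \<longrightarrow> (\<forall>p \<in> set gs. aperiodic (2 * k) p)) \<and>
     f' 21 = length gs \<and> f' 6 = f 6 + length (concat gs) \<and> (\<forall>r < f 6. G r = g 2 r) \<and>
      (\<forall>x. x \<notin> {6, 16, 19, 21, 22, 24, 25} \<longrightarrow> f' x = f x))" for s
  let ?\<mu> = "\<lambda>s. 500 * (f 18 - wvar s 19)"
  let ?b = "WLess (WVar 19) (WVar 18)"
  have "wp W v (While ?b emit_factor) (\<lambda>t s'. I s' \<and> \<not> bval W v s' ?b \<and>
      t + ?\<mu> s' \<le> ?\<mu> (mkst f g h q) + 1 + btime ?b) (mkst f g h q)"
  proof (rule wp_While)
    have "factored (g 0) (f 19) (f 19) (g 2) (g 4) (f 6) []"
      by (simp add: factored_def interch_refl)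
    then show "I (mkst f g h q)" unfolding I_def using f(5,7)
      by (intro exI[of _ f] exI[of _ "g 2"] exI[of _ "g 4"] exI[of _ "[]"]) simp
  next
    fix s assume "I s" and b: "bval W v s ?b"
    then obtain f' G O' gs where I: "s = mkst f' (g(2 := G, 4 := O')) h q"
     "f 19 \<le> f' 19" "f' 19 \<le> f 18" "factored (g 0) (f 19) (f' 19) G O' (f 6) gs"
     "f' 19 < f 18 \<longrightarrow> (\<forall>p \<in> set gs. aperiodic (2 * k) p)"
     "f' 21 = length gs" "f' 6 = f 6 + length (concat gs)" "\<forall>r < f 6. G r = g 2 r"
      and fr: "\<And>x. x \<notin> {6, 16, 19, 21, 22, 24, 25} \<Longrightarrow> f' x = f x" unfolding I_def by blast
    have f'c: "f' 18 = f 18" "f' 10 = f 10" "f' 11 = f 11" "f' 13 = f 13" using fr by simp_all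
    have lt: "f' 19 < f 18" using b f'c unfolding I(1) by simp
    have len: "length gs \<le> f' 19 - f 19" "length (concat gs) \<le> f' 19 - f 19"
      using I(4) by (simp_all add: factored_def)
    have pre: "f' 18 \<le> n" "f' 10 = 2 * k" "f' 11 = 4 * k" "f' 13 = 8 * (k * k)" "f' 19 < f' 18"
      "f' 6 + (f' 18 - f' 19) \<le> n" "f' 21 \<le> n"
      unfolding f'c I(6,7) using f lt I(2) len by linarith+
    show "wp W v emit_factor (\<lambda>t s'. I s' \<and> t + 1 + btime ?b + ?\<mu> s' \<le> ?\<mu> s) s"
      unfolding I(1)
    proof (rule wp_conseq[OF wp_emit_factor[OF pre]])
      fix t s'
      assume "\<exists>f'' r e. s' = mkst f'' ((g(2 := G, 4 := O'))(4 := ((g(2 := G, 4 := O')) 4)(f' 21 := f' 6),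
          2 := paste ((g(2 := G, 4 := O')) 0) r (e - r) ((g(2 := G, 4 := O')) 2) (f' 6))) h q \<and>
        cut ((g(2 := G, 4 := O')) 0) (f' 18) (f' 19) r e \<and> f'' 19 = e \<and> f'' 21 = f' 21 + 1 \<and>
        f'' 6 = f' 6 + (e - r) \<and>
        (\<forall>x. x \<notin> {6, 16, 19, 21, 22, 24, 25} \<longrightarrow> f'' x = f' x) \<and> t \<le> 400 * (e - f' 19)"
      then obtain f'' r e where s': "s' = mkst f'' ((g(2 := G, 4 := O'))(4 := ((g(2 := G, 4 := O')) 4)(f' 21 := f' 6),
          2 := paste ((g(2 := G, 4 := O')) 0) r (e - r) ((g(2 := G, 4 := O')) 2) (f' 6))) h q"
        and c': "cut ((g(2 := G, 4 := O')) 0) (f' 18) (f' 19) r e" and f'': "f'' 19 = e" "f'' 21 = f' 21 + 1"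
          "f'' 6 = f' 6 + (e - r)" "\<And>x. x \<notin> {6, 16, 19, 21, 22, 24, 25} \<Longrightarrow> f'' x = f' x"
        and t: "t \<le> 400 * (e - f' 19)" by blast
      have c: "cut (g 0) (f 18) (f' 19) r e" using c' f'c by simp
      have st: "s' = mkst f'' (g(2 := paste (g 0) r (e - r) G (f' 6), 4 := O'(f' 21 := f' 6))) h q"
        unfolding s' by (simp add: fun_eq_iff)
      have re: "f' 19 \<le> r" "r < e" "e \<le> f 18" "e < f 18 \<longrightarrow> aperiodic (2 * k) (slice (g 0) r e)"
        using c by (auto simp: cut_def)
      have fac: "factored (g 0) (f 19) e (paste (g 0) r (e - r) G (f' 6)) (O'(f' 21 := f' 6)) (f 6)
         (gs @ [slice (g 0) r e])"
        using factored_snoc[OF I(4) _ c I(2)] I(5) lt unfolding I(6,7) by simp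
      have ap: "e < f 18 \<longrightarrow> (\<forall>p \<in> set (gs @ [slice (g 0) r e]). aperiodic (2 * k) p)"
        using re(4) I(5) lt by auto
      have len': "f'' 21 = length (gs @ [slice (g 0) r e])"
        "f'' 6 = f 6 + length (concat (gs @ [slice (g 0) r e]))" using f''(2,3) I(6,7) by simp_all
      have old: "\<forall>i < f 6. paste (g 0) r (e - r) G (f' 6) i = g 2 i" using I(7,8) by (simp add: paste_def)
      have frame: "\<forall>x. x \<notin> {6, 16, 19, 21, 22, 24, 25} \<longrightarrow> f'' x = f x" using f''(4) fr by metis
      have "f 19 \<le> f'' 19" "f'' 19 \<le> f 18" using f''(1) re I(2) by simp_all
      then have "I s'" unfolding I_def
        using st fac ap len' old frame unfolding f''(1)[symmetric] by blast
      moreover have "t + 4 + 500 * (f 18 - e) \<le> 500 * (f 18 - f' 19)" using t re by linarith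
      ultimately show "I s' \<and> t + 1 + btime ?b + ?\<mu> s' \<le> ?\<mu> (mkst f' (g(2 := G, 4 := O')) h q)"
        unfolding st using f''(1) by simp
    qed
  qed
  then show ?thesis
  proof (rule wp_conseq)
    fix t s' assume a: "I s' \<and> \<not> bval W v s' ?b \<and> t + ?\<mu> s' \<le> ?\<mu> (mkst f g h q) + 1 + btime ?b"
    then obtain f' G O' gs where I: "s' = mkst f' (g(2 := G, 4 := O')) h q"
     "f' 19 \<le> f 18" "factored (g 0) (f 19) (f' 19) G O' (f 6) gs"
     "f' 21 = length gs" "f' 6 = f 6 + length (concat gs)" "\<forall>r < f 6. G r = g 2 r"
     and fr: "\<And>x. x \<notin> {6, 16, 19, 21, 22, 24, 25} \<Longrightarrow> f' x = f x" unfolding I_def by blast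
    have "f' 19 = f 18" using a I(2) fr[of 18] unfolding I(1) by simp
    moreover have "t \<le> 500 * (f 18 - f 19) + 4" using a by simp
    ultimately show "\<exists>f' G O' gs.
      s' = mkst f' (g(2 := G, 4 := O')) h q \<and> factored (g 0) (f 19) (f 18) G O' (f 6) gs \<and>
      f' 21 = length gs \<and> f' 6 = f 6 + length (concat gs) \<and> (\<forall>r < f 6. G r = g 2 r) \<and>
      (\<forall>x. x \<notin> {6, 16, 19, 21, 22, 24, 25} \<longrightarrow> f' x = f x) \<and> t \<le> 500 * (f 18 - f 19) + 4"
      using I fr by (intro exI[of _ f'] exI[of _ G] exI[of _ O'] exI[of _ gs]) simp
  qed
qed

text \<open>The synchronising blocks are the first and the last \<open>k + 1\<close> factors of
  \<open>butlast gs\<close>; the exceptional last factor is treated as right context.\<close>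

lemma interch_drop_middle:
  assumes "\<forall>p \<in> set (butlast gs). aperiodic (2 * k) p" "2 * k + 3 < length gs"
  shows "interch (concat gs) (concat (take (k + 1) gs) @ concat (drop (length gs - (k + 2)) gs))"
proof -
  let ?m = "length gs"
  define bs where "bs = butlast gs"
  have gs: "gs = bs @ [last gs]" using assms(2) unfolding bs_def by (cases gs rule: rev_cases) auto
  have lb: "length bs = ?m - 1" by (simp add: bs_def)
  define M where "M = take (?m - (k + 2) - (k + 1)) (drop (k + 1) bs)"
  define Hs where "Hs = drop (?m - (k + 2)) bs"
  have "drop (?m - (k + 2) - (k + 1)) (drop (k + 1) bs) = Hs"
  proof -
    have "?m - (k + 2) - (k + 1) + (k + 1) = ?m - (k + 2)" using assms(2) by linarith
    then show ?thesis unfolding Hs_def drop_drop by simp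
  qed
  then have bs: "bs = take (k + 1) bs @ M @ Hs" unfolding M_def by (metis append_take_drop_id)
  have "interch (concat (take (k + 1) bs) @ concat M @ concat Hs) (concat (take (k + 1) bs) @ concat Hs)"
  proof (rule interch_synchronised)
    show "k < length (take (k + 1) bs)" "k < length Hs" using assms(2) lb unfolding Hs_def by simp_all
    show "aperiodic (2 * k) G" if "G \<in> set (take (k + 1) bs)" for G
      using that assms(1) in_set_takeD unfolding bs_def by metis
    show "aperiodic (2 * k) G" if "G \<in> set Hs" for G
      using that assms(1) in_set_dropD unfolding bs_def Hs_def by metis
  qed
  from interch_context[OF this, of "[]" "last gs"]
  have "interch (concat (take (k + 1) bs @ M @ Hs) @ last gs) (concat (take (k + 1) bs) @ concat Hs @ last gs)"
    by simp
  then have "interch (concat (bs @ [last gs])) (concat (take (k + 1) bs) @ concat Hs @ last gs)"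
    unfolding bs[symmetric] by simp
  moreover have "take (k + 1) gs = take (k + 1) bs" "drop (?m - (k + 2)) gs = Hs @ [last gs]"
  proof -
    have 0: "k + 1 - length bs = 0" "?m - (k + 2) - length bs = 0" using assms(2) lb by linarith+
    show "take (k + 1) gs = take (k + 1) bs"
      using arg_cong[OF gs, of "take (k + 1)"] unfolding take_append 0 by simp
    show "drop (?m - (k + 2)) gs = Hs @ [last gs]"
      using arg_cong[OF gs, of "drop (?m - (k + 2))"] unfolding drop_append 0 Hs_def by simp
  qed
  ultimately show ?thesis unfolding gs[symmetric] by simp
qed

lemma wp_drop_middle:
  assumes f: "f 2 = k" "f 10 = 2 * k" "f 21 = length gs" "f 6 = o0 + length (concat gs)" "f 6 \<le> n"
    and gs: "factored A x z (g 2) (g 4) o0 gs" and "z \<le> n"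
  shows "wp W v drop_middle (\<lambda>t s'. \<exists>f' G R. s' = mkst f' (g(2 := G)) h q \<and> f' 6 = o0 + length R \<and>
      slice G o0 (o0 + length R) = R \<and> (\<forall>r < o0. G r = g 2 r) \<and> interch (concat gs) R \<and>
      set R \<subseteq> set (concat gs) \<and>
      length R \<le> (2 * k + 3) * (8 * (k * k) + 2 * k) \<and> length R \<le> length (concat gs) \<and>
      (\<forall>x. x \<notin> {6, 16, 28} \<longrightarrow> f' x = f x) \<and> t \<le> 16 * length (concat gs) + 60) (mkst f g h q)"
proof -
  let ?m = "length gs" and ?L = "8 * (k * k) + 2 * k"
  have "?m \<le> z - x" using gs by (simp add: factored_def)
  then have m: "?m \<le> n" using \<open>z \<le> n\<close> by linarith
  have W: "k + 2 < 2 ^ W" "k + 1 < 2 ^ W" "2 * k + 3 < 2 ^ W" "2 < (2 :: nat) ^ W" "3 < (2 :: nat) ^ W"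
    "?m < 2 ^ W" "f 6 < 2 ^ W" using word_bounds f m by linarith+
  have L: "\<And>p. p \<in> set gs \<Longrightarrow> length p \<le> ?L" and sl: "slice (g 2) o0 (f 6) = concat gs"
    and off: "\<And>i. i < ?m \<Longrightarrow> g 4 i = o0 + length (concat (take i gs))"
    using gs f(4) by (auto simp: factored_def)
  show ?thesis
  proof (cases "2 * k + 3 < ?m")
    case False
    have "length (concat gs) \<le> ?m * ?L" using L by (rule length_concat_le)
    also have "\<dots> \<le> (2 * k + 3) * ?L" using False by (intro mult_le_mono1) simp
    finally show ?thesis using False f W sl interch_refl[of "concat gs"] unfolding drop_middle_def
      by (auto simp: wp_Cond wp_Skip intro!: exI[of _ f] exI[of _ "g 2"] exI[of _ "concat gs"])
  next
    case True
    define a where "a = ?m - (k + 2)"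
    have a: "k + 1 \<le> a" "a < ?m" "?m - a = k + 2" using True by (auto simp: a_def)
    define src where "src = o0 + length (concat (take a gs))"
    define dst where "dst = o0 + length (concat (take (k + 1) gs))"
    have g4: "g 4 a = src" "g 4 (k + 1) = dst" using off a unfolding src_def dst_def by auto
    \<comment> \<open>\<open>dst\<close> \<le> \<open>src\<close> is what \<open>wp_copy\<close>
      asks for when a block is moved within one array.\<close>
    have le: "dst \<le> src" "src \<le> f 6" unfolding src_def dst_def f(4)
      using length_concat_take_mono[OF a(1), of gs] length_concat_take_mono[of a ?m gs] a by auto
    have s1: "slice (g 2) src (f 6) = concat (drop a gs)"
    proof -
      have "concat gs = concat (take a gs) @ concat (drop a gs)"
        by (metis append_take_drop_id concat_append)
      then have "drop (length (concat (take a gs))) (concat gs) = concat (drop a gs)" by simp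
      then show ?thesis unfolding sl[symmetric] drop_slice src_def .
    qed
    have s2: "slice (g 2) o0 dst = concat (take (k + 1) gs)"
    proof -
      have "concat gs = concat (take (k + 1) gs) @ concat (drop (k + 1) gs)"
        by (metis append_take_drop_id concat_append)
      then have "take (length (concat (take (k + 1) gs))) (concat gs) = concat (take (k + 1) gs)" by simp
      moreover have "length (concat (take (k + 1) gs)) \<le> length (concat gs)"
        using length_concat_take_mono[of "k + 1" ?m gs] a by simp
      then have "take (length (concat (take (k + 1) gs))) (slice (g 2) o0 (f 6)) = slice (g 2) o0 dst"
        unfolding dst_def f(4) by (intro take_slice) simp
      ultimately show ?thesis unfolding sl by simp
    qed
    define R where "R = concat (take (k + 1) gs) @ concat (drop a gs)"
    define f1 where "f1 = f(16 := src, 28 := f 6, 6 := dst)"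
    define G where "G = paste (g 2) src (f 6 - src) (g 2) dst"
    have lR: "dst + (f 6 - src) = o0 + length R"
      unfolding R_def length_append s1[symmetric] using dst_def by simp
    have "slice G o0 (dst + (f 6 - src)) = R"
      unfolding G_def using slice_paste_append[of o0 dst "g 2" src "f 6 - src" "g 2"] s1 s2 le
      by (simp add: dst_def R_def)
    then have G: "slice G o0 (o0 + length R) = R" unfolding lR .
    have iR: "interch (concat gs) R" unfolding R_def a_def
      using interch_drop_middle[OF _ True] gs by (simp add: factored_def)
    have "length R \<le> length (take (k + 1) gs) * ?L + length (drop a gs) * ?L"
      unfolding R_def length_append
      by (intro add_mono length_concat_le) (auto intro!: L dest: in_set_takeD in_set_dropD)
    also have "length (take (k + 1) gs) = k + 1" using a by simp
    also have "length (drop a gs) = k + 2" using a by simp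
    also have "(k + 1) * ?L + (k + 2) * ?L = (k + 1 + (k + 2)) * ?L" by (rule add_mult_distrib[symmetric])
    also have "k + 1 + (k + 2) = 2 * k + 3" by simp
    finally have bound: "length R \<le> (2 * k + 3) * ?L" .
    have sub: "set R \<subseteq> set (concat gs)"
      unfolding R_def by (auto dest: in_set_takeD in_set_dropD)
    have shrink: "length R \<le> length (concat gs)" using lR le f(4) by linarith
    have cp: "wp W v (copy 2 2 16 28 6) (\<lambda>t s'. t \<le> 16 * (f1 28 - f1 16) + 4 \<and>
      s' = mkst (f1(16 := f1 28, 6 := f1 6 + (f1 28 - f1 16)))
        (g(2 := paste (g 2) (f1 16) (f1 28 - f1 16) (g 2) (f1 6))) h q) (mkst f1 g h q)"
      by (rule wp_copy) (use le W in \<open>simp_all add: f1_def\<close>)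
    have "?m < 2 ^ W" "k + 2 \<le> ?m" using W a by simp_all
    note diff = sub_mod_word[OF this(2,1)] sub_mod_word'[OF this(2,1)]
    show ?thesis unfolding drop_middle_def
      using True f(1-3) W(1-6) g4 unfolding a_def
      apply (simp add: wp_Seq wp_WAssign wp_Cond diff del: add_2_eq_Suc add_2_eq_Suc' flip: f1_def)
      apply (rule wp_conseq[OF cp])
      using G iR sub bound shrink lR le
      by (auto simp: f1_def G_def paste_def dst_def intro!: exI[of _ "f1(16 := f1 28, 6 := f1 6 + (f1 28 - f1 16))"]
         exI[of _ G] exI[of _ R])
  qed
qed

end


section \<open>Searching a diagonal with a long run\<close>

definition agree_cond :: bexp where
  "agree_cond = BAnd (WLess (WVar 17) (WVar 0))
     (BAnd (WLess (WOp Sub (WOp Add (WVar 17) (WVar 14)) (WVar 2)) (WVar 1))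
       (letters_eq (WArr 0 (WVar 17)) (WArr 1 (WOp Sub (WOp Add (WVar 17) (WVar 14)) (WVar 2)))))"

text \<open>Each diagonal is scanned from \<open>4 k\<close> positions before the search position,
  and the first one whose run leaves the window is kept with its full length. Failing diagonals cost
  \<open>O(k)\<close> each, hence \<open>O(k^2)\<close> per search; the successful scan is charged
  to the progress of the search.\<close>

definition find_run :: com where
  "find_run = Seq (WAssign 26 (WOp Add (WVar 3) (WVar 10))) (Seq (WAssign 14 (WConst 0))
     (Seq (WAssign 17 (WOp Sub (WVar 3) (WVar 11))) (Seq (While agree_cond (incr 17))
     (While (BAnd (BNot (WLess (WVar 26) (WVar 17))) (WLess (WVar 14) (WVar 10)))
       (Seq (incr 14) (Seq (WAssign 17 (WOp Sub (WVar 3) (WVar 11)))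
         (While agree_cond (incr 17))))))))"

context kernel
begin

lemma wp_emit_run:
  assumes f: "f 18 \<le> n" "f 2 = k" "f 10 = 2 * k" "f 11 = 4 * k" "f 13 = 8 * (k * k)" "f 3 \<le> f 18"
    "f 6 + (f 18 - f 3) \<le> n" "f 7 + (f 18 - f 3) \<le> n"
  shows "wp W v emit_run (\<lambda>t s'. \<exists>f' G H O' R. s' = mkst f' (g(2 := G, 3 := H, 4 := O')) h q \<and>
      f' 6 = f 6 + length R \<and> f' 7 = f 7 + length R \<and>
      slice G 0 (f 6 + length R) = slice (g 2) 0 (f 6) @ R \<and>
      slice H 0 (f 7 + length R) = slice (g 3) 0 (f 7) @ R \<and>
      interch (slice (g 0) (f 3) (f 18)) R \<and> set R \<subseteq> set (slice (g 0) (f 3) (f 18)) \<and>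
      length R \<le> (2 * k + 3) * (8 * (k * k) + 2 * k) \<and> length R \<le> f 18 - f 3 \<and>
      (\<forall>x. x \<notin> {6, 7, 16, 19, 20, 21, 22, 24, 25, 28} \<longrightarrow> f' x = f x) \<and>
      t \<le> 600 * (f 18 - f 3) + 100) (mkst f g h q)"
proof -
  let ?L = "8 * (k * k) + 2 * k" and ?d = "f 18 - f 3"
  define Q where "Q t s' \<longleftrightarrow> (\<exists>f' G H O' R. s' = mkst f' (g(2 := G, 3 := H, 4 := O')) h q \<and>
      f' 6 = f 6 + length R \<and> f' 7 = f 7 + length R \<and>
      slice G 0 (f 6 + length R) = slice (g 2) 0 (f 6) @ R \<and>
      slice H 0 (f 7 + length R) = slice (g 3) 0 (f 7) @ R \<and>
      interch (slice (g 0) (f 3) (f 18)) R \<and> set R \<subseteq> set (slice (g 0) (f 3) (f 18)) \<and>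
      length R \<le> (2 * k + 3) * ?L \<and> length R \<le> ?d \<and>
      (\<forall>x. x \<notin> {6, 7, 16, 19, 20, 21, 22, 24, 25, 28} \<longrightarrow> f' x = f x) \<and> t \<le> 600 * ?d + 100)" for t s'
  define f1 where "f1 = f(19 := f 3, 20 := f 6, 21 := 0)"
  have f1: "f1 18 \<le> n" "f1 10 = 2 * k" "f1 11 = 4 * k" "f1 13 = 8 * (k * k)" "f1 19 \<le> f1 18"
    "f1 6 + (f1 18 - f1 19) \<le> n" "f1 21 = 0" using f by (simp_all add: f1_def)
  have last: "wp W v (copy 2 3 20 6 7) (\<lambda>t'' s'. Q (6 + t + t' + t'') s') s2"
    if s1: "s1 = mkst f2 (g(2 := G, 4 := O')) h q" and fac: "factored (g 0) (f 3) (f 18) G O' (f 6) gs"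
      and fr: "\<forall>x. x \<notin> {6, 16, 19, 21, 22, 24, 25} \<longrightarrow> f2 x = f1 x"
      and old: "\<forall>r < f 6. G r = g 2 r" and t: "t \<le> 500 * ?d + 4"
      and a: "s2 = mkst f3 ((g(2 := G, 4 := O'))(2 := G')) h q" "f3 6 = f 6 + length R"
       "slice G' (f 6) (f 6 + length R) = R" "\<forall>r < f 6. G' r = G r" "interch (concat gs) R"
       "set R \<subseteq> set (concat gs)" "length R \<le> (2 * k + 3) * ?L" "length R \<le> length (concat gs)"
       "\<forall>x. x \<notin> {6, 16, 28} \<longrightarrow> f3 x = f2 x" "t' \<le> 16 * length (concat gs) + 60"
    for t t' s1 s2 f2 f3 G G' O' gs R
  proof -
    have cl: "length (concat gs) \<le> ?d" and ic: "interch (slice (g 0) (f 3) (f 18)) (concat gs)"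
      using fac by (auto simp: factored_def)
    have f3: "f3 20 = f 6" "f3 7 = f 7" using a(9) fr by (simp_all add: f1_def)
    have R: "length R \<le> ?d" using cl a(8) by linarith
    define g3 where "g3 = (g(2 := G, 4 := O'))(2 := G')"
    define f4 where "f4 = f3(20 := f3 6, 7 := f3 7 + (f3 6 - f3 20))"
    define H where "H = paste G' (f 6) (length R) (g 3) (f 7)"
    have W: "f 6 + length R < 2 ^ W" "f 7 + length R < 2 ^ W" using R f word_bounds by linarith+
    have "wp W v (copy 2 3 20 6 7) (\<lambda>t s'. t \<le> 16 * (f3 6 - f3 20) + 4 \<and>
      s' = mkst f4 (g3(3 := paste (g3 2) (f3 20) (f3 6 - f3 20) (g3 3) (f3 7))) h q) (mkst f3 g3 h q)"
      unfolding f4_def by (rule wp_copy) (use W in \<open>simp_all add: a f3\<close>)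
    then show ?thesis unfolding a(1) g3_def[symmetric]
    proof (rule wp_conseq)
      fix t'' s'
      assume b: "t'' \<le> 16 * (f3 6 - f3 20) + 4 \<and>
        s' = mkst f4 (g3(3 := paste (g3 2) (f3 20) (f3 6 - f3 20) (g3 3) (f3 7))) h q"
      have "s' = mkst f4 (g(2 := G', 3 := H, 4 := O')) h q"
        using b by (simp add: g3_def H_def f3 a(2) fun_eq_iff)
      moreover have "f4 6 = f 6 + length R" "f4 7 = f 7 + length R" by (simp_all add: f4_def a(2) f3)
      moreover have "slice G' 0 (f 6 + length R) = slice (g 2) 0 (f 6) @ R"
      proof -
        have "slice G' 0 (f 6) = slice (g 2) 0 (f 6)" by (rule slice_cong) (use old a(4) in simp)
        then show ?thesis using slice_append[of 0 "f 6" "f 6 + length R" G'] a(3) by simp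
      qed
      moreover have "slice H 0 (f 7 + length R) = slice (g 3) 0 (f 7) @ R"
        unfolding H_def by (simp add: slice_paste_append a(3))
      moreover have "set R \<subseteq> set (slice (g 0) (f 3) (f 18))"
        using fac a(6) by (auto simp: factored_def)
      moreover have "interch (slice (g 0) (f 3) (f 18)) R" using ic a(5) by (rule interch_trans)
      moreover have "\<forall>x. x \<notin> {6, 7, 16, 19, 20, 21, 22, 24, 25, 28} \<longrightarrow> f4 x = f x"
        using a(9) fr by (simp add: f4_def f1_def)
      moreover have "6 + t + t' + t'' \<le> 600 * ?d + 100"
      proof -
        have "t'' \<le> 16 * ?d + 4" using b R by (simp add: a(2) f3)
        then show ?thesis using t a(10) cl by linarith
      qed
      ultimately show "Q (6 + t + t' + t'') s'" unfolding Q_def using a(7) R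
        by (intro exI[of _ f4] exI[of _ G'] exI[of _ H] exI[of _ O'] exI[of _ R]) simp
    qed
  qed
  have mid: "wp W v drop_middle (\<lambda>t' s'. wp W v (copy 2 3 20 6 7) (\<lambda>t'' s'. Q (6 + t + t' + t'') s') s') s1"
    if "\<exists>f' G O' gs. s1 = mkst f' (g(2 := G, 4 := O')) h q \<and>
      factored (g 0) (f1 19) (f1 18) G O' (f1 6) gs \<and>
      f' 21 = length gs \<and> f' 6 = f1 6 + length (concat gs) \<and> (\<forall>r < f1 6. G r = g 2 r) \<and>
      (\<forall>x. x \<notin> {6, 16, 19, 21, 22, 24, 25} \<longrightarrow> f' x = f1 x) \<and> t \<le> 500 * (f1 18 - f1 19) + 4" for t s1
  proof -
    from that obtain f2 G O' gs where s1: "s1 = mkst f2 (g(2 := G, 4 := O')) h q"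
      and fac: "factored (g 0) (f1 19) (f1 18) G O' (f1 6) gs"
      and f2: "f2 21 = length gs" "f2 6 = f1 6 + length (concat gs)" and old: "\<forall>r < f1 6. G r = g 2 r"
      and fr: "\<forall>x. x \<notin> {6, 16, 19, 21, 22, 24, 25} \<longrightarrow> f2 x = f1 x"
      and t: "t \<le> 500 * (f1 18 - f1 19) + 4" by blast
    have e: "f1 19 = f 3" "f1 18 = f 18" "f1 6 = f 6" by (simp_all add: f1_def)
    have cl: "length (concat gs) \<le> ?d" using fac by (simp add: factored_def e)
    have "f2 6 \<le> n" unfolding f2(2) e using cl f by linarith
    moreover have "f2 2 = k" "f2 10 = 2 * k" using fr f by (simp_all add: f1_def)
    moreover have "factored (g 0) (f 3) (f 18) ((g(2 := G, 4 := O')) 2) ((g(2 := G, 4 := O')) 4) (f 6) gs"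
      using fac by (simp add: e)
    ultimately show ?thesis unfolding s1
    proof (intro wp_conseq[OF wp_drop_middle])
      show "f2 21 = length gs" "f2 6 = f 6 + length (concat gs)" "f 18 \<le> n" using f2 e f by simp_all
      fix t' s2
      assume "\<exists>f' G' R. s2 = mkst f' ((g(2 := G, 4 := O'))(2 := G')) h q \<and> f' 6 = f 6 + length R \<and>
          slice G' (f 6) (f 6 + length R) = R \<and> (\<forall>r < f 6. G' r = (g(2 := G, 4 := O')) 2 r) \<and>
          interch (concat gs) R \<and> set R \<subseteq> set (concat gs) \<and> length R \<le> (2 * k + 3) * ?L \<and> length R \<le> length (concat gs) \<and>
          (\<forall>x. x \<notin> {6, 16, 28} \<longrightarrow> f' x = f2 x) \<and> t' \<le> 16 * length (concat gs) + 60"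
      then obtain f3 G' R where a: "s2 = mkst f3 ((g(2 := G, 4 := O'))(2 := G')) h q"
         "f3 6 = f 6 + length R"
         "slice G' (f 6) (f 6 + length R) = R" "\<forall>r < f 6. G' r = (g(2 := G, 4 := O')) 2 r"
         "interch (concat gs) R" "set R \<subseteq> set (concat gs)"
         "length R \<le> (2 * k + 3) * ?L" "length R \<le> length (concat gs)"
         "\<forall>x. x \<notin> {6, 16, 28} \<longrightarrow> f3 x = f2 x" "t' \<le> 16 * length (concat gs) + 60" by blast
      have a4: "\<forall>r < f 6. G' r = G r" using a(4) by simp
      show "wp W v (copy 2 3 20 6 7) (\<lambda>t'' s'. Q (6 + t + t' + t'') s') s2"
        by (rule last[OF s1 _ fr _ _ a(1-3) a4 a(5-10)]) (use fac old t e in simp_all)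
    qed
  qed
  have "wp W v emit_run Q (mkst f g h q)"
    unfolding emit_run_def
    by (simp add: wp_Seq wp_WAssign del: add_2_eq_Suc add_2_eq_Suc' flip: f1_def)
      (rule wp_conseq[OF wp_factors[OF f1]], drule mid, simp add: ac_simps)
  then show ?thesis unfolding Q_def .
qed

text \<open>\<open>k\<close> \<le> \<open>u0\<close> makes the position in \<open>Y\<close>
  nonnegative, so the wrapping subtraction of the program and the truncated one in
  \<open>agree\<close> coincide.\<close>

lemma wp_agree_scan:
  fixes g :: "nat \<Rightarrow> nat \<Rightarrow> nat"
  assumes f: "f 0 \<le> n" "f 1 \<le> n" "f 2 = k" "f 14 \<le> 2 * k" and u0: "k \<le> u0" "u0 \<le> f 0"
    and X: "X = slice (g 0) 0 (f 0)" and Y: "Y = slice (g 1) 0 (f 1)"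
  shows "wp W v (While agree_cond (incr 17)) (\<lambda>t s'. \<exists>u. u0 \<le> u \<and> u \<le> f 0 \<and>
      (\<forall>i. u0 \<le> i \<and> i < u \<longrightarrow> agree X Y k (f 14) i) \<and> \<not> agree X Y k (f 14) u \<and>
      s' = mkst (f(17 := u)) g h q \<and> t \<le> 38 * (u - u0) + 34) (mkst (f(17 := u0)) g h q)"
proof -
  have c: "bval W v (mkst (f(17 := l)) g h q) agree_cond \<longleftrightarrow> agree X Y k (f 14) l"
    if "u0 \<le> l" "l \<le> f 0" for l
  proof -
    have "l + f 14 < 2 ^ W" "k \<le> l + f 14" using that f u0 word_bounds by linarith+
    then show ?thesis
      by (auto simp: agree_cond_def agree_def X Y f sub_mod_word sub_mod_word')
  qed
  have bt: "btime agree_cond = 33" by (simp add: agree_cond_def)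
  show ?thesis
  proof (rule wp_conseq[OF wp_scan[where M = "f 0"]])
    show "u0 \<le> f 0" by fact
    show "f 0 < 2 ^ W" using f word_bounds by linarith
    show "\<not> bval W v (mkst (f(17 := f 0)) g h q) agree_cond" using c[of "f 0"] u0 by (simp add: agree_def X)
    fix t s' assume "\<exists>i\<ge>u0. i \<le> f 0 \<and> s' = mkst (f(17 := i)) g h q \<and>
      \<not> bval W v (mkst (f(17 := i)) g h q) agree_cond \<and>
      (\<forall>l. u0 \<le> l \<and> l < i \<longrightarrow> bval W v (mkst (f(17 := l)) g h q) agree_cond) \<and>
      t \<le> (i - u0) * (btime agree_cond + 5) + btime agree_cond + 1"
    then obtain i where i: "u0 \<le> i" "i \<le> f 0" "s' = mkst (f(17 := i)) g h q"
      "\<not> bval W v (mkst (f(17 := i)) g h q) agree_cond"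
      "\<And>l. u0 \<le> l \<Longrightarrow> l < i \<Longrightarrow> bval W v (mkst (f(17 := l)) g h q) agree_cond"
      "t \<le> (i - u0) * 38 + 34"
      unfolding bt by auto
    have 1: "\<forall>l. u0 \<le> l \<and> l < i \<longrightarrow> agree X Y k (f 14) l" using i(5) c i(2) by simp
    have 2: "\<not> agree X Y k (f 14) i" using i(4) c i(1,2) by simp
    show "\<exists>u. u0 \<le> u \<and> u \<le> f 0 \<and>
      (\<forall>i. u0 \<le> i \<and> i < u \<longrightarrow> agree X Y k (f 14) i) \<and> \<not> agree X Y k (f 14) u \<and>
      s' = mkst (f(17 := u)) g h q \<and> t \<le> 38 * (u - u0) + 34"
      using i(1,2,3,6) 1 2 by (intro exI[of _ i]) simp
  qed
qed

lemma wp_find_run: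
  fixes g :: "nat \<Rightarrow> nat \<Rightarrow> nat"
  assumes f: "f 0 \<le> n" "f 1 \<le> n" "f 2 = k" "f 10 = 2 * k" "f 11 = 4 * k" "5 * k \<le> f 3"
      "f 3 + 2 * k < f 0"
    and X: "X = slice (g 0) 0 (f 0)" and Y: "Y = slice (g 1) 0 (f 1)"
  shows "wp W v find_run (\<lambda>t s'. \<exists>j u. s' = mkst (f(26 := f 3 + 2 * k, 14 := j, 17 := u)) g h q \<and>
      j \<le> 2 * k \<and> f 3 - 4 * k \<le> u \<and> u \<le> f 0 \<and> (\<forall>i. f 3 - 4 * k \<le> i \<and> i < u \<longrightarrow> agree X Y k j i) \<and>
      \<not> agree X Y k j u \<and> (u \<le> f 3 + 2 * k \<longrightarrow> (\<forall>j' \<le> 2 * k. \<not> hit X Y k j' (f 3))) \<and>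
      t \<le> 1100 * (k * k) + 38 * (u - f 3) + 100) (mkst f g h q)"
proof -
  let ?x = "f 3"
  define u0 where "u0 = ?x - 4 * k"
  have u0: "k \<le> u0" "u0 \<le> f 0" "u0 \<le> ?x" "?x = u0 + 4 * k" using f unfolding u0_def by linarith+
  define fi where "fi = f(26 := ?x + 2 * k)"
  have W: "?x < 2 ^ W" "4 * k \<le> ?x" "?x + 2 * k < 2 ^ W" "2 * k + 1 < 2 ^ W" using f word_bounds by linarith+
  define I where "I s \<longleftrightarrow> (\<exists>j u. s = mkst (fi(14 := j, 17 := u)) g h q \<and> j \<le> 2 * k \<and> u0 \<le> u \<and> u \<le> f 0 \<and>
     (\<forall>i. u0 \<le> i \<and> i < u \<longrightarrow> agree X Y k j i) \<and> \<not> agree X Y k j u \<and>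
     (\<forall>j' < j. \<not> hit X Y k j' ?x))" for s
  \<comment> \<open>A failing scan covers at most \<open>6 * k\<close> positions at 38 units each,
    which \<open>300 * k\<close> pays for including overhead; the second summand is reserved for the
    scan that leaves the window.\<close>
  define \<mu> where "\<mu> s = (2 * k - wvar s 14) * (300 * k)
     + 38 * (if wvar s 17 \<le> ?x + 2 * k then f 0 - u0 else f 0 - wvar s 17)" for s :: state
  let ?b = "BAnd (BNot (WLess (WVar 26) (WVar 17))) (WLess (WVar 14) (WVar 10))"
  let ?body = "Seq (incr 14) (Seq (WAssign 17 (WOp Sub (WVar 3) (WVar 11))) (While agree_cond (incr 17)))"
  define Q where "Q t s' \<longleftrightarrow> (\<exists>j u. s' = mkst (f(26 := f 3 + 2 * k, 14 := j, 17 := u)) g h q \<and>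
      j \<le> 2 * k \<and> f 3 - 4 * k \<le> u \<and> u \<le> f 0 \<and> (\<forall>i. f 3 - 4 * k \<le> i \<and> i < u \<longrightarrow> agree X Y k j i) \<and>
      \<not> agree X Y k j u \<and> (u \<le> f 3 + 2 * k \<longrightarrow> (\<forall>j' \<le> 2 * k. \<not> hit X Y k j' (f 3))) \<and>
      t \<le> 1100 * (k * k) + 38 * (u - f 3) + 100)" for t s'
  have bt: "btime ?b = 8" by simp
  have miss: "\<not> hit X Y k j ?x" if "u \<le> ?x + 2 * k" "u0 \<le> u" "\<not> agree X Y k j u" for j u
    using that unfolding hit_def u0_def by blast
  have scan: "wp W v (While agree_cond (incr 17)) (\<lambda>t s'. \<exists>u. u0 \<le> u \<and> u \<le> f 0 \<and>
      (\<forall>i. u0 \<le> i \<and> i < u \<longrightarrow> agree X Y k j i) \<and> \<not> agree X Y k j u \<and>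
      s' = mkst (fi(14 := j, 17 := u)) g h q \<and> t \<le> 38 * (u - u0) + 34) (mkst (fi(14 := j, 17 := u0)) g h q)"
    if "j \<le> 2 * k" for j
    using wp_agree_scan[of "fi(14 := j)" u0 X g Y h q] f u0 X Y that by (simp add: fi_def)
  have loop: "wp W v (While ?b ?body)
     (\<lambda>t s'. I s' \<and> \<not> bval W v s' ?b \<and> t + \<mu> s' \<le> \<mu> s + 1 + btime ?b) s" if "I s" for s
  proof (rule wp_While)
    fix s assume "I s" and b: "bval W v s ?b"
    then obtain j u where I: "s = mkst (fi(14 := j, 17 := u)) g h q" "j \<le> 2 * k" "u0 \<le> u" "u \<le> f 0"
     "\<forall>i. u0 \<le> i \<and> i < u \<longrightarrow> agree X Y k j i" "\<not> agree X Y k j u"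
     "\<forall>j' < j. \<not> hit X Y k j' ?x" unfolding I_def by blast
    have lt: "u \<le> ?x + 2 * k" "j < 2 * k" using b f W unfolding I(1) by (auto simp: fi_def)
    have ov: "j + 1 < 2 ^ W" using lt W by linarith
    have st: "fi(14 := j, 17 := u, 14 := j + 1, 17 := u0) = fi(14 := j + 1, 17 := u0)"
      by (auto simp: fun_eq_iff)
    have *: "wp W v (While agree_cond (incr 17)) (\<lambda>t s'. I s' \<and> 4 + (4 + t) + 1 + btime ?b + \<mu> s' \<le> \<mu> s)
          (mkst (fi(14 := j + 1, 17 := u0)) g h q)"
    proof (rule wp_conseq[OF scan])
      show "j + 1 \<le> 2 * k" using lt by simp
      fix t s' assume "\<exists>u. u0 \<le> u \<and> u \<le> f 0 \<and>
          (\<forall>i. u0 \<le> i \<and> i < u \<longrightarrow> agree X Y k (j + 1) i) \<and> \<not> agree X Y k (j + 1) u \<and>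
          s' = mkst (fi(14 := j + 1, 17 := u)) g h q \<and> t \<le> 38 * (u - u0) + 34"
      then obtain u' where u': "u0 \<le> u'" "u' \<le> f 0" "\<forall>i. u0 \<le> i \<and> i < u' \<longrightarrow> agree X Y k (j + 1) i"
        "\<not> agree X Y k (j + 1) u'" "s' = mkst (fi(14 := j + 1, 17 := u')) g h q" "t \<le> 38 * (u' - u0) + 34"
        by blast
      have "\<forall>j' < j + 1. \<not> hit X Y k j' ?x" using I(7) miss[OF lt(1) I(3,6)] by (metis Suc_eq_plus1 less_Suc_eq)
      moreover have "j + 1 \<le> 2 * k" using lt(2) by simp
      ultimately have "I s'" unfolding I_def using u' by blast
      moreover have "4 + (4 + t) + 1 + btime ?b + \<mu> s' \<le> \<mu> s"
      proof -
        obtain e where e: "2 * k = j + 1 + e" using lt(2) by (auto simp: less_iff_Suc_add)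
        have "(2 * k - j) * (300 * k) = (2 * k - (j + 1)) * (300 * k) + 300 * k"
          unfolding e by (simp add: add_mult_distrib)
        moreover have "\<mu> s = (2 * k - j) * (300 * k) + 38 * (f 0 - u0)"
          using lt(1) unfolding \<mu>_def I(1) by (simp add: fi_def)
        moreover have "\<mu> s' = (2 * k - (j + 1)) * (300 * k)
            + 38 * (if u' \<le> ?x + 2 * k then f 0 - u0 else f 0 - u')"
          unfolding \<mu>_def u'(5) by (simp add: fi_def)
        moreover have "17 + t \<le> 300 * k" if "u' \<le> ?x + 2 * k"
          using that u'(6,1) u0 k_pos by linarith
        moreover have "17 + t + 38 * (f 0 - u') \<le> 300 * k + 38 * (f 0 - u0)"
          using u'(1,2,6) k_pos by linarith
        ultimately show ?thesis unfolding bt by (auto split: if_splits)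
      qed
      ultimately show "I s' \<and> 4 + (4 + t) + 1 + btime ?b + \<mu> s' \<le> \<mu> s" ..
    qed
    show "wp W v ?body (\<lambda>t s'. I s' \<and> t + 1 + btime ?b + \<mu> s' \<le> \<mu> s) s"
      unfolding I(1) wp_Seq
    proof (rule wp_incrI[OF _ refl])
      show "wvar (mkst (fi(14 := j, 17 := u)) g h q) 14 + 1 < 2 ^ W" using ov by simp
      show "wp W v (WAssign 17 (WOp Sub (WVar 3) (WVar 11)))
        (\<lambda>t'. wp W v (While agree_cond (incr 17))
           (\<lambda>t'a s'. I s' \<and> 4 + (t' + t'a) + 1 + btime ?b + \<mu> s' \<le> \<mu> (mkst (fi(14 := j, 17 := u)) g h q)))
        ((mkst (fi(14 := j, 17 := u)) g h q)
          \<lparr>wvar := (wvar (mkst (fi(14 := j, 17 := u)) g h q))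
            (14 := wvar (mkst (fi(14 := j, 17 := u)) g h q) 14 + 1)\<rparr>)"
        using * W f(5) unfolding I(1) st[symmetric] u0_def
        by (simp add: wp_WAssign sub_mod_word sub_mod_word' fi_def)
    qed
  next
    show "I s" by (rule that)
  qed
  have first: "wp W v (While agree_cond (incr 17)) (\<lambda>t s'. wp W v (While ?b ?body)
      (\<lambda>t' s'. Q (10 + (t + t')) s') s') (mkst (fi(14 := 0, 17 := u0)) g h q)"
  proof (rule wp_conseq[OF scan])
    fix t s' assume "\<exists>u. u0 \<le> u \<and> u \<le> f 0 \<and>
        (\<forall>i. u0 \<le> i \<and> i < u \<longrightarrow> agree X Y k 0 i) \<and> \<not> agree X Y k 0 u \<and>
        s' = mkst (fi(14 := 0, 17 := u)) g h q \<and> t \<le> 38 * (u - u0) + 34"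
    then obtain u where u: "u0 \<le> u" "u \<le> f 0" "\<forall>i. u0 \<le> i \<and> i < u \<longrightarrow> agree X Y k 0 i"
      "\<not> agree X Y k 0 u" "s' = mkst (fi(14 := 0, 17 := u)) g h q" "t \<le> 38 * (u - u0) + 34" by blast
    have "(0::nat) \<le> 2 * k" "\<forall>j' < 0. \<not> hit X Y k j' ?x" by simp_all
    then have "I s'" unfolding I_def using u by blast
    have mu: "t + \<mu> s' \<le> 34 + 228 * k + 600 * (k * k) + 38 * (f 0 - u0)"
    proof -
      have "\<mu> s' = 600 * (k * k) + 38 * (if u \<le> ?x + 2 * k then f 0 - u0 else f 0 - u)"
        unfolding \<mu>_def u(5) by (simp add: fi_def)
      moreover have "t \<le> 34 + 228 * k" if "u \<le> ?x + 2 * k" using that u(6,1) u0 by linarith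
      moreover have "t + 38 * (f 0 - u) \<le> 34 + 38 * (f 0 - u0)" using u(1,2,6) by linarith
      ultimately show ?thesis by (auto split: if_splits)
    qed
    show "wp W v (While ?b ?body) (\<lambda>t' s'. Q (10 + (t + t')) s') s'"
    proof (rule wp_conseq[OF loop[OF \<open>I s'\<close>]])
      fix t' s'' assume a: "I s'' \<and> \<not> bval W v s'' ?b \<and> t' + \<mu> s'' \<le> \<mu> s' + 1 + btime ?b"
      then obtain j u where I: "s'' = mkst (fi(14 := j, 17 := u)) g h q" "j \<le> 2 * k" "u0 \<le> u" "u \<le> f 0"
        "\<forall>i. u0 \<le> i \<and> i < u \<longrightarrow> agree X Y k j i" "\<not> agree X Y k j u"
        "\<forall>j' < j. \<not> hit X Y k j' ?x" unfolding I_def by blast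
      have nb: "u \<le> ?x + 2 * k \<Longrightarrow> j = 2 * k" using a f I(2) unfolding I(1) by (auto simp: fi_def)
      have none: "u \<le> ?x + 2 * k \<longrightarrow> (\<forall>j' \<le> 2 * k. \<not> hit X Y k j' ?x)"
        using nb I(7) miss[OF _ I(3,6)] by (metis le_neq_implies_less)
      have "t' + \<mu> s'' \<le> \<mu> s' + 9" using a bt by simp
      moreover have "38 * (f 0 - u) \<le> 38 * (f 0 - u0)" using I(3) by simp
      then have "38 * (f 0 - u) \<le> \<mu> s''" unfolding \<mu>_def I(1)
        by (simp add: trans_le_add2 del: mult_le_cancel1 mult_le_cancel2)
      ultimately have "10 + (t + t') + 38 * (f 0 - u) \<le> 53 + 228 * k + 600 * (k * k) + 38 * (f 0 - u0)"
        using mu by linarith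
      then have "10 + (t + t') \<le> 53 + 228 * k + 600 * (k * k) + 38 * (u - u0)" using I(3,4) by linarith
      moreover have "u - u0 \<le> u - ?x + 4 * k" using u0 by linarith
      ultimately have "10 + (t + t') \<le> 1100 * (k * k) + 38 * (u - ?x) + 100" using k_le_square by linarith
      then show "Q (10 + (t + t')) s''" unfolding Q_def using I none unfolding u0_def fi_def by blast
    qed
  qed simp
  have "wp W v find_run Q (mkst f g h q)"
    unfolding find_run_def using first W f(4,5) unfolding fi_def u0_def
    by (simp add: wp_Seq[of _ _ "WAssign _ _"] wp_Seq[of _ _ "While agree_cond _"] wp_WAssign
       sub_mod_word sub_mod_word' add.assoc)
  then show ?thesis unfolding Q_def .
qed

end


section \<open>The kernel\<close>

text \<open>The letters between the cursors and the start of the run are copied unchanged. The run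
  is taken from the search position up to \<open>2 k\<close> letters before its break: the next run
  may lie on a diagonal lower by up to \<open>2 k\<close>, and the cursor in \<open>Y\<close> must
  not be beyond its start.\<close>

definition take_run :: com where
  "take_run = Seq (WAssign 18 (WOp Sub (WVar 17) (WVar 10))) (Seq (copy 0 2 4 3 6)
     (Seq (WAssign 29 (WOp Sub (WOp Add (WVar 3) (WVar 14)) (WVar 2))) (Seq (copy 1 3 5 29 7)
     (Seq emit_run (Seq (WAssign 4 (WVar 18))
     (Seq (WAssign 5 (WOp Sub (WOp Add (WVar 18) (WVar 14)) (WVar 2))) (WAssign 3 (WVar 17))))))))"

definition kernel_step :: com where
  "kernel_step = Seq (incr 8) (Seq find_run (Cond (WLess (WVar 26) (WVar 17)) take_run
     (WAssign 3 (WOp Add (WVar 26) (WConst 1)))))"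

definition kernel_cond :: bexp where
  "kernel_cond = BAnd (WLess (WOp Add (WVar 3) (WVar 10)) (WVar 0)) (WLess (WVar 8) (WVar 9))"

text \<open>Time bounds add up along a sequence, so the pieces can be verified with intermediate
  state predicates that do not mention time.\<close>

lemma wp_Seq_le:
  assumes "wp W w A (\<lambda>t s'. t \<le> T \<and> P s') s" "\<And>s'. P s' \<Longrightarrow> wp W w B (\<lambda>t r. t \<le> N \<and> R r) s'"
  shows "wp W w (Seq A B) (\<lambda>t r. t \<le> T + N \<and> R r) s"
  unfolding wp_Seq
proof (rule wp_conseq[OF assms(1)])
  fix t s' assume "t \<le> T \<and> P s'"
  then show "wp W w B (\<lambda>t'. (\<lambda>t r. t \<le> T + N \<and> R r) (t + t')) s'"
    by (intro wp_conseq[OF assms(2)]) auto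
qed

lemma wp_Seq_exact:
  assumes "wp W w A (\<lambda>t s'. t \<le> T \<and> s' = s1) s" "wp W w B (\<lambda>t r. t \<le> N \<and> R r) s1"
  shows "wp W w (Seq A B) (\<lambda>t r. t \<le> T + N \<and> R r) s"
  using assms by (intro wp_Seq_le[of W w A T "\<lambda>s'. s' = s1"]) auto

context kernel
begin

lemma wp_take_run:
  fixes g :: "nat \<Rightarrow> nat \<Rightarrow> nat"
  assumes f: "f 0 \<le> n" "f 1 \<le> n" "f 2 = k" "f 10 = 2 * k" "f 11 = 4 * k" "f 13 = 8 * (k * k)"
      "5 * k \<le> f 3" "f 4 \<le> f 3" "f 5 + k \<le> f 3" "f 6 \<le> f 4" "f 6 + f 5 = f 7 + f 4" "f 14 \<le> 2 * k"
    and u: "f 3 + 2 * k < f 17" "f 17 \<le> f 0"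
    and agr: "\<And>i. f 3 \<le> i \<Longrightarrow> i < f 17 \<Longrightarrow> i + f 14 - k < f 1"
  shows "wp W v take_run (\<lambda>t s'.
      t \<le> 600 * (f 17 - f 3) + 16 * (f 3 - f 4) + 16 * (f 3 + f 14 - k - f 5) + 200 \<and> (\<exists>f' g' R. s' = mkst f' g' h q \<and> g' 0 = g 0 \<and> g' 1 = g 1 \<and>
      f' 3 = f 17 \<and> f' 4 = f 17 - 2 * k \<and> f' 5 = f 17 - 2 * k + f 14 - k \<and>
      f' 6 = f 6 + (f 3 - f 4) + length R \<and> f' 7 = f 7 + (f 3 + f 14 - k - f 5) + length R \<and>
      slice (g' 2) 0 (f' 6) = slice (g 2) 0 (f 6) @ slice (g 0) (f 4) (f 3) @ R \<and>
      slice (g' 3) 0 (f' 7) = slice (g 3) 0 (f 7) @ slice (g 1) (f 5) (f 3 + f 14 - k) @ R \<and>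
      interch (slice (g 0) (f 3) (f 17 - 2 * k)) R \<and> set R \<subseteq> set (slice (g 0) (f 3) (f 17 - 2 * k)) \<and>
      length R \<le> (2 * k + 3) * (8 * (k * k) + 2 * k) \<and> length R \<le> f 17 - 2 * k - f 3 \<and>
      (\<forall>x \<in> {0, 1, 2, 8, 9, 10, 11, 13}. f' x = f x))) (mkst f g h q)"
proof -
  let ?x = "f 3" and ?u = "f 17" and ?j = "f 14"
  define en where "en = ?u - 2 * k"
  define yl where "yl = ?x + ?j - k"
  have en: "?x < en" "en < ?u" "en \<le> n" "en \<le> f 0" using u f k_pos unfolding en_def by linarith+
  have y: "f 5 \<le> yl" "yl < f 1" "yl + (en - ?x) < f 1" "en + ?j - k = yl + (en - ?x)"
    using agr[of ?x] agr[of en] en f unfolding yl_def by simp_all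
  define P where "P s' \<longleftrightarrow> (\<exists>f' g' R. s' = mkst f' g' h q \<and> g' 0 = g 0 \<and> g' 1 = g 1 \<and>
      f' 3 = f 17 \<and> f' 4 = f 17 - 2 * k \<and> f' 5 = f 17 - 2 * k + f 14 - k \<and>
      f' 6 = f 6 + (f 3 - f 4) + length R \<and> f' 7 = f 7 + (f 3 + f 14 - k - f 5) + length R \<and>
      slice (g' 2) 0 (f' 6) = slice (g 2) 0 (f 6) @ slice (g 0) (f 4) (f 3) @ R \<and>
      slice (g' 3) 0 (f' 7) = slice (g 3) 0 (f 7) @ slice (g 1) (f 5) (f 3 + f 14 - k) @ R \<and>
      interch (slice (g 0) (f 3) (f 17 - 2 * k)) R \<and> set R \<subseteq> set (slice (g 0) (f 3) (f 17 - 2 * k)) \<and>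
      length R \<le> (2 * k + 3) * (8 * (k * k) + 2 * k) \<and> length R \<le> f 17 - 2 * k - f 3 \<and>
      (\<forall>x \<in> {0, 1, 2, 8, 9, 10, 11, 13}. f' x = f x))" for s'
  define f1 where "f1 = f(18 := en)"
  define g2 where "g2 = g(2 := paste (g 0) (f 4) (?x - f 4) (g 2) (f 6))"
  define f3 where "f3 = f1(4 := ?x, 6 := f 6 + (?x - f 4), 29 := yl)"
  define g4 where "g4 = g2(3 := paste (g 1) (f 5) (yl - f 5) (g 3) (f 7))"
  define f4 where "f4 = f3(5 := yl, 7 := f 7 + (yl - f 5))"
  have W: "?u < 2 ^ W" "?x + ?j < 2 ^ W" "en + ?j < 2 ^ W" "yl < 2 ^ W" "2 * k \<le> ?u" "k \<le> ?x + ?j" "k \<le> en + ?j"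
    "f 7 + (yl - f 5) < 2 ^ W" "f 6 + (?x - f 4) < 2 ^ W" "?x < 2 ^ W"
    using word_bounds f u y en by linarith+
  have b4: "f 6 + (?x - f 4) + (en - ?x) \<le> n" "f 7 + (yl - f 5) + (en - ?x) \<le> n"
    using f en y by linarith+
  have s1: "wp W v (WAssign 18 (WOp Sub (WVar 17) (WVar 10))) (\<lambda>t s'. t \<le> 4 \<and> s' = mkst f1 g h q) (mkst f g h q)"
    using W(1,5) f(4) by (simp add: wp_WAssign f1_def en_def sub_mod_word sub_mod_word')
  have s2: "wp W v (copy 0 2 4 3 6) (\<lambda>t s'. t \<le> 16 * (?x - f 4) + 4 \<and>
      s' = mkst (f1(4 := ?x, 6 := f 6 + (?x - f 4))) g2 h q) (mkst f1 g h q)"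
    using wp_copy[of 4 3 6 f1 W 0 2 v g h q] f(8) W(9,10) unfolding g2_def by (simp add: f1_def)
  have s3: "wp W v (WAssign 29 (WOp Sub (WOp Add (WVar 3) (WVar 14)) (WVar 2)))
      (\<lambda>t s'. t \<le> 6 \<and> s' = mkst f3 g2 h q) (mkst (f1(4 := ?x, 6 := f 6 + (?x - f 4))) g2 h q)"
    using W(2,6) f(3) by (simp add: wp_WAssign f1_def f3_def yl_def sub_mod_word sub_mod_word')
  have s4: "wp W v (copy 1 3 5 29 7) (\<lambda>t s'. t \<le> 16 * (yl - f 5) + 4 \<and> s' = mkst f4 g4 h q) (mkst f3 g2 h q)"
    using wp_copy[of 5 29 7 f3 W 1 3 v g2 h q] W(4,8) y(1) unfolding g4_def f4_def
    by (simp add: f3_def f1_def g2_def)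
  have e4: "f4 18 \<le> n" "f4 2 = k" "f4 10 = 2 * k" "f4 11 = 4 * k" "f4 13 = 8 * (k * k)" "f4 3 \<le> f4 18"
    "f4 6 + (f4 18 - f4 3) \<le> n" "f4 7 + (f4 18 - f4 3) \<le> n"
    using f(3-6) en b4 by (simp_all add: f4_def f3_def f1_def)
  define P5 where "P5 s' \<longleftrightarrow> (\<exists>f' G H O' R. s' = mkst f' (g4(2 := G, 3 := H, 4 := O')) h q \<and>
      f' 6 = f4 6 + length R \<and> f' 7 = f4 7 + length R \<and>
      slice G 0 (f4 6 + length R) = slice (g4 2) 0 (f4 6) @ R \<and>
      slice H 0 (f4 7 + length R) = slice (g4 3) 0 (f4 7) @ R \<and>
      interch (slice (g4 0) (f4 3) (f4 18)) R \<and> set R \<subseteq> set (slice (g4 0) (f4 3) (f4 18)) \<and>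
      length R \<le> (2 * k + 3) * (8 * (k * k) + 2 * k) \<and> length R \<le> f4 18 - f4 3 \<and>
      (\<forall>x. x \<notin> {6, 7, 16, 19, 20, 21, 22, 24, 25, 28} \<longrightarrow> f' x = f4 x))" for s'
  have s5: "wp W v emit_run (\<lambda>t s'. t \<le> 600 * (f4 18 - f4 3) + 100 \<and> P5 s') (mkst f4 g4 h q)"
    by (rule wp_conseq[OF wp_emit_run[OF e4]]) (unfold P5_def, blast)
  have s6: "wp W v (Seq (WAssign 4 (WVar 18)) (Seq (WAssign 5 (WOp Sub (WOp Add (WVar 18) (WVar 14)) (WVar 2)))
      (WAssign 3 (WVar 17)))) (\<lambda>t s'. t \<le> 10 \<and> P s') s'" if "P5 s'" for s'
  proof -
    from that obtain f' G H O' R where s': "s' = mkst f' (g4(2 := G, 3 := H, 4 := O')) h q"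
      and f': "f' 6 = f4 6 + length R" "f' 7 = f4 7 + length R"
      and G: "slice G 0 (f4 6 + length R) = slice (g4 2) 0 (f4 6) @ R"
      and H: "slice H 0 (f4 7 + length R) = slice (g4 3) 0 (f4 7) @ R"
      and ic: "interch (slice (g4 0) (f4 3) (f4 18)) R" and sub: "set R \<subseteq> set (slice (g4 0) (f4 3) (f4 18))"
      and lR: "length R \<le> (2 * k + 3) * (8 * (k * k) + 2 * k)" "length R \<le> f4 18 - f4 3"
      and fr: "\<And>x. x \<notin> {6, 7, 16, 19, 20, 21, 22, 24, 25, 28} \<Longrightarrow> f' x = f4 x"
      unfolding P5_def by blast
    define f6 where "f6 = f'(4 := en, 5 := en + ?j - k, 3 := ?u)"
    have v: "f' 18 = en" "f' 14 = ?j" "f' 2 = k" "f' 17 = ?u"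
      using fr f(3) by (simp_all add: f4_def f3_def f1_def)
    have g4': "g4 0 = g 0" "g4 1 = g 1" "slice (g4 2) 0 (f4 6) = slice (g 2) 0 (f 6) @ slice (g 0) (f 4) ?x"
      "slice (g4 3) 0 (f4 7) = slice (g 3) 0 (f 7) @ slice (g 1) (f 5) yl"
      using slice_paste_append[of 0 "f 6" "g 0" "f 4" "?x - f 4" "g 2"]
        slice_paste_append[of 0 "f 7" "g 1" "f 5" "yl - f 5" "g 3"] f(8) y(1)
      by (simp_all add: g4_def g2_def f4_def f3_def f1_def)
    have "P (mkst f6 (g4(2 := G, 3 := H, 4 := O')) h q)" unfolding P_def
    proof (intro exI conjI)
      show "mkst f6 (g4(2 := G, 3 := H, 4 := O')) h q = mkst f6 (g4(2 := G, 3 := H, 4 := O')) h q" ..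
      show "(g4(2 := G, 3 := H, 4 := O')) 0 = g 0" "(g4(2 := G, 3 := H, 4 := O')) 1 = g 1"
        using g4' by simp_all
      show "f6 3 = ?u" "f6 4 = ?u - 2 * k" "f6 5 = ?u - 2 * k + ?j - k" by (simp_all add: f6_def en_def)
      show f66: "f6 6 = f 6 + (?x - f 4) + length R" and f67: "f6 7 = f 7 + (?x + ?j - k - f 5) + length R"
        using f' by (simp_all add: f6_def f4_def f3_def yl_def)
      have e: "f6 6 = f4 6 + length R" "f6 7 = f4 7 + length R" using f' by (simp_all add: f6_def)
      show "slice ((g4(2 := G, 3 := H, 4 := O')) 2) 0 (f6 6) = slice (g 2) 0 (f 6) @ slice (g 0) (f 4) ?x @ R"
        unfolding e using G g4'(3) by simp
      show "slice ((g4(2 := G, 3 := H, 4 := O')) 3) 0 (f6 7)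
          = slice (g 3) 0 (f 7) @ slice (g 1) (f 5) (?x + ?j - k) @ R"
        unfolding e using H g4'(4) by (simp add: yl_def)
      show "interch (slice (g 0) ?x (?u - 2 * k)) R" "set R \<subseteq> set (slice (g 0) ?x (?u - 2 * k))"
      proof -
        have "slice (g4 0) (f4 3) (f4 18) = slice (g 0) ?x (?u - 2 * k)"
          using g4'(1) by (simp add: f4_def f3_def f1_def en_def)
        then show "interch (slice (g 0) ?x (?u - 2 * k)) R" "set R \<subseteq> set (slice (g 0) ?x (?u - 2 * k))"
          using ic sub by simp_all
      qed
      show "length R \<le> (2 * k + 3) * (8 * (k * k) + 2 * k)" by (rule lR(1))
      show "length R \<le> ?u - 2 * k - ?x" using lR(2) by (simp add: f4_def f3_def f1_def en_def)
      show "\<forall>x \<in> {0, 1, 2, 8, 9, 10, 11, 13}. f6 x = f x"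
        using fr by (simp add: f6_def f4_def f3_def f1_def)
    qed
    then show ?thesis unfolding s' f6_def
      using v W(3,7) by (simp add: wp_Seq wp_WAssign sub_mod_word sub_mod_word')
  qed
  have "wp W v take_run (\<lambda>t s'. t \<le> 4 + (16 * (?x - f 4) + 4 + (6 + (16 * (yl - f 5) + 4 +
      (600 * (f4 18 - f4 3) + 100 + 10)))) \<and> P s') (mkst f g h q)"
    unfolding take_run_def
    by (intro wp_Seq_exact[OF s1] wp_Seq_exact[OF s2] wp_Seq_exact[OF s3] wp_Seq_exact[OF s4]
        wp_Seq_le[OF s5] s6)
  moreover have "4 + (16 * (?x - f 4) + 4 + (6 + (16 * (yl - f 5) + 4 + (600 * (f4 18 - f4 3) + 100 + 10))))
      \<le> 600 * (f 17 - f 3) + 16 * (f 3 - f 4) + 16 * (f 3 + f 14 - k - f 5) + 200"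
    using en by (simp add: f4_def f3_def f1_def yl_def)
  ultimately have "wp W v take_run (\<lambda>t s'.
      t \<le> 600 * (f 17 - f 3) + 16 * (f 3 - f 4) + 16 * (f 3 + f 14 - k - f 5) + 200 \<and> P s') (mkst f g h q)"
    by (elim wp_conseq) linarith
  then show ?thesis unfolding P_def .
qed

text \<open>Letters of output per search step: a compressed run of at most \<open>2 * k + 3\<close>
  factors, plus the \<open>2 * k\<close> letters held back at its end or the jump of
  \<open>2 * k + 1\<close>.\<close>

definition step_growth :: nat where
  "step_growth = (2 * k + 3) * (8 * (k * k) + 2 * k) + 2 * k + 1"

text \<open>The output so far followed by the unread suffixes is equivalent to the input for all
  thresholds up to \<open>k\<close>. By \<open>f 6 + f 5 = f 7 + f 4\<close> both outputs have lost
  equally many letters, so diagonals are preserved; \<open>f 5 + k\<close> \<le> \<open>f 3\<close>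
  lets the next run start on any diagonal. The size bound counts the letters between the cursor and
  the search position as already emitted.\<close>

definition kernel_inv :: "nat list \<Rightarrow> nat list \<Rightarrow> (nat \<Rightarrow> nat) \<Rightarrow> (nat \<Rightarrow> nat \<Rightarrow> nat) \<Rightarrow> bool" where
  "kernel_inv X Y f g \<longleftrightarrow> f 0 = length X \<and> f 1 = length Y \<and> slice (g 0) 0 (f 0) = X \<and> slice (g 1) 0 (f 1) = Y \<and>
     f 2 = k \<and> f 9 = 5 * k + 5 \<and> f 10 = 2 * k \<and> f 11 = 4 * k \<and> f 13 = 8 * (k * k) \<and>
     (run_step X Y k ^^ f 8) (5 * k) (f 3) \<and> f 8 \<le> 5 * k + 5 \<and>
     f 4 \<le> f 3 \<and> f 5 + k \<le> f 3 \<and> f 5 \<le> f 1 \<and> f 4 \<le> f 0 \<and> f 6 + f 5 = f 7 + f 4 \<and> f 6 \<le> f 4 \<and>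
     f 6 + (f 3 - f 4) \<le> 5 * k + f 8 * step_growth \<and>
     (\<forall>c \<le> real k. alignable c (slice (g 2) 0 (f 6) @ drop (f 4) X) (slice (g 3) 0 (f 7) @ drop (f 5) Y)
        = alignable c X Y) \<and>
     set (slice (g 2) 0 (f 6)) \<subseteq> set X \<and> set (slice (g 3) 0 (f 7)) \<subseteq> set X \<union> set Y"

text \<open>A search step costs \<open>O(k^2)\<close> for its windows, paid by the number of steps
  still allowed. Each letter of \<open>X\<close> ahead of the search pays for scanning and
  compression, each unread letter of either string for being copied.\<close>

definition kernel_potential :: "(nat \<Rightarrow> nat) \<Rightarrow> nat" where
  "kernel_potential f = 3000 * (k * k) * (5 * k + 5 - f 8) + 700 * (f 0 - f 3) + 20 * (f 0 - f 4) + 20 * (f 1 - f 5)"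

lemma wp_kernel_step:
  assumes inv: "kernel_inv X Y f g" and "length X \<le> n" "length Y \<le> n"
    and b: "f 3 + 2 * k < f 0" "f 8 < f 9"
  shows "wp W v kernel_step (\<lambda>t s'. \<exists>f' g'. s' = mkst f' g' h q \<and> kernel_inv X Y f' g' \<and>
      t + 12 + kernel_potential f' \<le> kernel_potential f) (mkst f g h q)"
proof -
  define f1 where "f1 = f(8 := f 8 + 1)"
  have X: "X = slice (g 0) 0 (f 0)" and Y: "Y = slice (g 1) 0 (f 1)" and len: "f 0 = length X" "f 1 = length Y"
    and c: "f 2 = k" "f 9 = 5 * k + 5" "f 10 = 2 * k" "f 11 = 4 * k" "f 13 = 8 * (k * k)"
    and steps: "(run_step X Y k ^^ f 8) (5 * k) (f 3)" and le: "f 4 \<le> f 3" "f 5 + k \<le> f 3" "f 5 \<le> f 1" "f 4 \<le> f 0"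
    "f 6 + f 5 = f 7 + f 4" "f 6 \<le> f 4"
    and size: "f 6 + (f 3 - f 4) \<le> 5 * k + f 8 * step_growth"
    and eqv: "\<And>c. c \<le> real k \<Longrightarrow> alignable c (slice (g 2) 0 (f 6) @ drop (f 4) X) (slice (g 3) 0 (f 7) @ drop (f 5) Y)
        = alignable c X Y"
    and sets: "set (slice (g 2) 0 (f 6)) \<subseteq> set X" "set (slice (g 3) 0 (f 7)) \<subseteq> set X \<union> set Y"
    using inv unfolding kernel_inv_def by auto
  have x5: "5 * k \<le> f 3" using steps by (rule run_steps_ge)
  have n: "f 0 \<le> n" "f 1 \<le> n" using assms len by simp_all
  have W: "f 8 + 1 < 2 ^ W" "f 3 + 2 * k + 1 < 2 ^ W" using b c n word_bounds by linarith+
  have pot8: "3000 * (k * k) * (5 * k + 5 - f 8) = 3000 * (k * k) * (5 * k + 5 - (f 8 + 1)) + 3000 * (k * k)"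
  proof -
    obtain e where e: "5 * k + 5 - (f 8 + 1) = e" "5 * k + 5 - f 8 = e + 1" using b(2) c(2) by simp
    show ?thesis unfolding e add_mult_distrib2 by simp
  qed
  define P where "P s' \<longleftrightarrow> (\<exists>j u. s' = mkst (f1(26 := f 3 + 2 * k, 14 := j, 17 := u)) g h q \<and>
      j \<le> 2 * k \<and> f 3 - 4 * k \<le> u \<and> u \<le> f 0 \<and> (\<forall>i. f 3 - 4 * k \<le> i \<and> i < u \<longrightarrow> agree X Y k j i) \<and>
      \<not> agree X Y k j u \<and> (u \<le> f 3 + 2 * k \<longrightarrow> (\<forall>j' \<le> 2 * k. \<not> hit X Y k j' (f 3))))" for s'
  define Q where "Q t s' \<longleftrightarrow> (\<exists>f' g'. s' = mkst f' g' h q \<and> kernel_inv X Y f' g' \<and>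
      t + 12 + kernel_potential f' \<le> kernel_potential f)" for t s'
  let ?C = "Cond (WLess (WVar 26) (WVar 17)) take_run (WAssign 3 (WOp Add (WVar 26) (WConst 1)))"
  have cond: "wp W v ?C (\<lambda>t' s'. Q (4 + (t + t')) s') s1"
    if "s1 = mkst (f1(26 := f 3 + 2 * k, 14 := j, 17 := u)) g h q" and j: "j \<le> 2 * k" and u: "f 3 - 4 * k \<le> u" "u \<le> f 0"
      and agr: "\<forall>i. f 3 - 4 * k \<le> i \<and> i < u \<longrightarrow> agree X Y k j i" and stop: "\<not> agree X Y k j u"
      and no: "u \<le> f 3 + 2 * k \<longrightarrow> (\<forall>j' \<le> 2 * k. \<not> hit X Y k j' (f 3))"
      and t: "t \<le> 1100 * (k * k) + 38 * (u - f 3) + 100"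
    for t s1 j u
  proof (cases "f 3 + 2 * k < u")
    case False
    define f2 where "f2 = f1(26 := f 3 + 2 * k, 14 := j, 17 := u, 3 := f 3 + 2 * k + 1)"
    have rs: "run_step X Y k (f 3) (f 3 + 2 * k + 1)"
      using False no b(1) len unfolding run_step_def by simp
    have st: "(run_step X Y k ^^ (f 8 + 1)) (5 * k) (f 3 + 2 * k + 1)"
      using steps rs unfolding Suc_eq_plus1[symmetric] by auto
    have sz: "f 6 + (f 3 + 2 * k + 1 - f 4) \<le> 5 * k + (f 8 + 1) * step_growth"
      using size le(1) by (simp add: add_mult_distrib) (simp add: step_growth_def)
    have v2: "f2 0 = f 0" "f2 1 = f 1" "f2 2 = f 2" "f2 3 = f 3 + 2 * k + 1" "f2 4 = f 4" "f2 5 = f 5"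
      "f2 6 = f 6" "f2 7 = f 7" "f2 8 = f 8 + 1" "f2 9 = f 9" "f2 10 = f 10" "f2 11 = f 11" "f2 13 = f 13"
      by (simp_all add: f2_def f1_def)
    have "f 4 \<le> f 3 + 2 * k + 1" "f 5 + k \<le> f 3 + 2 * k + 1" "f 8 + 1 \<le> 5 * k + 5" using le b c by linarith+
    note bounds = this
    have "kernel_inv X Y f2 g"
      unfolding kernel_inv_def v2
      by (intro conjI allI impI)
        (fact len X[symmetric] Y[symmetric] c st bounds le sz sets | rule eqv, assumption)+
    moreover have "4 + (t + 8) + 12 + kernel_potential f2 \<le> kernel_potential f"
    proof -
      have kp: "kernel_potential f2 = 3000 * (k * k) * (5 * k + 5 - (f 8 + 1)) + 700 * (f 0 - (f 3 + 2 * k + 1))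
          + 20 * (f 0 - f 4) + 20 * (f 1 - f 5)" unfolding kernel_potential_def v2 ..
      have gen: "4 + (t + 8) + 12 + (A + 700 * C' + D + E) \<le> A + K + 700 * C + D + E"
        if "t + 24 \<le> K" "C' \<le> C" for A C C' D E K :: nat using that by linarith
      have "t + 24 \<le> 3000 * (k * k)"
        using t False k_le_square k_pos by linarith
      then show ?thesis unfolding kp kernel_potential_def[of f] pot8 by (rule gen) simp
    qed
    ultimately show ?thesis
      using False W unfolding that(1) Q_def
      by (auto simp: wp_Cond wp_WAssign f1_def intro!: exI[of _ f2] exI[of _ g] simp: f2_def)
  next
    case True
    define f2 where "f2 = f1(26 := f 3 + 2 * k, 14 := j, 17 := u)"
    have f2: "f2 0 \<le> n" "f2 1 \<le> n" "f2 2 = k" "f2 10 = 2 * k" "f2 11 = 4 * k" "f2 13 = 8 * (k * k)"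
      "5 * k \<le> f2 3" "f2 4 \<le> f2 3" "f2 5 + k \<le> f2 3" "f2 6 \<le> f2 4" "f2 6 + f2 5 = f2 7 + f2 4" "f2 14 \<le> 2 * k"
      "f2 3 + 2 * k < f2 17" "f2 17 \<le> f2 0"
      using n c x5 le j True u by (simp_all add: f2_def f1_def)
    have ag: "X ! i = Y ! (i + j - k)" "i < length X" "i + j - k < length Y" if "f 3 - 4 * k \<le> i" "i < u" for i
      using agr that unfolding agree_def by blast+
    have ag2: "i + f2 14 - k < f2 1" if "f2 3 \<le> i" "i < f2 17" for i
      using ag(3)[of i] that len by (simp add: f2_def f1_def)
    let ?x = "f 3" and ?en = "u - 2 * k" and ?yl = "f 3 + j - k" and ?ye = "u - 2 * k + j - k"
    have en: "?x < ?en" "?en < u" using True k_pos by linarith+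
    have "?ye < length Y" using en by (intro ag(3)) linarith+
    then have ylt: "?ye \<le> f 1" "?yl \<le> ?ye" "f 5 \<le> ?yl" "?ye = ?yl + (?en - ?x)"
      using en x5 le len by linarith+
    define P2 where "P2 s' \<longleftrightarrow> (\<exists>f' g' R. s' = mkst f' g' h q \<and> g' 0 = g 0 \<and> g' 1 = g 1 \<and>
      f' 3 = f2 17 \<and> f' 4 = f2 17 - 2 * k \<and> f' 5 = f2 17 - 2 * k + f2 14 - k \<and>
      f' 6 = f2 6 + (f2 3 - f2 4) + length R \<and> f' 7 = f2 7 + (f2 3 + f2 14 - k - f2 5) + length R \<and>
      slice (g' 2) 0 (f' 6) = slice (g 2) 0 (f2 6) @ slice (g 0) (f2 4) (f2 3) @ R \<and>
      slice (g' 3) 0 (f' 7) = slice (g 3) 0 (f2 7) @ slice (g 1) (f2 5) (f2 3 + f2 14 - k) @ R \<and>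
      interch (slice (g 0) (f2 3) (f2 17 - 2 * k)) R \<and> set R \<subseteq> set (slice (g 0) (f2 3) (f2 17 - 2 * k)) \<and>
      length R \<le> (2 * k + 3) * (8 * (k * k) + 2 * k) \<and> length R \<le> f2 17 - 2 * k - f2 3 \<and>
      (\<forall>x \<in> {0, 1, 2, 8, 9, 10, 11, 13}. f' x = f2 x))" for s'
    have tr: "wp W v take_run (\<lambda>t s'.
      t \<le> 600 * (f2 17 - f2 3) + 16 * (f2 3 - f2 4) + 16 * (f2 3 + f2 14 - k - f2 5) + 200 \<and> P2 s') (mkst f2 g h q)"
      unfolding P2_def by (rule wp_take_run[OF f2 ag2])
    have fin: "Q (4 + (t + (4 + t'))) s'" if "P2 s'"
      and t': "t' \<le> 600 * (f2 17 - f2 3) + 16 * (f2 3 - f2 4) + 16 * (f2 3 + f2 14 - k - f2 5) + 200" for t' s'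
    proof -
      have v2: "f2 17 = u" "f2 14 = j" "f2 3 = f 3" "f2 4 = f 4" "f2 5 = f 5" "f2 6 = f 6" "f2 7 = f 7"
        by (simp_all add: f2_def f1_def)
      from \<open>P2 s'\<close> obtain f' g' R where s': "s' = mkst f' g' h q" and g': "g' 0 = g 0" "g' 1 = g 1"
        and f': "f' 3 = u" "f' 4 = ?en" "f' 5 = ?ye" "f' 6 = f 6 + (?x - f 4) + length R"
          "f' 7 = f 7 + (?yl - f 5) + length R"
        and X': "slice (g' 2) 0 (f' 6) = slice (g 2) 0 (f 6) @ slice (g 0) (f 4) ?x @ R"
        and Y': "slice (g' 3) 0 (f' 7) = slice (g 3) 0 (f 7) @ slice (g 1) (f 5) ?yl @ R"
        and ic: "interch (slice (g 0) ?x ?en) R" and sub: "set R \<subseteq> set (slice (g 0) ?x ?en)"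
        and lR: "length R \<le> (2 * k + 3) * (8 * (k * k) + 2 * k)" "length R \<le> ?en - ?x"
        and fr: "\<And>x. x \<in> {0, 1, 2, 8, 9, 10, 11, 13} \<Longrightarrow> f' x = f2 x"
        unfolding P2_def v2 by blast
      have fr': "f' 0 = f 0" "f' 1 = f 1" "f' 2 = k" "f' 8 = f 8 + 1" "f' 9 = 5 * k + 5" "f' 10 = 2 * k"
        "f' 11 = 4 * k" "f' 13 = 8 * (k * k)"
        using fr c by (simp_all add: f2_def f1_def)
      have rs: "run_step X Y k (f 3) u" unfolding run_step_def
        using b(1) len True j agr stop by auto
      have st: "(run_step X Y k ^^ (f 8 + 1)) (5 * k) u"
        using steps rs unfolding Suc_eq_plus1[symmetric] by auto
      have al: "alignable c (slice (g' 2) 0 (f' 6) @ drop ?en X) (slice (g' 3) 0 (f' 7) @ drop ?ye Y)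
          = alignable c X Y" if "c \<le> real k" for c
      proof -
        let ?A = "slice (g 2) 0 (f 6) @ slice (g 0) (f 4) ?x" and ?A' = "slice (g 3) 0 (f 7) @ slice (g 1) (f 5) ?yl"
        \<comment> \<open>As both outputs have lost equally many letters, the lengths of
          \<open>?A\<close> and \<open>?A'\<close> differ by the offset of the diagonal
          \<open>j\<close>, which is at most \<open>k\<close>.\<close>
        have "close ?A ?A'" unfolding close_def length_append length_slice
          using le x5 j ylt(3) by (intro conjI) linarith+
        moreover have "slice (g 0) ?x ?en = slice (g 1) ?yl ?ye"
        proof (rule nth_equalityI)
          show "length (slice (g 0) ?x ?en) = length (slice (g 1) ?yl ?ye)" using ylt(4) by simp
          fix i assume "i < length (slice (g 0) ?x ?en)"
          then have i: "i < ?en - ?x" by simp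
          then have "X ! (?x + i) = Y ! (?yl + i)"
            using ag(1)[of "?x + i"] x5 en by (simp add: add.commute add.left_commute)
          moreover have "X ! (?x + i) = g 0 (?x + i)" unfolding X using i en u(2) by simp
          moreover have "Y ! (?yl + i) = g 1 (?yl + i)" unfolding Y using i ylt(1,4) by simp
          ultimately show "slice (g 0) ?x ?en ! i = slice (g 1) ?yl ?ye ! i" using i ylt(4) by simp
        qed
        moreover have "drop (f 4) X = slice (g 0) (f 4) ?x @ slice (g 0) ?x ?en @ drop ?en X"
          unfolding X drop_slice using le en u(2) by (simp add: slice_append)
        moreover have "drop (f 5) Y = slice (g 1) (f 5) ?yl @ slice (g 1) ?yl ?ye @ drop ?ye Y"
          unfolding Y drop_slice using ylt by (simp add: slice_append)
        ultimately show ?thesis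
          using ic[unfolded interch_def, rule_format, of ?A ?A' c "drop ?en X" "drop ?ye Y"] eqv[OF that] that
          unfolding X' Y' f'(2,3) by simp
      qed
      have sz: "f' 6 + (u - ?en) \<le> 5 * k + (f 8 + 1) * step_growth"
        unfolding add_mult_distrib mult_1 using size lR(1) f'(4) True step_growth_def by linarith
      have bd: "?ye + k \<le> u" "f' 6 + ?ye = f' 7 + ?en" "f' 6 \<le> ?en" "?en \<le> f 0"
        using f'(4,5) le ylt en x5 j lR(2) u(2) by linarith+
      have "set (slice (g 0) ?x ?en) \<subseteq> set X" "set (slice (g 0) (f 4) ?x) \<subseteq> set X"
        "set (slice (g 1) (f 5) ?yl) \<subseteq> set Y"
        unfolding X Y using en u(2) ylt by (simp_all add: set_slice_mono)
      then have sets': "set (slice (g' 2) 0 (f' 6)) \<subseteq> set X" "set (slice (g' 3) 0 (f' 7)) \<subseteq> set X \<union> set Y"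
        unfolding X' Y' using sets sub by auto
      have bd': "f 8 + 1 \<le> 5 * k + 5" "?en \<le> u" using b(2) c(2) en by simp_all
      have "kernel_inv X Y f' g'"
        unfolding kernel_inv_def fr' f'(1-3) g'
        by (intro conjI allI impI) (fact len X[symmetric] Y[symmetric] st ylt(1) sz bd bd' sets' refl | rule al, assumption)+
      moreover have "4 + (t + (4 + t')) + 12 + kernel_potential f' \<le> kernel_potential f"
      proof -
        have kp: "kernel_potential f' = 3000 * (k * k) * (5 * k + 5 - (f 8 + 1)) + 700 * (f 0 - u)
          + 20 * (f 0 - ?en) + 20 * (f 1 - ?ye)" unfolding kernel_potential_def fr' f' ..
        have tri: "a - c = a - b + (b - c)" if "b \<le> a" "c \<le> b" for a b c :: nat using that by simp
        have e: "f 0 - f 3 = f 0 - u + (u - f 3)" "f 0 - f 4 = f 0 - ?en + (?en - f 4)"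
          "f 1 - f 5 = f 1 - ?ye + (?ye - f 5)"
          by (rule tri; use en u(2) le(1) ylt(1-3) in linarith)+
        have gen: "4 + (t + (4 + t')) + 12 + (A + 700 * C + 20 * D + 20 * E)
            \<le> A + 3000 * K + 700 * (C + d) + 20 * (D + d1) + 20 * (E + d2)"
          if "t \<le> 1100 * K + 38 * d + 100" "t' \<le> 600 * d + 16 * a1 + 16 * a2 + 200" "1 \<le> K" "a1 \<le> d1" "a2 \<le> d2"
          for A C D E K d d1 d2 a1 a2 :: nat
          using that unfolding add_mult_distrib2 by linarith
        have "t' \<le> 600 * (u - f 3) + 16 * (f 3 - f 4) + 16 * (?yl - f 5) + 200"
          using t' unfolding v2 .
        moreover have "1 \<le> k * k" using k_le_square k_pos by linarith
        moreover have "f 3 - f 4 \<le> ?en - f 4" "?yl - f 5 \<le> ?ye - f 5" using en ylt(2) by simp_all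
        ultimately show ?thesis unfolding kp kernel_potential_def[of f] pot8 e by (rule gen[OF t])
      qed
      ultimately show ?thesis unfolding Q_def s' by blast
    qed
    have "wp W v take_run (\<lambda>t'. Q (4 + (t + (4 + t')))) (mkst f2 g h q)"
      by (rule wp_conseq[OF tr]) (use fin in blast)
    then show ?thesis unfolding that(1) f2_def[symmetric] using True
      by (simp add: wp_Cond f2_def f1_def)
  qed
  have f1: "f1 0 \<le> n" "f1 1 \<le> n" "f1 2 = k" "f1 10 = 2 * k" "f1 11 = 4 * k" "5 * k \<le> f1 3" "f1 3 + 2 * k < f1 0"
    "X = slice (g 0) 0 (f1 0)" "Y = slice (g 1) 0 (f1 1)"
    using n c x5 b X Y by (simp_all add: f1_def)
  have "wp W v kernel_step Q (mkst f g h q)"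
    unfolding kernel_step_def
    unfolding wp_Seq
  proof (rule wp_incrI[OF _ refl])
    show "wvar (mkst f g h q) 8 + 1 < 2 ^ W" using W by simp
    have "wp W v find_run (\<lambda>t. wp W v ?C (\<lambda>t'. Q (4 + (t + t')))) (mkst f1 g h q)"
    proof (rule wp_conseq[OF wp_find_run[OF f1]])
      fix t s' assume "\<exists>j u. s' = mkst (f1(26 := f1 3 + 2 * k, 14 := j, 17 := u)) g h q \<and>
        j \<le> 2 * k \<and> f1 3 - 4 * k \<le> u \<and> u \<le> f1 0 \<and> (\<forall>i. f1 3 - 4 * k \<le> i \<and> i < u \<longrightarrow> agree X Y k j i) \<and>
        \<not> agree X Y k j u \<and> (u \<le> f1 3 + 2 * k \<longrightarrow> (\<forall>j' \<le> 2 * k. \<not> hit X Y k j' (f1 3))) \<and>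
        t \<le> 1100 * (k * k) + 38 * (u - f1 3) + 100"
      moreover have "f1 3 = f 3" "f1 0 = f 0" by (simp_all add: f1_def)
      ultimately show "wp W v ?C (\<lambda>t'. Q (4 + (t + t'))) s'" using cond by auto
    qed
    then show "wp W v find_run (\<lambda>t. wp W v ?C (\<lambda>t'. Q (4 + (t + t'))))
        ((mkst f g h q)\<lparr>wvar := (wvar (mkst f g h q))(8 := wvar (mkst f g h q) 8 + 1)\<rparr>)"
      by (simp add: f1_def)
  qed
  then show ?thesis unfolding Q_def .
qed

text \<open>On exit either the window no longer fits into \<open>X\<close>, or the step limit is
  reached with letters left; in the latter case \<open>number_of_run_steps\<close> implies that the
  distance exceeds \<open>k\<close>.\<close>

lemma wp_kernel_loop:
  assumes inv: "kernel_inv X Y f g" and n: "length X \<le> n" "length Y \<le> n"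
  shows "wp W v (While kernel_cond kernel_step) (\<lambda>t s'. t \<le> kernel_potential f + 10 \<and>
      (\<exists>f' g'. s' = mkst f' g' h q \<and> kernel_inv X Y f' g' \<and> (f' 3 + 2 * k < f' 0 \<longrightarrow> f' 8 = 5 * k + 5))) (mkst f g h q)"
proof -
  define I where "I s \<longleftrightarrow> (\<exists>f g. s = mkst f g h q \<and> kernel_inv X Y f g)" for s
  have cond: "bval W v (mkst f g h q) kernel_cond \<longleftrightarrow> f 3 + 2 * k < f 0 \<and> f 8 < f 9" if "kernel_inv X Y f g" for f g
  proof -
    have i: "f 10 = 2 * k" "f 0 \<le> n" "(run_step X Y k ^^ f 8) (5 * k) (f 3)"
      using that n by (simp_all add: kernel_inv_def)
    \<comment> \<open>The search position stays within \<open>X\<close>, except for its initial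
      value \<open>5 * k\<close> when \<open>X\<close> is short; the loop test therefore does not
      overflow.\<close>
    have "f 3 \<le> n + 5 * k"
    proof (cases "f 8")
      case 0
      then show ?thesis using i(3) by simp
    next
      case (Suc t)
      then obtain y where "run_step X Y k y (f 3)" using i(3) by auto
      then show ?thesis using run_step_le[of X Y k y "f 3"] n by simp
    qed
    then have "f 3 + 2 * k < 2 ^ W" using word_bounds by linarith
    then show ?thesis using i by (simp add: kernel_cond_def)
  qed
  have "wp W v (While kernel_cond kernel_step) (\<lambda>t s'. I s' \<and> \<not> bval W v s' kernel_cond \<and>
      t + kernel_potential (wvar s') \<le> kernel_potential (wvar (mkst f g h q)) + 1 + btime kernel_cond) (mkst f g h q)"
  proof (rule wp_While)
    show "I (mkst f g h q)" unfolding I_def using inv by blast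
    fix s assume "I s" and b: "bval W v s kernel_cond"
    then obtain f g where s: "s = mkst f g h q" and i: "kernel_inv X Y f g" unfolding I_def by blast
    have bb: "f 3 + 2 * k < f 0" "f 8 < f 9" using b cond[OF i] s by simp_all
    show "wp W v kernel_step (\<lambda>t s'. I s' \<and> t + 1 + btime kernel_cond + kernel_potential (wvar s')
        \<le> kernel_potential (wvar s)) s"
      unfolding s
      by (rule wp_conseq[OF wp_kernel_step[OF i n bb]]) (auto simp: I_def kernel_cond_def)
  qed
  then show ?thesis
  proof (rule wp_conseq)
    fix t s'
    assume a: "I s' \<and> \<not> bval W v s' kernel_cond \<and>
      t + kernel_potential (wvar s') \<le> kernel_potential (wvar (mkst f g h q)) + 1 + btime kernel_cond"
    then obtain f' g' where s: "s' = mkst f' g' h q" and i: "kernel_inv X Y f' g'" unfolding I_def by blast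
    have "btime kernel_cond = 9" by (simp add: kernel_cond_def)
    then have "t \<le> kernel_potential f + 10" using a by simp
    moreover have "f' 3 + 2 * k < f' 0 \<longrightarrow> f' 8 = 5 * k + 5"
      using a cond[OF i] i unfolding s by (auto simp: kernel_inv_def)
    ultimately show "t \<le> kernel_potential f + 10 \<and>
      (\<exists>f' g'. s' = mkst f' g' h q \<and> kernel_inv X Y f' g' \<and> (f' 3 + 2 * k < f' 0 \<longrightarrow> f' 8 = 5 * k + 5))"
      using s i by blast
  qed
qed

end


section \<open>The banded dynamic program\<close>

definition rmin :: "nat \<Rightarrow> rexp \<Rightarrow> com" where
  "rmin d e = Cond (RLess e (RVar d)) (RAssign d e) Skip"

lemma exact_WAssign:
  "wp W w (WAssign x e) (\<lambda>t s'. t \<le> 1 + wtime e \<and> s' = s\<lparr>wvar := (wvar s)(x := wval W s e)\<rparr>) s"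
  by (simp add: wp_WAssign)

lemma exact_RAssign:
  "wp W w (RAssign x e) (\<lambda>t s'. t \<le> 1 + rtime e \<and> s' = s\<lparr>rvar := (rvar s)(x := rval W w s e)\<rparr>) s"
  by (simp add: wp_RAssign)

lemma exact_RStore:
  "wp W w (RStore a i e) (\<lambda>t s'. t \<le> 1 + wtime i + rtime e \<and>
     s' = s\<lparr>rarr := (rarr s)(a := (rarr s a)(wval W s i := rval W w s e))\<rparr>) s"
  by (simp add: wp_RStore)

lemma exact_rmin:
  "wp W w (rmin d e) (\<lambda>t s'. t \<le> 2 * rtime e + 4 \<and>
     s' = s\<lparr>rvar := (rvar s)(d := min (rval W w s e) (rvar s d))\<rparr>) s"
  by (simp add: rmin_def wp_Cond wp_RAssign wp_Skip min_def)

lemmas exact = wp_Seq_exact exact_WAssign exact_RAssign exact_RStore exact_rmin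

text \<open>One array holds the current row and is overwritten in place. Before a cell is replaced,
  its old value is saved in real variable 4 as the diagonal neighbour of the next cell.\<close>

definition dp_cell :: com where
  "dp_cell = Seq (RAssign 5 (RVar 1))
     (Seq (rmin 5 (RAdd (RVar 4) (RWeight (Some (WArr 2 (WVar 30))) (Some (WArr 3 (WVar 31))))))
     (Seq (rmin 5 (RAdd (RArr 0 (WOp Add (WVar 31) (WConst 1))) (RWeight (Some (WArr 2 (WVar 30))) None)))
     (Seq (rmin 5 (RAdd (RVar 3) (RWeight None (Some (WArr 3 (WVar 31))))))
     (Seq (RAssign 4 (RArr 0 (WOp Add (WVar 31) (WConst 1)))) (Seq (RAssign 3 (RVar 5))
     (Seq (WAssign 31 (WOp Add (WVar 31) (WConst 1))) (RStore 0 (WVar 31) (RVar 5))))))))"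

text \<open>For row \<open>i + 1\<close> with \<open>i < k\<close>, the band contains column 0,
  which is computed here. Otherwise the row starts at column \<open>i - k\<close>, just left of its
  band, and the left neighbour is the cap \<open>k + 1\<close>.\<close>

definition dp_row_start :: com where
  "dp_row_start = Seq (WAssign 32 (WOp Add (WOp Add (WVar 30) (WConst 1)) (WVar 2))) (Seq (RAssign 3 (RVar 1))
     (Cond (WLess (WVar 30) (WVar 2))
       (Seq (WAssign 31 (WConst 0)) (Seq (RAssign 4 (RArr 0 (WVar 31)))
         (Seq (rmin 3 (RAdd (RVar 4) (RWeight (Some (WArr 2 (WVar 30))) None))) (RStore 0 (WVar 31) (RVar 3)))))
       (Seq (WAssign 31 (WOp Sub (WVar 30) (WVar 2))) (RAssign 4 (RArr 0 (WVar 31))))))"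

definition dp_row :: com where
  "dp_row = Seq dp_row_start (Seq (While (BAnd (WLess (WVar 31) (WVar 7)) (WLess (WVar 31) (WVar 32))) dp_cell)
     (WAssign 30 (WOp Add (WVar 30) (WConst 1))))"

definition dp_first_cell :: com where
  "dp_first_cell = Seq (RAssign 5 (RVar 1))
     (Seq (rmin 5 (RAdd (RArr 0 (WVar 31)) (RWeight None (Some (WArr 3 (WVar 31))))))
     (Seq (WAssign 31 (WOp Add (WVar 31) (WConst 1))) (RStore 0 (WVar 31) (RVar 5))))"

text \<open>Words cannot be converted into reals, so \<open>k\<close> is built by adding 1
  repeatedly.\<close>

definition dp_cap :: com where
  "dp_cap = Seq (WAssign 30 (WConst 0)) (Seq (WAssign 31 (WConst 0))
     (Seq (While (WLess (WVar 31) (WVar 2)) (Seq (RAssign 2 (RAdd (RVar 2) ROne))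
       (WAssign 31 (WOp Add (WVar 31) (WConst 1)))))
     (Seq (RAssign 1 (RAdd (RVar 2) ROne)) (WAssign 31 (WConst 0)))))"

definition dp_prog :: com where
  "dp_prog = Seq dp_cap (Seq (While (WLess (WVar 31) (WVar 7)) dp_first_cell)
     (Seq (While (WLess (WVar 30) (WVar 6)) dp_row)
     (Seq (RAssign 0 (RArr 0 (WVar 7)))
       (Cond (RLess (RVar 2) (RVar 0)) (WAssign 0 (WConst 0)) (WAssign 0 (WConst 1))))))"

context kernel
begin

text \<open>Capping at \<open>k + 1\<close> keeps every value up to \<open>k\<close> and turns all
  cells outside the band into one constant.\<close>

definition capped :: "nat list \<Rightarrow> nat list \<Rightarrow> nat \<Rightarrow> nat \<Rightarrow> real" where
  "capped X Y i j = min (dp w X Y i j) (real k + 1)"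

text \<open>Weights are nonnegative, so capping the neighbours first does not change the capped
  minimum. The order of the terms follows the \<open>rmin\<close> commands of the program.\<close>

lemma capped_simps:
  "capped X Y 0 0 = 0"
  "capped X Y (Suc i) 0 = min (capped X Y i 0 + w (Some (X ! i)) None) (real k + 1)"
  "capped X Y 0 (Suc j) = min (capped X Y 0 j + w None (Some (Y ! j))) (real k + 1)"
  "capped X Y (Suc i) (Suc j) = min (capped X Y (Suc i) j + w None (Some (Y ! j)))
     (min (capped X Y i (Suc j) + w (Some (X ! i)) None)
       (min (capped X Y i j + w (Some (X ! i)) (Some (Y ! j))) (real k + 1)))"
  using w_nonneg[of "Some (X ! i)" None] w_nonneg[of None "Some (Y ! j)"]
    w_nonneg[of "Some (X ! i)" "Some (Y ! j)"]
  by (auto simp: capped_def min_def)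

lemma capped_outside:
  assumes "i \<le> length X" "j \<le> length Y" "i + k < j \<or> j + k < i"
  shows "capped X Y i j = real k + 1"
proof -
  have "real k + 1 \<le> dp w X Y i j"
    using length_diff_le_dp[OF assms(1,2)] assms(3) by auto
  then show ?thesis by (simp add: capped_def)
qed

definition agrees :: "nat list \<Rightarrow> nat list \<Rightarrow> bool" where
  "agrees X Y \<longleftrightarrow> (\<forall>a \<in> ext_alphabet (set X \<union> set Y). \<forall>b \<in> ext_alphabet (set X \<union> set Y). v a b = w a b)"

lemma agrees_letters:
  assumes "agrees X Y"
  shows "i < length X \<Longrightarrow> v (Some (X ! i)) None = w (Some (X ! i)) None"
    "j < length Y \<Longrightarrow> v None (Some (Y ! j)) = w None (Some (Y ! j))"
    "i < length X \<Longrightarrow> j < length Y \<Longrightarrow> v (Some (X ! i)) (Some (Y ! j)) = w (Some (X ! i)) (Some (Y ! j))"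
  using assms by (auto simp: agrees_def ext_alphabet_def)

definition dp_state :: "nat list \<Rightarrow> nat list \<Rightarrow> (nat \<Rightarrow> nat) \<Rightarrow> (nat \<Rightarrow> nat \<Rightarrow> nat) \<Rightarrow> (nat \<Rightarrow> real) \<Rightarrow> bool" where
  "dp_state X Y f g h \<longleftrightarrow> f 2 = k \<and> f 6 = length X \<and> f 7 = length Y \<and> length X \<le> n \<and> length Y \<le> n \<and>
     slice (g 2) 0 (f 6) = X \<and> slice (g 3) 0 (f 7) = Y \<and> agrees X Y \<and> h 1 = real k + 1 \<and> h 2 = real k"

lemma dp_state_letters:
  assumes "dp_state X Y f g h"
  shows "i < length X \<Longrightarrow> g 2 i = X ! i" "j < length Y \<Longrightarrow> g 3 j = Y ! j"
proof -
  have X: "slice (g 2) 0 (length X) = X" and Y: "slice (g 3) 0 (length Y) = Y"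
    using assms unfolding dp_state_def by metis+
  show "g 2 i = X ! i" if "i < length X"
    using nth_slice[of i "length X" 0 "g 2"] that unfolding X by simp
  show "g 3 j = Y ! j" if "j < length Y"
    using nth_slice[of j "length Y" 0 "g 3"] that unfolding Y by simp
qed

lemma dp_state_upd:
  "dp_state X Y f g h \<Longrightarrow> f' 2 = f 2 \<Longrightarrow> f' 6 = f 6 \<Longrightarrow> f' 7 = f 7 \<Longrightarrow> h' 1 = h 1 \<Longrightarrow> h' 2 = h 2 \<Longrightarrow>
    dp_state X Y f' g h'"
  unfolding dp_state_def by metis

text \<open>The array is split at column \<open>m\<close>: row \<open>i + 1\<close> up to
  \<open>m\<close>, row \<open>i\<close> behind it. Left of the band of row \<open>i + 1\<close> the
  entries are stale and nothing is claimed.\<close>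

definition row_inv :: "nat list \<Rightarrow> nat list \<Rightarrow> nat \<Rightarrow> nat \<Rightarrow> (nat \<Rightarrow> real) \<Rightarrow> (nat \<Rightarrow> real) \<Rightarrow> bool" where
  "row_inv X Y i m h A \<longleftrightarrow> i \<le> m + k \<and> m \<le> i + 1 + k \<and> m \<le> length Y \<and>
     (\<forall>j \<le> length Y. m < j \<longrightarrow> A j = capped X Y i j) \<and>
     (\<forall>j \<le> m. i + 1 \<le> j + k \<longrightarrow> A j = capped X Y (i + 1) j) \<and>
     h 3 = capped X Y (i + 1) m \<and> h 4 = capped X Y i m"

lemma wp_dp_cell:
  assumes s: "dp_state X Y f g h" and i: "f 30 < length X" and m: "f 31 < length Y" "f 31 < f 30 + 1 + k"
    and inv: "row_inv X Y (f 30) (f 31) h (q 0)"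
  shows "wp W v dp_cell (\<lambda>t s'. t \<le> 80 \<and> (\<exists>h' q'. s' = mkst (f(31 := f 31 + 1)) g h' q' \<and>
     dp_state X Y (f(31 := f 31 + 1)) g h' \<and> row_inv X Y (f 30) (f 31 + 1) h' (q' 0))) (mkst f g h q)"
proof -
  have W: "f 31 + 1 < 2 ^ W" using s m word_bounds by (simp add: dp_state_def)
  let ?i = "f 30" and ?m = "f 31"
  define x where "x = capped X Y (?i + 1) (?m + 1)"
  define h' where "h' = h(5 := x, 4 := q 0 (?m + 1), 3 := x)"
  define q' where "q' = q(0 := (q 0)(?m + 1 := x))"
  have I: "q 0 (?m + 1) = capped X Y ?i (?m + 1)" "h 3 = capped X Y (?i + 1) ?m" "h 4 = capped X Y ?i ?m"
    using inv m by (simp_all add: row_inv_def)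
  have ag: "agrees X Y" and h1: "h 1 = real k + 1" using s by (simp_all add: dp_state_def)
  have x: "x = min (h 3 + v None (Some (g 3 ?m))) (min (q 0 (?m + 1) + v (Some (g 2 ?i)) None)
      (min (h 4 + v (Some (g 2 ?i)) (Some (g 3 ?m))) (h 1)))"
    using dp_state_letters[OF s] agrees_letters[OF ag] i m
    unfolding x_def h1 by (simp add: capped_simps(4)[unfolded Suc_eq_plus1] I)
  have "dp_state X Y (f(31 := f 31 + 1)) g h'" using s by (rule dp_state_upd) (simp_all add: h'_def)
  moreover have "row_inv X Y ?i (?m + 1) h' (q' 0)"
    using inv m(1,2) I(1) by (auto simp: row_inv_def h'_def q'_def x_def le_Suc_eq)
  moreover have exact_cell: "wp W v dp_cell (\<lambda>t s'. t \<le> 80 \<and> s' = mkst (f(31 := f 31 + 1)) g h' q') (mkst f g h q)"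
  proof -
    define y1 where "y1 = min (h 4 + v (Some (g 2 ?i)) (Some (g 3 ?m))) (h 1)"
    define y2 where "y2 = min (q 0 (?m + 1) + v (Some (g 2 ?i)) None) y1"
    have xy: "min (h 3 + v None (Some (g 3 ?m))) y2 = x" unfolding x y1_def y2_def ..
    have 1: "wp W v (RAssign 5 (RVar 1)) (\<lambda>t s'. t \<le> 2 \<and> s' = mkst f g (h(5 := h 1)) q) (mkst f g h q)"
      by (simp add: wp_RAssign)
    have 2: "wp W v (rmin 5 (RAdd (RVar 4) (RWeight (Some (WArr 2 (WVar 30))) (Some (WArr 3 (WVar 31))))))
        (\<lambda>t s'. t \<le> 18 \<and> s' = mkst f g (h(5 := y1)) q) (mkst f g (h(5 := h 1)) q)"
      by (rule wp_conseq[OF exact_rmin]) (simp add: y1_def)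
    have 3: "wp W v (rmin 5 (RAdd (RArr 0 (WOp Add (WVar 31) (WConst 1))) (RWeight (Some (WArr 2 (WVar 30))) None)))
        (\<lambda>t s'. t \<le> 22 \<and> s' = mkst f g (h(5 := y2)) q) (mkst f g (h(5 := y1)) q)"
      by (rule wp_conseq[OF exact_rmin]) (use W in \<open>simp add: y2_def\<close>)
    have 4: "wp W v (rmin 5 (RAdd (RVar 3) (RWeight None (Some (WArr 3 (WVar 31))))))
        (\<lambda>t s'. t \<le> 16 \<and> s' = mkst f g (h(5 := x)) q) (mkst f g (h(5 := y2)) q)"
      by (rule wp_conseq[OF exact_rmin]) (simp add: xy)
    have 5: "wp W v (RAssign 4 (RArr 0 (WOp Add (WVar 31) (WConst 1))))
        (\<lambda>t s'. t \<le> 5 \<and> s' = mkst f g (h(5 := x, 4 := q 0 (?m + 1))) q) (mkst f g (h(5 := x)) q)"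
      using W by (simp add: wp_RAssign)
    have 6: "wp W v (RAssign 3 (RVar 5)) (\<lambda>t s'. t \<le> 2 \<and> s' = mkst f g h' q)
        (mkst f g (h(5 := x, 4 := q 0 (?m + 1))) q)"
      by (simp add: wp_RAssign h'_def)
    have 7: "wp W v (WAssign 31 (WOp Add (WVar 31) (WConst 1)))
        (\<lambda>t s'. t \<le> 4 \<and> s' = mkst (f(31 := ?m + 1)) g h' q) (mkst f g h' q)"
      using W by (simp add: wp_WAssign)
    have 8: "wp W v (RStore 0 (WVar 31) (RVar 5))
        (\<lambda>t s'. t \<le> 3 \<and> s' = mkst (f(31 := ?m + 1)) g h' q') (mkst (f(31 := ?m + 1)) g h' q)"
      by (simp add: wp_RStore q'_def) (simp add: h'_def)
    show ?thesis unfolding dp_cell_def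
      by (rule wp_conseq[OF wp_Seq_exact[OF 1 wp_Seq_exact[OF 2 wp_Seq_exact[OF 3 wp_Seq_exact[OF 4
        wp_Seq_exact[OF 5 wp_Seq_exact[OF 6 wp_Seq_exact[OF 7 8]]]]]]]]) simp
  qed
  ultimately show ?thesis
    by - (rule wp_conseq[OF exact_cell], blast)
qed

definition row_done :: "nat list \<Rightarrow> nat list \<Rightarrow> nat \<Rightarrow> (nat \<Rightarrow> real) \<Rightarrow> bool" where
  "row_done X Y i A \<longleftrightarrow> (\<forall>j \<le> length Y. i \<le> j + k \<longrightarrow> A j = capped X Y i j)"

lemma wp_dp_row_start:
  assumes s: "dp_state X Y f g h" and i: "f 30 < length X" and len: "length X \<le> length Y + k"
    and row: "row_done X Y (f 30) (q 0)"
  shows "wp W v dp_row_start (\<lambda>t s'. t \<le> 60 \<and> (\<exists>f' h' q'. s' = mkst f' g h' q' \<and> dp_state X Y f' g h' \<and>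
     f' 30 = f 30 \<and> f' 32 = f 30 + 1 + k \<and> row_inv X Y (f 30) (f' 31) h' (q' 0))) (mkst f g h q)"
proof -
  let ?i = "f 30"
  have f: "f 2 = k" "length X \<le> n" "length Y \<le> n" and ag: "agrees X Y" and h1: "h 1 = real k + 1"
    using s by (simp_all add: dp_state_def)
  have W: "?i + 1 + k < 2 ^ W" "?i < 2 ^ W" "?i + 1 < 2 ^ W" using f i word_bounds by linarith+
  define P where "P s' \<longleftrightarrow> (\<exists>f' h' q'. s' = mkst f' g h' q' \<and> dp_state X Y f' g h' \<and>
     f' 30 = f 30 \<and> f' 32 = f 30 + 1 + k \<and> row_inv X Y (f 30) (f' 31) h' (q' 0))" for s'
  have "wp W v dp_row_start (\<lambda>t s'. t \<le> 60 \<and> P s') (mkst f g h q)"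
  proof (cases "?i < k")
    case True
    define x where "x = capped X Y (?i + 1) 0"
    define f' where "f' = f(32 := ?i + 1 + k, 31 := 0)"
    define h' where "h' = h(3 := x, 4 := q 0 0)"
    define q' where "q' = q(0 := (q 0)(0 := x))"
    have q0: "q 0 0 = capped X Y ?i 0" using row True by (simp add: row_done_def)
    have x: "x = min (q 0 0 + v (Some (g 2 ?i)) None) (h 1)"
      using dp_state_letters(1)[OF s i] agrees_letters(1)[OF ag i]
      unfolding x_def h1 by (simp add: capped_simps(2)[unfolded Suc_eq_plus1] q0)
    have "dp_state X Y f' g h'" using s by (rule dp_state_upd) (simp_all add: f'_def h'_def)
    moreover have "row_inv X Y ?i 0 h' (q' 0)"
      using row True q0 by (simp add: row_inv_def row_done_def h'_def q'_def x_def)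
    ultimately have "P (mkst f' g h' q')"
      unfolding P_def by (intro exI[of _ f'] exI[of _ h'] exI[of _ q']) (simp add: f'_def)
    moreover have "wp W v dp_row_start (\<lambda>t s'. t \<le> 60 \<and> s' = mkst f' g h' q') (mkst f g h q)"
    proof -
      have b: "bval W v (mkst (f(32 := ?i + 1 + k)) g (h(3 := h 1)) q) (WLess (WVar 30) (WVar 2))"
        using True f by simp
      have A: "wp W v (Seq (WAssign 31 (WConst 0)) (Seq (RAssign 4 (RArr 0 (WVar 31)))
         (Seq (rmin 3 (RAdd (RVar 4) (RWeight (Some (WArr 2 (WVar 30))) None))) (RStore 0 (WVar 31) (RVar 3)))))
         (\<lambda>t s'. t \<le> 40 \<and> s' = mkst f' g h' q') (mkst (f(32 := ?i + 1 + k)) g (h(3 := h 1)) q)"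
        apply (rule wp_conseq, (rule exact)+)
        using W by (auto simp: f'_def h'_def q'_def simp flip: x)
      have C: "wp W v (Cond (WLess (WVar 30) (WVar 2)) (Seq (WAssign 31 (WConst 0)) (Seq (RAssign 4 (RArr 0 (WVar 31)))
         (Seq (rmin 3 (RAdd (RVar 4) (RWeight (Some (WArr 2 (WVar 30))) None))) (RStore 0 (WVar 31) (RVar 3)))))
         (Seq (WAssign 31 (WOp Sub (WVar 30) (WVar 2))) (RAssign 4 (RArr 0 (WVar 31)))))
         (\<lambda>t s'. t \<le> 44 \<and> s' = mkst f' g h' q') (mkst (f(32 := ?i + 1 + k)) g (h(3 := h 1)) q)"
        unfolding wp_Cond if_P[OF b] by (rule wp_conseq[OF A]) simp
      have 1: "wp W v (WAssign 32 (WOp Add (WOp Add (WVar 30) (WConst 1)) (WVar 2)))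
         (\<lambda>t s'. t \<le> 6 \<and> s' = mkst (f(32 := ?i + 1 + k)) g h q) (mkst f g h q)"
        using W f by (simp add: wp_WAssign)
      have 2: "wp W v (RAssign 3 (RVar 1)) (\<lambda>t s'. t \<le> 2 \<and> s' = mkst (f(32 := ?i + 1 + k)) g (h(3 := h 1)) q)
         (mkst (f(32 := ?i + 1 + k)) g h q)" by (simp add: wp_RAssign)
      show ?thesis unfolding dp_row_start_def
        by (rule wp_conseq[OF wp_Seq_exact[OF 1 wp_Seq_exact[OF 2 C]]]) simp
    qed
    ultimately show ?thesis by (elim wp_conseq) simp
  next
    case False
    define f' where "f' = f(32 := ?i + 1 + k, 31 := ?i - k)"
    define h' where "h' = h(3 := h 1, 4 := q 0 (?i - k))"
    have m: "?i - k \<le> length Y" using i len by linarith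
    have q0: "q 0 (?i - k) = capped X Y ?i (?i - k)" using row m by (simp add: row_done_def)
    \<comment> \<open>Column \<open>i - k\<close> lies one diagonal outside the band of row
      \<open>i + 1\<close>.\<close>
    have K: "capped X Y (?i + 1) (?i - k) = h 1" unfolding h1 using m i False by (intro capped_outside) simp_all
    have "dp_state X Y f' g h'" using s by (rule dp_state_upd) (simp_all add: f'_def h'_def)
    moreover have "row_inv X Y ?i (?i - k) h' (q 0)"
      using row False q0 K m by (auto simp: row_inv_def row_done_def h'_def)
    ultimately have "P (mkst f' g h' q)"
      unfolding P_def by (intro exI[of _ f'] exI[of _ h'] exI[of _ q]) (simp add: f'_def)
    moreover have "wp W v dp_row_start (\<lambda>t s'. t \<le> 60 \<and> s' = mkst f' g h' q) (mkst f g h q)"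
    proof -
      have b: "\<not> bval W v (mkst (f(32 := ?i + 1 + k)) g (h(3 := h 1)) q) (WLess (WVar 30) (WVar 2))"
        using False f by simp
      have A: "wp W v (Seq (WAssign 31 (WOp Sub (WVar 30) (WVar 2))) (RAssign 4 (RArr 0 (WVar 31))))
         (\<lambda>t s'. t \<le> 40 \<and> s' = mkst f' g h' q) (mkst (f(32 := ?i + 1 + k)) g (h(3 := h 1)) q)"
        apply (rule wp_conseq, (rule exact)+)
        using W False f by (simp add: f'_def h'_def sub_mod_word sub_mod_word')
      have C: "wp W v (Cond (WLess (WVar 30) (WVar 2)) (Seq (WAssign 31 (WConst 0)) (Seq (RAssign 4 (RArr 0 (WVar 31)))
         (Seq (rmin 3 (RAdd (RVar 4) (RWeight (Some (WArr 2 (WVar 30))) None))) (RStore 0 (WVar 31) (RVar 3)))))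
         (Seq (WAssign 31 (WOp Sub (WVar 30) (WVar 2))) (RAssign 4 (RArr 0 (WVar 31)))))
         (\<lambda>t s'. t \<le> 44 \<and> s' = mkst f' g h' q) (mkst (f(32 := ?i + 1 + k)) g (h(3 := h 1)) q)"
        unfolding wp_Cond if_not_P[OF b] by (rule wp_conseq[OF A]) simp
      have 1: "wp W v (WAssign 32 (WOp Add (WOp Add (WVar 30) (WConst 1)) (WVar 2)))
         (\<lambda>t s'. t \<le> 6 \<and> s' = mkst (f(32 := ?i + 1 + k)) g h q) (mkst f g h q)"
        using W f by (simp add: wp_WAssign)
      have 2: "wp W v (RAssign 3 (RVar 1)) (\<lambda>t s'. t \<le> 2 \<and> s' = mkst (f(32 := ?i + 1 + k)) g (h(3 := h 1)) q)
         (mkst (f(32 := ?i + 1 + k)) g h q)" by (simp add: wp_RAssign)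
      show ?thesis unfolding dp_row_start_def
        by (rule wp_conseq[OF wp_Seq_exact[OF 1 wp_Seq_exact[OF 2 C]]]) simp
    qed
    ultimately show ?thesis by (elim wp_conseq) simp
  qed
  then show ?thesis unfolding P_def .
qed

lemma wp_dp_row:
  assumes s: "dp_state X Y f g h" and i: "f 30 < length X" and len: "length X \<le> length Y + k"
    and row: "row_done X Y (f 30) (q 0)"
  shows "wp W v dp_row (\<lambda>t s'. t \<le> 200 * k + 200 \<and> (\<exists>f' h' q'. s' = mkst f' g h' q' \<and> dp_state X Y f' g h' \<and>
     f' 30 = f 30 + 1 \<and> row_done X Y (f 30 + 1) (q' 0))) (mkst f g h q)"
proof -
  let ?i = "f 30" and ?hi = "f 30 + 1 + k"
  let ?b = "BAnd (WLess (WVar 31) (WVar 7)) (WLess (WVar 31) (WVar 32))"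
  have W: "?i + 1 < 2 ^ W" using s i word_bounds by (simp add: dp_state_def)
  define P where "P s' \<longleftrightarrow> (\<exists>f' h' q'. s' = mkst f' g h' q' \<and> dp_state X Y f' g h' \<and>
     f' 30 = ?i \<and> f' 32 = ?hi \<and> row_inv X Y ?i (f' 31) h' (q' 0))" for s'
  define R where "R s' \<longleftrightarrow> (\<exists>f' h' q'. s' = mkst f' g h' q' \<and> dp_state X Y f' g h' \<and>
     f' 30 = ?i \<and> row_done X Y (?i + 1) (q' 0))" for s'
  have 1: "wp W v dp_row_start (\<lambda>t s'. t \<le> 60 \<and> P s') (mkst f g h q)"
    unfolding P_def by (rule wp_dp_row_start) fact+
  have 2: "wp W v (While ?b dp_cell) (\<lambda>t s'. t \<le> 200 * k + 108 \<and> R s') s1" if P: "P s1" for s1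
  proof -
    have "wp W v (While ?b dp_cell) (\<lambda>t s'. P s' \<and> \<not> bval W v s' ?b \<and>
       t + 100 * (?hi - wvar s' 31) \<le> 100 * (?hi - wvar s1 31) + 1 + btime ?b) s1"
    proof (rule wp_While)
      fix s :: state assume "P s" and b: "bval W v s ?b"
      then obtain f' h' q' where st: "s = mkst f' g h' q'" and S: "dp_state X Y f' g h'" "f' 30 = ?i" "f' 32 = ?hi"
        "row_inv X Y ?i (f' 31) h' (q' 0)" unfolding P_def by blast
      have m: "f' 31 < length Y" "f' 31 < ?hi" using b S unfolding st by (auto simp: dp_state_def)
      show "wp W v dp_cell (\<lambda>t s'. P s' \<and> t + 1 + btime ?b + 100 * (?hi - wvar s' 31) \<le> 100 * (?hi - wvar s 31)) s"
        unfolding st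
      proof (rule wp_conseq[OF wp_dp_cell[OF S(1)]])
        show "f' 30 < length X" "f' 31 < length Y" "f' 31 < f' 30 + 1 + k" "row_inv X Y (f' 30) (f' 31) h' (q' 0)"
          using i m S by simp_all
        fix t :: nat and s' assume a: "t \<le> 80 \<and> (\<exists>h' q'. s' = mkst (f'(31 := f' 31 + 1)) g h' q' \<and>
          dp_state X Y (f'(31 := f' 31 + 1)) g h' \<and> row_inv X Y (f' 30) (f' 31 + 1) h' (q' 0))"
        then have "P s'" unfolding P_def using S(2,3) by fastforce
        moreover have "wvar s' 31 = f' 31 + 1" using a by auto
        then have d: "?hi - f' 31 = (?hi - wvar s' 31) + 1" using m(2) by linarith
        have "t + 8 + 100 * (?hi - wvar s' 31) \<le> 100 * (?hi - f' 31)" unfolding d using a by simp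
        ultimately show "P s' \<and> t + 1 + btime ?b + 100 * (?hi - wvar s' 31)
            \<le> 100 * (?hi - wvar (mkst f' g h' q') 31)" by simp
      qed
    qed (rule P)
    then show ?thesis
    proof (rule wp_conseq)
      fix t :: nat and s' :: state assume a: "P s' \<and> \<not> bval W v s' ?b \<and>
         t + 100 * (?hi - wvar s' 31) \<le> 100 * (?hi - wvar s1 31) + 1 + btime ?b"
      then obtain f' h' q' where st: "s' = mkst f' g h' q'" and S: "dp_state X Y f' g h'" "f' 30 = ?i" "f' 32 = ?hi"
        "row_inv X Y ?i (f' 31) h' (q' 0)" unfolding P_def by blast
      have stop: "\<not> (f' 31 < length Y \<and> f' 31 < ?hi)" using a S unfolding st by (auto simp: dp_state_def)
      have "row_done X Y (?i + 1) (q' 0)" unfolding row_done_def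
      proof (intro allI impI)
        fix j assume j: "j \<le> length Y" "?i + 1 \<le> j + k"
        show "q' 0 j = capped X Y (?i + 1) j"
        proof (cases "j \<le> f' 31")
          case True
          then show ?thesis using S(4) j by (simp add: row_inv_def)
        next
          case False
          \<comment> \<open>Column \<open>j\<close> lies right of the band in both rows, so the
            unchanged entry, the cap, is valid for the new row too.\<close>
          then have "q' 0 j = capped X Y ?i j" "?hi < j" using S(4) j stop by (auto simp: row_inv_def)
          then show ?thesis using capped_outside[of ?i X j Y] capped_outside[of "?i + 1" X j Y] i j by simp
        qed
      qed
      then have "R s'" unfolding R_def using st S by blast
      have "?i \<le> wvar s1 31 + k" using P by (auto simp: P_def row_inv_def)
      then have "?hi - wvar s1 31 \<le> 2 * k + 1" by linarith
      moreover have "t \<le> 100 * (?hi - wvar s1 31) + 8" using a by simp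
      ultimately have "t \<le> 200 * k + 108" by linarith
      then show "t \<le> 200 * k + 108 \<and> R s'" using \<open>R s'\<close> by blast
    qed
  qed
  have 3: "wp W v (WAssign 30 (WOp Add (WVar 30) (WConst 1))) (\<lambda>t s'. t \<le> 4 \<and>
     (\<exists>f' h' q'. s' = mkst f' g h' q' \<and> dp_state X Y f' g h' \<and>
     f' 30 = f 30 + 1 \<and> row_done X Y (f 30 + 1) (q' 0))) s1" if "R s1" for s1
  proof -
    from that obtain f' h' q' where st: "s1 = mkst f' g h' q'" and S: "dp_state X Y f' g h'" "f' 30 = ?i"
      "row_done X Y (?i + 1) (q' 0)" unfolding R_def by blast
    have "dp_state X Y (f'(30 := ?i + 1)) g h'" using S(1) by (rule dp_state_upd) simp_all
    then show ?thesis unfolding st using S W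
      by (simp add: wp_WAssign)
  qed
  show ?thesis unfolding dp_row_def
    by (rule wp_conseq[OF wp_Seq_le[OF 1 wp_Seq_le[OF 2 3]]]) auto
qed

lemma wp_dp_cap:
  assumes "f 2 = k" "h 2 = 0"
  shows "wp W v dp_cap (\<lambda>t s'. t \<le> 20 * k + 30 \<and> s' = mkst (f(30 := 0, 31 := 0)) g (h(2 := real k, 1 := real k + 1)) q)
    (mkst f g h q)"
proof -
  let ?body = "Seq (RAssign 2 (RAdd (RVar 2) ROne)) (WAssign 31 (WOp Add (WVar 31) (WConst 1)))"
  let ?b = "WLess (WVar 31) (WVar 2)"
  define st where "st c = mkst (f(30 := 0, 31 := c)) g (h(2 := real c)) q" for c
  define I where "I s \<longleftrightarrow> (\<exists>c \<le> k. s = st c)" for s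
  have W: "k + 1 < 2 ^ W" using word_bounds by linarith
  have 1: "wp W v (WAssign 30 (WConst 0)) (\<lambda>t s'. t \<le> 2 \<and> s' = mkst (f(30 := 0)) g h q) (mkst f g h q)"
    by (simp add: wp_WAssign)
  have 2: "wp W v (WAssign 31 (WConst 0)) (\<lambda>t s'. t \<le> 2 \<and> s' = st 0) (mkst (f(30 := 0)) g h q)"
    using assms(2) by (simp add: wp_WAssign st_def fun_upd_idem)
  have 3: "wp W v (While ?b ?body) (\<lambda>t s'. t \<le> 20 * k + 4 \<and> s' = st k) (st 0)"
  proof -
    have "wp W v (While ?b ?body) (\<lambda>t s'. I s' \<and> \<not> bval W v s' ?b \<and>
       t + 20 * (k - wvar s' 31) \<le> 20 * (k - wvar (st 0) 31) + 1 + btime ?b) (st 0)"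
    proof (rule wp_While)
      show "I (st 0)" unfolding I_def by blast
      fix s assume "I s" and b: "bval W v s ?b"
      then obtain c where c: "c \<le> k" "s = st c" unfolding I_def by blast
      have lt: "c < k" using b c assms(1) by (simp add: st_def)
      have ov: "c + 1 < 2 ^ W" using lt W by linarith
      have d: "k - c = (k - (c + 1)) + 1" using lt by linarith
      have "wp W v ?body (\<lambda>t s'. t = 8 \<and> s' = st (c + 1)) s"
        unfolding c(2) using ov by (simp add: wp_Seq wp_RAssign wp_WAssign st_def add.commute)
      then show "wp W v ?body (\<lambda>t s'. I s' \<and> t + 1 + btime ?b + 20 * (k - wvar s' 31) \<le> 20 * (k - wvar s 31)) s"
      proof (rule wp_conseq)
        fix t :: nat and s' :: state assume a: "t = 8 \<and> s' = st (c + 1)"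
        have "I s'" unfolding I_def using a lt by (intro exI[of _ "c + 1"]) simp
        moreover have v31: "wvar s' 31 = c + 1" "wvar s 31 = c" using a c(2) by (simp_all add: st_def)
        ultimately show "I s' \<and> t + 1 + btime ?b + 20 * (k - wvar s' 31) \<le> 20 * (k - wvar s 31)"
          unfolding v31 d using a by simp
      qed
    qed
    then show ?thesis
    proof (rule wp_conseq)
      fix t :: nat and s' :: state assume a: "I s' \<and> \<not> bval W v s' ?b \<and>
       t + 20 * (k - wvar s' 31) \<le> 20 * (k - wvar (st 0) 31) + 1 + btime ?b"
      then obtain c where c: "c \<le> k" "s' = st c" unfolding I_def by blast
      then have "c = k" using a assms(1) by (simp add: st_def)
      then show "t \<le> 20 * k + 4 \<and> s' = st k" using a c by (simp add: st_def)
    qed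
  qed
  have 4: "wp W v (RAssign 1 (RAdd (RVar 2) ROne)) (\<lambda>t s'. t \<le> 4 \<and>
     s' = mkst (f(30 := 0, 31 := k)) g (h(2 := real k, 1 := real k + 1)) q) (st k)"
    by (simp add: wp_RAssign st_def)
  have 5: "wp W v (WAssign 31 (WConst 0)) (\<lambda>t s'. t \<le> 2 \<and>
     s' = mkst (f(30 := 0, 31 := 0)) g (h(2 := real k, 1 := real k + 1)) q)
     (mkst (f(30 := 0, 31 := k)) g (h(2 := real k, 1 := real k + 1)) q)"
    by (simp add: wp_WAssign)
  show ?thesis unfolding dp_cap_def
    by (rule wp_conseq[OF wp_Seq_exact[OF 1 wp_Seq_exact[OF 2 wp_Seq_exact[OF 3 wp_Seq_exact[OF 4 5]]]]]) simp
qed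

text \<open>The whole first row is filled, not only its band, so that entries right of the band
  already hold the cap when later rows read them.\<close>

lemma wp_dp_first_row:
  assumes s: "dp_state X Y f g h" and "f 31 = 0" and "q 0 0 = 0"
  shows "wp W v (While (WLess (WVar 31) (WVar 7)) dp_first_cell) (\<lambda>t s'. t \<le> 60 * length Y + 4 \<and>
     (\<exists>f' h' q'. s' = mkst f' g h' q' \<and> dp_state X Y f' g h' \<and> f' 30 = f 30 \<and> row_done X Y 0 (q' 0))) (mkst f g h q)"
proof -
  let ?b = "WLess (WVar 31) (WVar 7)"
  define I where "I s \<longleftrightarrow> (\<exists>f' h' q'. s = mkst f' g h' q' \<and> dp_state X Y f' g h' \<and> f' 30 = f 30 \<and> f' 31 \<le> length Y \<and>
     (\<forall>j \<le> f' 31. q' 0 j = capped X Y 0 j))" for s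
  have "wp W v (While ?b dp_first_cell) (\<lambda>t s'. I s' \<and> \<not> bval W v s' ?b \<and>
     t + 60 * (length Y - wvar s' 31) \<le> 60 * (length Y - wvar (mkst f g h q) 31) + 1 + btime ?b) (mkst f g h q)"
  proof (rule wp_While)
    show "I (mkst f g h q)" unfolding I_def
      using s assms(2,3) by (intro exI[of _ f] exI[of _ h] exI[of _ q]) (simp add: capped_simps(1))
    fix s assume "I s" and b: "bval W v s ?b"
    then obtain f' h' q' where st: "s = mkst f' g h' q'" and S: "dp_state X Y f' g h'" "f' 30 = f 30"
      and le: "f' 31 \<le> length Y" and q': "\<forall>j \<le> f' 31. q' 0 j = capped X Y 0 j" unfolding I_def by blast
    let ?m = "f' 31"
    have lt: "?m < length Y" using b S(1) unfolding st by (simp add: dp_state_def)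
    have W: "?m + 1 < 2 ^ W" using lt S(1) word_bounds by (simp add: dp_state_def)
    have d: "length Y - ?m = (length Y - (?m + 1)) + 1" using lt by linarith
    have ag: "agrees X Y" and h1: "h' 1 = real k + 1" using S(1) by (simp_all add: dp_state_def)
    define x where "x = capped X Y 0 (?m + 1)"
    have x: "min (q' 0 ?m + v None (Some (g 3 ?m))) (h' 1) = x"
      using dp_state_letters(2)[OF S(1) lt] agrees_letters(2)[OF ag lt] q'
      unfolding x_def h1 by (simp add: capped_simps(3)[unfolded Suc_eq_plus1])
    define f2 where "f2 = f'(31 := ?m + 1)"
    define h2 where "h2 = h'(5 := x)"
    define q2 where "q2 = q'(0 := (q' 0)(?m + 1 := x))"
    have 1: "wp W v (RAssign 5 (RVar 1)) (\<lambda>t s'. t \<le> 2 \<and> s' = mkst f' g (h'(5 := h' 1)) q') (mkst f' g h' q')"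
      by (simp add: wp_RAssign)
    have 2: "wp W v (rmin 5 (RAdd (RArr 0 (WVar 31)) (RWeight None (Some (WArr 3 (WVar 31))))))
        (\<lambda>t s'. t \<le> 18 \<and> s' = mkst f' g h2 q') (mkst f' g (h'(5 := h' 1)) q')"
      by (rule wp_conseq[OF exact_rmin]) (simp add: x h2_def)
    have 3: "wp W v (WAssign 31 (WOp Add (WVar 31) (WConst 1)))
        (\<lambda>t s'. t \<le> 4 \<and> s' = mkst f2 g h2 q') (mkst f' g h2 q')"
      using W by (simp add: wp_WAssign f2_def)
    have 4: "wp W v (RStore 0 (WVar 31) (RVar 5)) (\<lambda>t s'. t \<le> 3 \<and> s' = mkst f2 g h2 q2) (mkst f2 g h2 q')"
      by (simp add: wp_RStore q2_def) (simp add: h2_def f2_def)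
    have "wp W v dp_first_cell (\<lambda>t s'. t \<le> 27 \<and> s' = mkst f2 g h2 q2) s"
      unfolding dp_first_cell_def st
      by (rule wp_conseq[OF wp_Seq_exact[OF 1 wp_Seq_exact[OF 2 wp_Seq_exact[OF 3 4]]]]) simp
    then show "wp W v dp_first_cell (\<lambda>t s'. I s' \<and> t + 1 + btime ?b + 60 * (length Y - wvar s' 31)
        \<le> 60 * (length Y - wvar s 31)) s"
    proof (rule wp_conseq)
      fix t :: nat and s' :: state assume a: "t \<le> 27 \<and> s' = mkst f2 g h2 q2"
      have "dp_state X Y f2 g h2" using S(1) by (rule dp_state_upd) (simp_all add: f2_def h2_def)
      moreover have "f2 30 = f 30" "f2 31 \<le> length Y" using S(2) lt by (simp_all add: f2_def)
      moreover have "\<forall>j \<le> f2 31. q2 0 j = capped X Y 0 j"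
        using q' by (simp add: f2_def q2_def x_def le_Suc_eq flip: Suc_eq_plus1)
      ultimately have "I s'" unfolding I_def using a by blast
      moreover have v31: "wvar s' 31 = ?m + 1" "wvar s 31 = ?m" using a st by (simp_all add: f2_def)
      ultimately show "I s' \<and> t + 1 + btime ?b + 60 * (length Y - wvar s' 31) \<le> 60 * (length Y - wvar s 31)"
        unfolding v31 d using a by simp
    qed
  qed
  then show ?thesis
  proof (rule wp_conseq)
    fix t :: nat and s' :: state assume a: "I s' \<and> \<not> bval W v s' ?b \<and>
     t + 60 * (length Y - wvar s' 31) \<le> 60 * (length Y - wvar (mkst f g h q) 31) + 1 + btime ?b"
    then obtain f' h' q' where st: "s' = mkst f' g h' q'" and S: "dp_state X Y f' g h'" "f' 30 = f 30"
      and le: "f' 31 \<le> length Y" and q': "\<forall>j \<le> f' 31. q' 0 j = capped X Y 0 j" unfolding I_def by blast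
    have "f' 31 = length Y" using a le S(1) unfolding st by (simp add: dp_state_def)
    then have "row_done X Y 0 (q' 0)" using q' by (simp add: row_done_def)
    moreover have "t \<le> 60 * length Y + 4" using a assms(2) by simp
    ultimately show "t \<le> 60 * length Y + 4 \<and>
     (\<exists>f' h' q'. s' = mkst f' g h' q' \<and> dp_state X Y f' g h' \<and> f' 30 = f 30 \<and> row_done X Y 0 (q' 0))"
      using st S by blast
  qed
qed

lemma wp_dp_rows:
  assumes s: "dp_state X Y f g h" and "f 30 = 0" and len: "length X \<le> length Y + k"
    and row: "row_done X Y 0 (q 0)"
  shows "wp W v (While (WLess (WVar 30) (WVar 6)) dp_row) (\<lambda>t s'. t \<le> length X * (200 * k + 204) + 4 \<and>
     (\<exists>f' h' q'. s' = mkst f' g h' q' \<and> dp_state X Y f' g h' \<and> row_done X Y (length X) (q' 0))) (mkst f g h q)"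
proof -
  let ?b = "WLess (WVar 30) (WVar 6)"
  let ?c = "200 * k + 204"
  define I where "I s \<longleftrightarrow> (\<exists>f' h' q'. s = mkst f' g h' q' \<and> dp_state X Y f' g h' \<and> f' 30 \<le> length X \<and>
     row_done X Y (f' 30) (q' 0))" for s
  have "wp W v (While ?b dp_row) (\<lambda>t s'. I s' \<and> \<not> bval W v s' ?b \<and>
     t + (length X - wvar s' 30) * ?c \<le> (length X - wvar (mkst f g h q) 30) * ?c + 1 + btime ?b) (mkst f g h q)"
  proof (rule wp_While)
    show "I (mkst f g h q)" unfolding I_def using s assms(2) row by auto
    fix s assume "I s" and b: "bval W v s ?b"
    then obtain f' h' q' where st: "s = mkst f' g h' q'" and S: "dp_state X Y f' g h'"
      "row_done X Y (f' 30) (q' 0)" unfolding I_def by blast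
    have lt: "f' 30 < length X" using b S(1) unfolding st by (simp add: dp_state_def)
    have d: "length X - f' 30 = (length X - (f' 30 + 1)) + 1" using lt by linarith
    show "wp W v dp_row (\<lambda>t s'. I s' \<and> t + 1 + btime ?b + (length X - wvar s' 30) * ?c
        \<le> (length X - wvar s 30) * ?c) s"
      unfolding st
    proof (rule wp_conseq[OF wp_dp_row[of X Y f' g h' q', OF S(1) lt len S(2)]])
      fix t :: nat and s' :: state assume a: "t \<le> 200 * k + 200 \<and> (\<exists>f'' h'' q''. s' = mkst f'' g h'' q'' \<and> dp_state X Y f'' g h'' \<and>
        f'' 30 = f' 30 + 1 \<and> row_done X Y (f' 30 + 1) (q'' 0))"
      then obtain f'' h'' q'' where st': "s' = mkst f'' g h'' q''" "dp_state X Y f'' g h''"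
        "f'' 30 = f' 30 + 1" "row_done X Y (f'' 30) (q'' 0)" by auto
      moreover have "f'' 30 \<le> length X" using st'(3) lt by simp
      ultimately have "I s'" unfolding I_def by blast
      moreover have v30: "wvar s' 30 = f' 30 + 1" using st' by simp
      ultimately show "I s' \<and> t + 1 + btime ?b + (length X - wvar s' 30) * ?c
          \<le> (length X - wvar (mkst f' g h' q') 30) * ?c"
        unfolding v30 state.simps d using a by (simp add: add_mult_distrib)
    qed
  qed
  then show ?thesis
  proof (rule wp_conseq)
    fix t :: nat and s' :: state assume a: "I s' \<and> \<not> bval W v s' ?b \<and>
     t + (length X - wvar s' 30) * ?c \<le> (length X - wvar (mkst f g h q) 30) * ?c + 1 + btime ?b"
    then obtain f' h' q' where st: "s' = mkst f' g h' q'" and S: "dp_state X Y f' g h'"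
      "f' 30 \<le> length X" "row_done X Y (f' 30) (q' 0)" unfolding I_def by blast
    have "f' 30 = length X" using a S unfolding st by (simp add: dp_state_def)
    moreover have "t \<le> length X * ?c + 4"
      using a assms(2) by simp
    ultimately show "t \<le> length X * ?c + 4 \<and>
     (\<exists>f' h' q'. s' = mkst f' g h' q' \<and> dp_state X Y f' g h' \<and> row_done X Y (length X) (q' 0))"
      using st S by metis
  qed
qed

lemma wp_dp_prog:
  assumes f: "f 2 = k" "f 6 = length X" "f 7 = length Y" "length X \<le> n" "length Y \<le> n" "length X \<le> length Y + k"
    and g: "slice (g 2) 0 (f 6) = X" "slice (g 3) 0 (f 7) = Y" and ag: "agrees X Y" and "h 2 = 0" "q 0 0 = 0"
  shows "wp W v dp_prog (\<lambda>t s'. t \<le> length X * (200 * k + 204) + 60 * length Y + 20 * k + 100 \<and>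
     result s' = (if dp w X Y (length X) (length Y) \<le> real k then ereal (dp w X Y (length X) (length Y)) else \<infinity>))
     (mkst f g h q)"
proof -
  define f1 where "f1 = f(30 := 0, 31 := 0)"
  define h1 where "h1 = h(2 := real k, 1 := real k + 1)"
  have 1: "wp W v dp_cap (\<lambda>t s'. t \<le> 20 * k + 30 \<and> s' = mkst f1 g h1 q) (mkst f g h q)"
    unfolding f1_def h1_def using assms by (intro wp_dp_cap)
  have S: "dp_state X Y f1 g h1" unfolding dp_state_def using assms by (simp add: f1_def h1_def)
  define P where "P s' \<longleftrightarrow> (\<exists>f' h' q'. s' = mkst f' g h' q' \<and> dp_state X Y f' g h' \<and> f' 30 = f1 30 \<and>
     row_done X Y 0 (q' 0))" for s'
  define R where "R s' \<longleftrightarrow> (\<exists>f' h' q'. s' = mkst f' g h' q' \<and> dp_state X Y f' g h' \<and>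
     row_done X Y (length X) (q' 0))" for s'
  have 2: "wp W v (While (WLess (WVar 31) (WVar 7)) dp_first_cell) (\<lambda>t s'. t \<le> 60 * length Y + 4 \<and> P s') (mkst f1 g h1 q)"
    unfolding P_def by (rule wp_dp_first_row[of X Y f1 g h1 q, OF S]) (simp_all add: f1_def assms)
  have 3: "wp W v (While (WLess (WVar 30) (WVar 6)) dp_row) (\<lambda>t s'. t \<le> length X * (200 * k + 204) + 4 \<and> R s') s1"
    if "P s1" for s1
  proof -
    from that obtain f' h' q' where st: "s1 = mkst f' g h' q'" "dp_state X Y f' g h'" "f' 30 = 0"
      "row_done X Y 0 (q' 0)" unfolding P_def f1_def by auto
    show ?thesis unfolding R_def st(1) by (rule wp_dp_rows[of X Y f' g h' q', OF st(2,3) f(6) st(4)])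
  qed
  have 4: "wp W v (Seq (RAssign 0 (RArr 0 (WVar 7)))
      (Cond (RLess (RVar 2) (RVar 0)) (WAssign 0 (WConst 0)) (WAssign 0 (WConst 1))))
      (\<lambda>t s'. t \<le> 20 \<and>
     result s' = (if dp w X Y (length X) (length Y) \<le> real k then ereal (dp w X Y (length X) (length Y)) else \<infinity>)) s1"
    if "R s1" for s1
  proof -
    from that obtain f' h' q' where st: "s1 = mkst f' g h' q'" and S: "dp_state X Y f' g h'"
      "row_done X Y (length X) (q' 0)" unfolding R_def by blast
    have "q' 0 (f' 7) = capped X Y (length X) (length Y)" "h' 2 = real k"
      using S f(6) by (simp_all add: row_done_def dp_state_def)
    then show ?thesis unfolding st
      by (simp add: wp_Seq wp_RAssign wp_Cond wp_WAssign result_def capped_def min_def)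
  qed
  show ?thesis unfolding dp_prog_def
    by (rule wp_conseq[OF wp_Seq_exact[OF 1 wp_Seq_le[OF 2 wp_Seq_le[OF 3 4]]]]) auto
qed

end


section \<open>The algorithm\<close>

definition set_constants :: com where
  "set_constants = Seq (WAssign 10 (WOp Add (WVar 2) (WVar 2))) (Seq (WAssign 11 (WOp Add (WVar 10) (WVar 10)))
     (Seq (WAssign 13 (WOp Mul (WConst 8) (WOp Mul (WVar 2) (WVar 2))))
     (Seq (WAssign 3 (WOp Add (WVar 11) (WVar 2))) (WAssign 9 (WOp Add (WVar 3) (WConst 5))))))"

text \<open>If the window would still fit into \<open>X\<close>, the step limit was exhausted and
  the answer is infinite. Otherwise copying the unread suffixes completes the kernel.\<close>

definition finish :: com where
  "finish = Cond (WLess (WOp Add (WVar 3) (WVar 10)) (WVar 0)) (WAssign 0 (WConst 0))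
     (Seq (copy 0 2 4 0 6) (Seq (copy 1 3 5 1 7) dp_prog))"

text \<open>The initial test rejects strings whose length difference alone exceeds \<open>k\<close>;
  afterwards the final cell lies inside the band.\<close>

definition edit_distance_prog :: com where
  "edit_distance_prog = Cond (BAnd (BNot (WLess (WOp Add (WVar 1) (WVar 2)) (WVar 0)))
       (BNot (WLess (WOp Add (WVar 0) (WVar 2)) (WVar 1))))
     (Seq set_constants (Seq (While kernel_cond kernel_step) finish)) (WAssign 0 (WConst 0))"

context kernel
begin

definition bounded_dp :: "nat list \<Rightarrow> nat list \<Rightarrow> ereal" where
  "bounded_dp X Y = (if dp w X Y (length X) (length Y) \<le> real k then ereal (dp w X Y (length X) (length Y)) else \<infinity>)"

text \<open>Each of the two values serves as a threshold for the other one, which gives both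
  inequalities as soon as one value is at most \<open>k\<close>.\<close>

lemma bounded_dp_cong:
  assumes "\<And>c. c \<le> real k \<Longrightarrow> alignable c X' Y' = alignable c X Y"
  shows "bounded_dp X' Y' = bounded_dp X Y"
proof -
  let ?d = "dp w X Y (length X) (length Y)" and ?d' = "dp w X' Y' (length X') (length Y')"
  have e: "?d' \<le> c \<longleftrightarrow> ?d \<le> c" if "c \<le> real k" for c
    using assms[OF that] by (simp add: alignable_iff_dp)
  show ?thesis
  proof (cases "?d \<le> real k")
    case True
    then have "?d' \<le> real k" using e[of "real k"] by simp
    then have "?d = ?d'" using e[of ?d] e[of ?d'] True by (intro antisym) simp_all
    then show ?thesis by (simp add: bounded_dp_def)
  next
    case False
    then show ?thesis using e[of "real k"] by (simp add: bounded_dp_def)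
  qed
qed

lemma wp_finish:
  assumes inv: "kernel_inv X Y f g" and n: "length X \<le> n" "length Y \<le> n" and ag: "agrees X Y"
    and len: "length X \<le> length Y + k" and stop: "f 3 + 2 * k < f 0 \<longrightarrow> f 8 = 5 * k + 5"
  shows "wp W v finish (\<lambda>t s'. t \<le> (7 * k + (5 * k + 5) * step_growth) * (200 * k + 204) + 100 * n + 20 * k + 200 \<and>
    result s' = bounded_dp X Y) (mkst f g (\<lambda>_. 0) (\<lambda>_ _. 0))"
proof -
  have i: "f 0 = length X" "f 1 = length Y" "slice (g 0) 0 (f 0) = X" "slice (g 1) 0 (f 1) = Y"
    "f 2 = k" "f 10 = 2 * k"
    "(run_step X Y k ^^ f 8) (5 * k) (f 3)" "f 8 \<le> 5 * k + 5" "f 4 \<le> f 3" "f 5 \<le> f 1" "f 4 \<le> f 0"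
    "f 6 + f 5 = f 7 + f 4" "f 6 \<le> f 4" "f 6 + (f 3 - f 4) \<le> 5 * k + f 8 * step_growth"
    "\<And>c. c \<le> real k \<Longrightarrow> alignable c (slice (g 2) 0 (f 6) @ drop (f 4) X) (slice (g 3) 0 (f 7) @ drop (f 5) Y)
        = alignable c X Y"
    "set (slice (g 2) 0 (f 6)) \<subseteq> set X" "set (slice (g 3) 0 (f 7)) \<subseteq> set X \<union> set Y"
    using inv unfolding kernel_inv_def by auto
  have x: "f 3 + 2 * k < 2 ^ W"
  proof (cases "f 8")
    case 0
    then show ?thesis using i(7) word_bounds by simp
  next
    case (Suc t)
    then obtain y where "run_step X Y k y (f 3)" using i(7) by auto
    then show ?thesis using run_step_le[of X Y k y "f 3"] n word_bounds by linarith
  qed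
  show ?thesis
  proof (cases "f 3 + 2 * k < f 0")
    case True
    have "\<not> dp w X Y (length X) (length Y) \<le> real k"
    proof
      assume "dp w X Y (length X) (length Y) \<le> real k"
      then have "alignable (real k) X Y" by (simp add: alignable_iff_dp)
      then obtain cs where "columns X Y cs" "column_cost w cs \<le> real k" unfolding alignable_def by blast
      then show False using number_of_run_steps[OF _ mismatches_le_k k_pos i(7)] stop True by fastforce
    qed
    then show ?thesis using True x i(6)
      by (simp add: finish_def wp_Cond wp_WAssign result_def bounded_dp_def)
  next
    case False
    define X' where "X' = slice (g 2) 0 (f 6) @ drop (f 4) X"
    define Y' where "Y' = slice (g 3) 0 (f 7) @ drop (f 5) Y"
    have le: "f 7 \<le> f 5" using i(12,13) by linarith
    have lX: "length X' = f 6 + (f 0 - f 4)" and lY: "length Y' = f 7 + (f 1 - f 5)"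
      by (simp_all add: X'_def Y'_def i(1,2))
    have nX: "length X' \<le> n" "length Y' \<le> n" "length X' \<le> length Y' + k"
      unfolding lX lY using i(1,2,10-13) n le len by linarith+
    have W: "f 0 < 2 ^ W" "f 1 < 2 ^ W" "length X' < 2 ^ W" "length Y' < 2 ^ W"
      using nX n i(1,2) word_bounds by linarith+
    \<comment> \<open>Besides the contributions of the search steps, the kernel contains the initial
      \<open>5 * k\<close> letters and at most \<open>2 * k\<close> letters behind the last search
      position.\<close>
    have size: "length X' \<le> 7 * k + (5 * k + 5) * step_growth"
    proof -
      have "f 8 * step_growth \<le> (5 * k + 5) * step_growth" using i(8) by (rule mult_le_mono1)
      then show ?thesis unfolding lX using i(9,14) False by linarith
    qed
    define f1 where "f1 = f(4 := f 0, 6 := length X')"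
    define f2 where "f2 = f1(5 := f 1, 7 := length Y')"
    define g1 where "g1 = g(2 := paste (g 0) (f 4) (f 0 - f 4) (g 2) (f 6))"
    define g2 where "g2 = g1(3 := paste (g 1) (f 5) (f 1 - f 5) (g 3) (f 7))"
    have 1: "wp W v (copy 0 2 4 0 6) (\<lambda>t s'. t \<le> 16 * n + 4 \<and> s' = mkst f1 g1 (\<lambda>_. 0) (\<lambda>_ _. 0))
        (mkst f g (\<lambda>_. 0) (\<lambda>_ _. 0))"
    proof (rule wp_conseq[OF wp_copy])
      fix t s' assume "t \<le> 16 * (f 0 - f 4) + 4 \<and>
        s' = mkst (f(4 := f 0, 6 := f 6 + (f 0 - f 4))) (g(2 := paste (g 0) (f 4) (f 0 - f 4) (g 2) (f 6)))
          (\<lambda>_. 0) (\<lambda>_ _. 0)"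
      moreover have "f 0 - f 4 \<le> n" using n i(1) by linarith
      ultimately show "t \<le> 16 * n + 4 \<and> s' = mkst f1 g1 (\<lambda>_. 0) (\<lambda>_ _. 0)"
        unfolding f1_def g1_def lX by simp
    qed (use W i(11) lX in simp_all)
    have 2: "wp W v (copy 1 3 5 1 7) (\<lambda>t s'. t \<le> 16 * n + 4 \<and> s' = mkst f2 g2 (\<lambda>_. 0) (\<lambda>_ _. 0))
        (mkst f1 g1 (\<lambda>_. 0) (\<lambda>_ _. 0))"
    proof (rule wp_conseq[OF wp_copy])
      fix t s' assume "t \<le> 16 * (f1 1 - f1 5) + 4 \<and>
        s' = mkst (f1(5 := f1 1, 7 := f1 7 + (f1 1 - f1 5)))
          (g1(3 := paste (g1 1) (f1 5) (f1 1 - f1 5) (g1 3) (f1 7))) (\<lambda>_. 0) (\<lambda>_ _. 0)"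
      moreover have "f 1 - f 5 \<le> n" using n i(2) by linarith
      ultimately show "t \<le> 16 * n + 4 \<and> s' = mkst f2 g2 (\<lambda>_. 0) (\<lambda>_ _. 0)"
        unfolding f2_def g2_def lY by (simp add: f1_def g1_def)
    qed (use W i(10) lY in \<open>simp_all add: f1_def\<close>)
    have "slice (g2 2) 0 (f2 6) = X'" "slice (g2 3) 0 (f2 7) = Y'"
    proof -
      have "drop (f 4) X = slice (g 0) (f 4) (f 0)" "drop (f 5) Y = slice (g 1) (f 5) (f 1)"
        using i(3,4) drop_slice[of "f 4" "g 0" 0 "f 0"] drop_slice[of "f 5" "g 1" 0 "f 1"] by simp_all
      then show "slice (g2 2) 0 (f2 6) = X'" "slice (g2 3) 0 (f2 7) = Y'"
        using slice_paste_append[of 0 "f 6" "g 0" "f 4" "f 0 - f 4" "g 2"]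
          slice_paste_append[of 0 "f 7" "g 1" "f 5" "f 1 - f 5" "g 3"] i(10,11)
        unfolding X'_def Y'_def by (simp_all add: g2_def g1_def f2_def f1_def lX lY)
    qed
    moreover have "agrees X' Y'"
    proof -
      have "set X' \<union> set Y' \<subseteq> set X \<union> set Y"
        using i(16,17) set_drop_subset[of "f 4" X] set_drop_subset[of "f 5" Y] by (auto simp: X'_def Y'_def)
      then show ?thesis using ag unfolding agrees_def ext_alphabet_def by blast
    qed
    ultimately have 3: "wp W v dp_prog (\<lambda>t s'. t \<le> length X' * (200 * k + 204) + 60 * length Y' + 20 * k + 100 \<and>
        result s' = bounded_dp X' Y') (mkst f2 g2 (\<lambda>_. 0) (\<lambda>_ _. 0))"
      unfolding bounded_dp_def using nX i(5) by (intro wp_dp_prog) (simp_all add: f2_def f1_def)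
    have eq: "bounded_dp X' Y' = bounded_dp X Y"
      unfolding X'_def Y'_def by (rule bounded_dp_cong) (rule i(15))
    have "length X' * (200 * k + 204) \<le> (7 * k + (5 * k + 5) * step_growth) * (200 * k + 204)"
      using size by (rule mult_le_mono1)
    then have time: "16 * n + 4 + (16 * n + 4 + (length X' * (200 * k + 204) + 60 * length Y' + 20 * k + 100)) + 10
        \<le> (7 * k + (5 * k + 5) * step_growth) * (200 * k + 204) + 100 * n + 20 * k + 200"
      using nX(2) by linarith
    have "wp W v (Seq (copy 0 2 4 0 6) (Seq (copy 1 3 5 1 7) dp_prog))
      (\<lambda>t s'. t \<le> 16 * n + 4 + (16 * n + 4 + (length X' * (200 * k + 204) + 60 * length Y' + 20 * k + 100)) \<and>
        result s' = bounded_dp X' Y') (mkst f g (\<lambda>_. 0) (\<lambda>_ _. 0))"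
      by (rule wp_Seq_exact[OF 1 wp_Seq_exact[OF 2 3]])
    moreover have "\<not> bval W v (mkst f g (\<lambda>_. 0) (\<lambda>_ _. 0)) (WLess (WOp Add (WVar 3) (WVar 10)) (WVar 0))"
      using False x i(6) by simp
    ultimately show ?thesis unfolding finish_def wp_Cond
      using time eq by (auto elim!: wp_conseq)
  qed
qed

text \<open>The kernel consists of \<open>O(k)\<close> steps of \<open>O(k^3)\<close> letters each,
  and the band multiplies its length by \<open>O(k)\<close>; the search contributes only
  \<open>O(k^3)\<close>.\<close>

lemma polynomial_bound:
  "(7 * k + (5 * k + 5) * step_growth) * (200 * k + 204) + 3000 * (k * k) * (5 * k + 5) + 20 * k \<le> 260000 * k ^ 5"
proof -
  have le: "k \<le> k ^ 3" "k * k \<le> k ^ 3" "1 \<le> k ^ 3" "k \<le> k ^ 4" "k ^ 3 \<le> k ^ 5" "k \<le> k ^ 5"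
    using k_pos power_increasing[of 1 3 k] power_increasing[of 2 3 k] power_increasing[of 1 4 k]
      power_increasing[of 3 5 k] power_increasing[of 1 5 k]
    by (simp_all add: power2_eq_square)
  have k1: "1 \<le> k" using k_pos by simp
  have "step_growth = 16 * k ^ 3 + 28 * (k * k) + 8 * k + 1"
    unfolding step_growth_def by (simp add: algebra_simps power3_eq_cube)
  then have g: "step_growth \<le> 53 * k ^ 3" using le by linarith
  have "(5 * k + 5) * step_growth \<le> (10 * k) * (53 * k ^ 3)" using k1 g by (intro mult_le_mono) simp_all
  also have "\<dots> = 530 * k ^ 4" by (simp add: power4_eq_xxxx power3_eq_cube)
  finally have "7 * k + (5 * k + 5) * step_growth \<le> 537 * k ^ 4" using le(4) by linarith
  then have "(7 * k + (5 * k + 5) * step_growth) * (200 * k + 204) \<le> (537 * k ^ 4) * (404 * k)"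
    using k1 by (intro mult_le_mono) simp_all
  also have "\<dots> = 216948 * (k ^ 4 * k)" by simp
  also have "k ^ 4 * k = k ^ 5" using power_Suc2[of k 4] by simp
  finally have a: "(7 * k + (5 * k + 5) * step_growth) * (200 * k + 204) \<le> 216948 * k ^ 5" .
  have "3000 * (k * k) * (5 * k + 5) \<le> 3000 * (k * k) * (10 * k)" using k1 by (intro mult_le_mono2) simp
  also have "\<dots> = 30000 * k ^ 3" by (simp add: power3_eq_cube)
  finally show ?thesis using a le by linarith
qed

lemma wp_edit_distance_prog:
  assumes n: "length X \<le> n" "length Y \<le> n" and ag: "agrees X Y"
  shows "wp W v edit_distance_prog (\<lambda>t s'. t \<le> 300000 * (n + k ^ 5) \<and> result s' = bounded_dp X Y) (input_state X Y k)"
proof -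
  define f :: "nat \<Rightarrow> nat" where "f = (\<lambda>_. 0)(0 := length X, 1 := length Y, 2 := k)"
  define g :: "nat \<Rightarrow> nat \<Rightarrow> nat" where "g = (\<lambda>_ _. 0)(0 := (\<lambda>i. if i < length X then X ! i else 0),
     1 := (\<lambda>i. if i < length Y then Y ! i else 0))"
  have st: "input_state X Y k = mkst f g (\<lambda>_. 0) (\<lambda>_ _. 0)" by (simp add: input_state_def f_def g_def)
  have k5: "1 \<le> k ^ 5" using k_pos by simp
  have W: "length Y + k < 2 ^ W" "length X + k < 2 ^ W" using n word_bounds by linarith+
  let ?b = "BAnd (BNot (WLess (WOp Add (WVar 1) (WVar 2)) (WVar 0)))
       (BNot (WLess (WOp Add (WVar 0) (WVar 2)) (WVar 1)))"
  have b: "bval W v (mkst f g (\<lambda>_. 0) (\<lambda>_ _. 0)) ?b \<longleftrightarrow> length X \<le> length Y + k \<and> length Y \<le> length X + k"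
    using W by (auto simp: f_def)
  show ?thesis
  proof (cases "length X \<le> length Y + k \<and> length Y \<le> length X + k")
    case False
    then have "\<not> dp w X Y (length X) (length Y) \<le> real k"
      using length_diff_le_dp[of "length X" X "length Y" Y] by auto
    then show ?thesis unfolding st edit_distance_prog_def wp_Cond using False b k5
      by (auto simp: wp_WAssign result_def bounded_dp_def f_def)
  next
    case True
    define f1 where "f1 = f(10 := 2 * k, 11 := 4 * k, 13 := 8 * (k * k), 3 := 5 * k, 9 := 5 * k + 5)"
    have W': "2 * k < 2 ^ W" "4 * k < 2 ^ W" "8 * (k * k) < 2 ^ W" "k * k < 2 ^ W" "8 < (2 :: nat) ^ W"
      "5 * k < 2 ^ W" "5 * k + 5 < 2 ^ W" "5 < (2 :: nat) ^ W"
      using word_bounds by linarith+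
    have 1: "wp W v set_constants (\<lambda>t s'. t \<le> 30 \<and> s' = mkst f1 g (\<lambda>_. 0) (\<lambda>_ _. 0)) (mkst f g (\<lambda>_. 0) (\<lambda>_ _. 0))"
    proof -
      have "f 2 = k" by (simp add: f_def)
      then show ?thesis unfolding set_constants_def f1_def
        using W' by (simp add: wp_Seq wp_WAssign mult_2[symmetric] add.commute[of _ k])
    qed
    have X: "slice (g 0) 0 (length X) = X" "slice (g 1) 0 (length Y) = Y"
      by (auto simp: g_def intro!: nth_equalityI)
    have inv: "kernel_inv X Y f1 g"
      unfolding kernel_inv_def using X by (simp add: f1_def f_def)
    have pot: "kernel_potential f1 \<le> 3000 * (k * k) * (5 * k + 5) + 740 * n"
    proof -
      have "kernel_potential f1 = 3000 * (k * k) * (5 * k + 5) + 700 * (length X - 5 * k) + 20 * length X + 20 * length Y"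
        by (simp add: kernel_potential_def f1_def f_def)
      then show ?thesis using n by linarith
    qed
    define P where "P s' \<longleftrightarrow> (\<exists>f' g'. s' = mkst f' g' (\<lambda>_. 0) (\<lambda>_ _. 0) \<and> kernel_inv X Y f' g' \<and>
        (f' 3 + 2 * k < f' 0 \<longrightarrow> f' 8 = 5 * k + 5))" for s'
    have 2: "wp W v (While kernel_cond kernel_step) (\<lambda>t s'. t \<le> kernel_potential f1 + 10 \<and> P s') (mkst f1 g (\<lambda>_. 0) (\<lambda>_ _. 0))"
      unfolding P_def by (rule wp_kernel_loop[OF inv n])
    have 3: "wp W v finish (\<lambda>t s'. t \<le> (7 * k + (5 * k + 5) * step_growth) * (200 * k + 204) + 100 * n + 20 * k + 200 \<and>
      result s' = bounded_dp X Y) s'" if "P s'" for s'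
      using that wp_finish[OF _ n ag conjunct1[OF True]] unfolding P_def by blast
    have "wp W v (Seq set_constants (Seq (While kernel_cond kernel_step) finish))
      (\<lambda>t s'. t \<le> 30 + (kernel_potential f1 + 10 + ((7 * k + (5 * k + 5) * step_growth) * (200 * k + 204) + 100 * n + 20 * k + 200))
        \<and> result s' = bounded_dp X Y) (mkst f g (\<lambda>_. 0) (\<lambda>_ _. 0))"
      by (rule wp_Seq_exact[OF 1 wp_Seq_le[OF 2 3]])
    moreover have "20 + (30 + (kernel_potential f1 + 10 +
        ((7 * k + (5 * k + 5) * step_growth) * (200 * k + 204) + 100 * n + 20 * k + 200))) \<le> 300000 * (n + k ^ 5)"
      using pot polynomial_bound k5 unfolding distrib_left by linarith
    moreover have "1 + btime ?b \<le> 20" by simp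
    ultimately show ?thesis unfolding st edit_distance_prog_def wp_Cond if_P[OF b[THEN iffD2, OF True]]
      by (elim wp_conseq) linarith
  qed
qed

end

text \<open>Of the exponent 8, the factor \<open>?N ^ 6\<close> is at least 64 and absorbs the
  constant 20, while \<open>?N ^ 2\<close> dominates \<open>n + k + k * k + 1\<close>.\<close>

lemma word_size_bound:
  assumes "word_size_ok 8 W n k" "0 < k"
  shows "20 * (n + k + k * k + 1) < 2 ^ W"
proof -
  let ?N = "n + k + 1"
  have "8 * log 2 (real ?N) \<le> real W" using assms(1) by (simp add: word_size_ok_def)
  then have "2 powr (8 * log 2 (real ?N)) \<le> 2 powr real W" by simp
  also have "2 powr (8 * log 2 (real ?N)) = real ?N ^ 8"
    by (simp add: powr_powr[symmetric] mult.commute[of 8] powr_numeral)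
  also have "2 powr real W = 2 ^ W" by (simp add: powr_realpow)
  finally have "real (?N ^ 8) \<le> real (2 ^ W)" by simp
  then have N8: "?N ^ 8 \<le> 2 ^ W" by (simp only: of_nat_le_iff)
  have "2 ^ 6 \<le> ?N ^ 6" using assms(2) by (intro power_mono) simp_all
  then have "64 * ?N ^ 2 \<le> ?N ^ 6 * ?N ^ 2" by (intro mult_le_mono1) simp
  also have "\<dots> = ?N ^ 8" by (simp flip: power_add)
  finally have "64 * ?N ^ 2 \<le> 2 ^ W" using N8 by simp
  moreover have "n + k + k * k + 1 \<le> ?N ^ 2" by (simp add: power2_eq_square algebra_simps)
  then have "20 * (n + k + k * k + 1) \<le> 20 * ?N ^ 2" by (rule mult_le_mono2)
  moreover have "0 < ?N ^ 2" by simp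
  then have "20 * ?N ^ 2 < 64 * ?N ^ 2" by (intro mult_strict_right_mono) simp_all
  ultimately show ?thesis by (meson le_less_trans less_le_trans)
qed

theorem theorem1p1:
  shows "\<exists>(P :: com) (C :: nat) (c :: nat). c \<ge> 1 \<and>
    (\<forall>(W :: nat) (n :: nat) (k :: nat) (\<Sigma> :: nat set) (X :: nat list) (Y :: nat list) (w :: nat weight).
       k > 0 \<and> word_size_ok c W n k \<and> \<Sigma> \<subseteq> {..<2 ^ W} \<and>
       set X \<subseteq> \<Sigma> \<and> set Y \<subseteq> \<Sigma> \<and> length X \<le> n \<and> length Y \<le> n \<and> weight_function \<Sigma> w \<longrightarrow>
       (\<exists>t s. exec W w P (input_state X Y k) t s \<and> result s = ed_le w k X Y \<and>
              t \<le> C * (n + k ^ 5)))"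
proof (rule exI[of _ edit_distance_prog], rule exI[of _ 300000], rule exI[of _ 8], intro conjI allI impI)
  fix W n k :: nat and \<Sigma> :: "nat set" and X Y :: "nat list" and w :: "nat weight"
  assume a: "k > 0 \<and> word_size_ok 8 W n k \<and> \<Sigma> \<subseteq> {..<2 ^ W} \<and>
       set X \<subseteq> \<Sigma> \<and> set Y \<subseteq> \<Sigma> \<and> length X \<le> n \<and> length Y \<le> n \<and> weight_function \<Sigma> w"
  \<comment> \<open>The axioms hold on the alphabet only, so the weight is completed by 0 for equal
    arguments and by the least admissible value 1 elsewhere; the program still queries the original
    \<open>w\<close>.\<close>
  define w' :: "nat weight" where
    "w' x y = (if x = y then 0 else if x \<in> ext_alphabet \<Sigma> \<and> y \<in> ext_alphabet \<Sigma> then w x y else 1)" for x y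
  interpret kernel w' k W n w
  proof
    show "w' x x = 0" for x by (simp add: w'_def)
    show "1 \<le> w' x y" if "x \<noteq> y" for x y
      using that a by (auto simp: w'_def weight_function_def)
    show "0 < k" "20 * (n + k + k * k + 1) < 2 ^ W" using a word_size_bound by blast+
  qed
  have "ext_alphabet (set X \<union> set Y) \<subseteq> ext_alphabet \<Sigma>" using a unfolding ext_alphabet_def by blast
  then have eq: "w x y = w' x y" if "x \<in> ext_alphabet (set X \<union> set Y)" "y \<in> ext_alphabet (set X \<union> set Y)" for x y
    using that a by (auto simp: w'_def weight_function_def)
  then have "agrees X Y" by (simp add: agrees_def)
  then have "wp W w edit_distance_prog (\<lambda>t s'. t \<le> 300000 * (n + k ^ 5) \<and> result s' = bounded_dp X Y) (input_state X Y k)"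
    using a by (intro wp_edit_distance_prog) simp_all
  moreover have "bounded_dp X Y = ed_le w k X Y"
    unfolding bounded_dp_def ed_le_def ed_eq_dp
    using dp_cong[of X Y w w' "length X" "length Y"] eq by simp
  ultimately show "\<exists>t s. exec W w edit_distance_prog (input_state X Y k) t s \<and> result s = ed_le w k X Y \<and>
      t \<le> 300000 * (n + k ^ 5)" unfolding wp_def by auto
qed simp

end
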